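(* Let $\mathcal{D} \subset Gl(d,\mathbb{R})$, let $\Gamma \subset \mathbb{R}^d$ be a (full-rank) lattice, and let $k \in \mathbb{N}$, $k\ge 1$. Let $W \subset \mathbb{R}^d$ be a bounded Borel set whose boundary has Lebesgue measure zero. If $W$ is translationally $k$-tiling with respect to $\Gamma$ and multiplicatively tiling with respect to $\mathcal{D}^{-T} = \{A^{-T} : A \in \mathcal{D}\}$, then there exists a set $\Lambda \subset \mathbb{R}^d$ such that $W$ is a $(\Lambda,\mathcal{D})$-Riesz-wavelet set.
   Context: A full-rank lattice in $\mathbb{R}^d$ is a set $\Gamma = L\mathbb{Z}^d$ with $L \in Gl(d,\mathbb{R})$. $A^{-T}$ is the transpose inverse of $A$, and $AW = \{Ax : x \in W\}$. $W$ is translationally $k$-tiling w.r.t. $\Gamma$ if $\sum_{\gamma\in\Gamma} \mathbb{1}_{\gamma+W}(\xi) = k$ for almost every $\xi\in\mathbb{R}^d$. $W$ is multiplicatively tiling w.r.t. a set $\mathcal{D}' \subset Gl(d,\mathbb{R})$ if $\sum_{A\in\mathcal{D}'} \mathbb{1}_{AW}(\xi) = 1$ for almost every $\xi\in\mathbb{R}^d$. A Riesz basis of a Hilbert space $\mathcal{H}$ is a family $(g_i)_{i\in I}$ spanning a dense subspace for which there are constants $0<C_1\le C_2$ with $C_1\sum_i |c_i|^2 \le \|\sum_i c_i g_i\|^2 \le C_2 \sum_i |c_i|^2$ for all finitely supported complex families $(c_i)_{i\in I}$. On $L^2(\mathbb{R}^d)$ put $(T_\lambda f)(x) = f(x-\lambda)$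 for $\lambda\in\mathbb{R}^d$ and $(D_A f)(x) = |\det A|^{-1/2} f(A^{-1}x)$ for $A\in Gl(d,\mathbb{R})$. The Fourier transform is the unitary operator on $L^2(\mathbb{R}^d)$ given by $\widehat{f}(\zeta)=\int_{\mathbb{R}^d} f(x)e^{-2\pi i\langle \zeta,x\rangle}dx$ for $f\in L^1\cap L^2$. A function $\psi \in L^2(\mathbb{R}^d)$ is a $(\Lambda,\mathcal{D})$-Riesz-wavelet if $(D_A T_\lambda \psi)_{A\in\mathcal{D},\lambda\in\Lambda}$ is a Riesz basis of $L^2(\mathbb{R}^d)$. A Borel set $W$ is a $(\Lambda,\mathcal{D})$-Riesz-wavelet set if $\psi$ with $\widehat{\psi} = c_\psi \mathbb{1}_W$ (with $c_\psi \neq 0$ a normalization constant) is a $(\Lambda,\mathcal{D})$-Riesz-wavelet. *)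

theory Defs
  imports "HOL-Analysis.Analysis"
begin

definition full_rank_lattice :: "(real ^ 'n) set \<Rightarrow> bool" where
  "full_rank_lattice \<Gamma> \<longleftrightarrow>
     (\<exists>L :: real ^ 'n ^ 'n. invertible L \<and> \<Gamma> = (*v) L ` {z. \<forall>i. z $ i \<in> \<int>})"

text \<open>
  The sums over the index sets below are sums of real numbers; \<^const>\<open>has_sum\<close> includes their
  convergence, so for indicators a value \<open>k\<close> says that exactly \<open>k\<close> of the summands are nonzero.
\<close>

definition translationally_tiling ::
  "nat \<Rightarrow> (real ^ 'n) set \<Rightarrow> (real ^ 'n) set \<Rightarrow> bool" where
  "translationally_tiling k \<Gamma> W \<longleftrightarrow>
     (AE \<xi> in lborel.
        ((\<lambda>\<gamma>. indicator ((+) \<gamma> ` W) \<xi> :: real) has_sum real k) \<Gamma>)"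

definition multiplicatively_tiling ::
  "(real ^ 'n ^ 'n) set \<Rightarrow> (real ^ 'n) set \<Rightarrow> bool" where
  "multiplicatively_tiling D' W \<longleftrightarrow>
     (AE \<xi> in lborel.
        ((\<lambda>A. indicator ((*v) A ` W) \<xi> :: real) has_sum 1) D')"

text \<open>
  Elements of \<open>L\<^sup>2(\<real>\<^sup>d)\<close> are represented by Borel measurable functions, not by classes modulo
  almost everywhere equality, so \<open>L2_norm\<close> is only a seminorm on \<open>L2\<close>. No notion below
  distinguishes functions that agree almost everywhere. On functions outside \<open>L2\<close> the value of
  \<open>L2_norm\<close> is meaningless; it is used only on members of \<open>L2\<close>.
\<close>

definition L2 :: "(real ^ 'n \<Rightarrow> complex) set" where
  "L2 = {f. f \<in> borel_measurable lborel \<and> integrable lborel (\<lambda>x. (cmod (f x))\<^sup>2)}"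

definition L2_norm :: "(real ^ 'n \<Rightarrow> complex) \<Rightarrow> real" where
  "L2_norm f = sqrt (\<integral>x. (cmod (f x))\<^sup>2 \<partial>lborel)"

text \<open>
  In both inequalities and in the density condition, a finitely supported family is given by a
  finite set \<open>F\<close> containing its support and coefficients on \<open>F\<close>.
\<close>

definition riesz_basis_L2 :: "'i set \<Rightarrow> ('i \<Rightarrow> real ^ 'n \<Rightarrow> complex) \<Rightarrow> bool" where
  "riesz_basis_L2 I g \<longleftrightarrow>
     (\<forall>i\<in>I. g i \<in> L2) \<and>
     (\<forall>f\<in>L2. \<forall>\<epsilon>>0. \<exists>F c. finite F \<and> F \<subseteq> I \<and>
        L2_norm (\<lambda>x. f x - (\<Sum>i\<in>F. c i * g i x)) < \<epsilon>) \<and>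
     (\<exists>C1 C2. 0 < C1 \<and> C1 \<le> C2 \<and>
        (\<forall>F c. finite F \<and> F \<subseteq> I \<longrightarrow>
           C1 * (\<Sum>i\<in>F. (cmod (c i))\<^sup>2) \<le> (L2_norm (\<lambda>x. \<Sum>i\<in>F. c i * g i x))\<^sup>2 \<and>
           (L2_norm (\<lambda>x. \<Sum>i\<in>F. c i * g i x))\<^sup>2 \<le> C2 * (\<Sum>i\<in>F. (cmod (c i))\<^sup>2)))"

definition translation :: "real ^ 'n \<Rightarrow> (real ^ 'n \<Rightarrow> complex) \<Rightarrow> real ^ 'n \<Rightarrow> complex" where
  "translation l f = (\<lambda>x. f (x - l))"

definition dilation :: "real ^ 'n ^ 'n \<Rightarrow> (real ^ 'n \<Rightarrow> complex) \<Rightarrow> real ^ 'n \<Rightarrow> complex" where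
  "dilation A f = (\<lambda>x. of_real (\<bar>det A\<bar> powr (- 1 / 2)) * f (matrix_inv A *v x))"

definition fourier_integral :: "(real ^ 'n \<Rightarrow> complex) \<Rightarrow> real ^ 'n \<Rightarrow> complex" where
  "fourier_integral f \<zeta> =
     (\<integral>x. f x * exp (- 2 * of_real pi * \<i> * of_real (\<zeta> \<bullet> x)) \<partial>lborel)"

text \<open>
  \<open>is_fourier_transform f h\<close> says that \<open>h\<close> represents the Fourier transform of the class of \<open>f\<close>.
  The unitary operator is the continuous extension of \<open>fourier_integral\<close> from \<open>L\<^sup>1 \<inter> L\<^sup>2\<close>
  to \<open>L\<^sup>2\<close>, so its graph is the closure in \<open>L\<^sup>2 \<times> L\<^sup>2\<close> of the graph of \<open>fourier_integral\<close>.
  By Plancherel's theorem the requirement \<open>fourier_integral (u n) \<in> L2\<close> holds automatically.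
\<close>

definition is_fourier_transform ::
  "(real ^ 'n \<Rightarrow> complex) \<Rightarrow> (real ^ 'n \<Rightarrow> complex) \<Rightarrow> bool" where
  "is_fourier_transform f h \<longleftrightarrow> f \<in> L2 \<and> h \<in> L2 \<and>
     (\<exists>u :: nat \<Rightarrow> real ^ 'n \<Rightarrow> complex.
        (\<forall>n. integrable lborel (u n) \<and> u n \<in> L2 \<and> fourier_integral (u n) \<in> L2) \<and>
        (\<lambda>n. L2_norm (\<lambda>x. u n x - f x)) \<longlonglongrightarrow> 0 \<and>
        (\<lambda>n. L2_norm (\<lambda>\<zeta>. fourier_integral (u n) \<zeta> - h \<zeta>)) \<longlonglongrightarrow> 0)"

definition riesz_wavelet ::
  "(real ^ 'n) set \<Rightarrow> (real ^ 'n ^ 'n) set \<Rightarrow> (real ^ 'n \<Rightarrow> complex) \<Rightarrow> bool" where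
  "riesz_wavelet \<Lambda> D \<psi> \<longleftrightarrow> \<psi> \<in> L2 \<and>
     riesz_basis_L2 (D \<times> \<Lambda>) (\<lambda>(A, l). dilation A (translation l \<psi>))"

text \<open>
  For \<open>W\<close> of finite measure and \<open>c\<close> fixed, \<open>\<psi>\<close> exists and is unique up to null sets, since the
  Fourier transform is unitary; and the Riesz basis property does not depend on \<open>c \<noteq> 0\<close>.
  The existential form makes the existence of \<open>\<psi>\<close> part of the assertion.
\<close>

definition riesz_wavelet_set ::
  "(real ^ 'n) set \<Rightarrow> (real ^ 'n ^ 'n) set \<Rightarrow> (real ^ 'n) set \<Rightarrow> bool" where
  "riesz_wavelet_set \<Lambda> D W \<longleftrightarrow> W \<in> sets borel \<and>
     (\<exists>c \<psi>. c \<noteq> 0 \<and> is_fourier_transform \<psi> (\<lambda>\<zeta>. c * indicator W \<zeta>) \<and> riesz_wavelet \<Lambda> D \<psi>)"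

end

theory Submission
  imports Defs
begin

text \<open>
  The Fourier transform turns \<open>D\<^sub>A T\<^sub>l \<psi>\<close> into \<open>|det A|\<^bsup>1/2\<^esup>\<close> times an exponential in
  \<open>A\<^sup>T \<eta>\<close>, cut off to \<open>A\<^sup>-\<^sup>T W\<close>. The sets \<open>A\<^sup>-\<^sup>T W\<close> tile the space, so everything reduces to finding
  frequencies \<open>\<Lambda>\<close> whose exponentials form a Riesz basis of \<open>L\<^sup>2(W)\<close>.

  For this (following Kolountzakis) let \<open>\<Gamma> = \<int>\<^sup>d\<close> after a linear change of variables, and take
  \<open>\<Lambda> = {j b + l | j < k, l \<in> \<int>\<^sup>d}\<close>. A combination of these exponentials is
  \<open>\<Sum>\<^sub>j e(j b \<cdot> x) P\<^sub>j(x)\<close> with \<open>P\<^sub>j\<close> periodic, and its values at the \<open>k\<close> points of \<open>W\<close> above a point of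
  the unit cube are obtained from the \<open>e(j b \<cdot> x) P\<^sub>j(x)\<close> by a Vandermonde matrix with nodes
  \<open>e(b \<cdot> m)\<close>. As \<open>W\<close> is bounded, only finitely many \<open>m\<close> occur; a generic small \<open>b\<close> separates their
  nodes, and finitely many invertible matrices are uniformly invertible. This compares \<open>L\<^sup>2(W)\<close>
  with \<open>k\<close> copies of \<open>L\<^sup>2\<close> of the cube, where trigonometric polynomials are dense by the
  Stone-Weierstrass theorem.

  Plancherel's theorem for boundedly supported functions follows from Parseval's identity on the
  cube, applied to all modulations \<open>e(- a \<cdot> x) h(x)\<close> and integrated over \<open>a\<close> in the cube.
\<close>

section \<open>Linear changes of variables and periodization\<close>

text \<open>Exponentials restricted to \<open>W\<close> need not be orthogonal, and the points of
  \<open>W\<close> above \<open>x\<close> change with \<open>x\<close>. What rescues the argument is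
  that the Vandermonde matrix depends on \<open>x\<close> only through the pattern of translates, so
  it is piecewise constant; this yields measurable solutions as well as uniform constants. The shift
  \<open>b\<close> has a second task: its multiples \<open>j b\<close> with \<open>j < k\<close>
  must differ modulo \<open>\<int>\<^sup>d\<close>, as otherwise two of the shifted lattices
  coincide. Passing from \<open>W\<close> to all tiles costs nothing in the constants, since almost
  everywhere only one tile contributes and the determinant factor makes each pullback isometric. But
  \<open>D\<close> is an arbitrary set: exhausting the space by finitely many tiles at a time first
  requires that \<open>D\<close> is countable, which comes from the positive measure of
  \<open>W\<close>. Boundedness of \<open>W\<close> keeps the generators on the frequency side
  boundedly supported, so that their transforms are convergent integrals; general functions are
  truncated, once in space and once in frequency. Since translation by \<open>l\<close> becomes
  multiplication by the character of \<open>-l\<close>, the wavelet translations are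
  \<open>-\<Lambda>\<close>.\<close>

lemma matrix_inv:
  fixes A :: "real ^ 'n ^ 'n"
  assumes "invertible A"
  shows "A ** matrix_inv A = mat 1" "matrix_inv A ** A = mat 1"
  using someI_ex[OF assms[unfolded invertible_def]] by (simp_all add: matrix_inv_def)

lemma invertible_mul_matrix_inv:
  fixes A :: "real ^ 'n ^ 'n"
  assumes "invertible A"
  shows "A *v (matrix_inv A *v x) = x" "matrix_inv A *v (A *v x) = x"
  using matrix_inv[OF assms] by (simp_all add: matrix_vector_mul_assoc)

lemma measurable_matrix_vector_mul [measurable]:
  fixes A :: "real ^ 'n ^ 'm"
  shows "(*v) A \<in> borel_measurable borel"
  by (intro borel_measurable_continuous_onI linear_continuous_on matrix_vector_mul_bounded_linear)

text \<open>Boxes determine Lebesgue measure, so it is enough to follow a box. Its preimage is the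
  image under the inverse shear, hence bounded and measurable; that a shear keeps the volume of this
  set is reduced by \<open>measure_linear_sufficient\<close> to closed boxes.\<close>

lemma lborel_shear:
  fixes m n :: "'n :: finite"
  assumes mn: "m \<noteq> n"
  defines "h \<equiv> \<lambda>x :: real ^ 'n. \<chi> i. if i = m then x $ m + x $ n else x $ i"
  shows "lborel = distr lborel borel h"
proof (rule lborel_eqI)
  fix l u :: "real ^ 'n" assume le: "\<And>b. b \<in> Basis \<Longrightarrow> l \<bullet> b \<le> u \<bullet> b"
  define g where "g = (\<lambda>x :: real ^ 'n. \<chi> i. if i = m then x $ m - x $ n else x $ i)"
  have lin: "linear h" "linear g"
    unfolding h_def g_def by (auto intro!: linearI simp: algebra_simps plus_vec_def scaleR_vec_def vec_eq_iff)
  have hg: "h (g x) = x" "g (h x) = x" for x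
    using mn by (auto simp: h_def g_def vec_eq_iff)
  have h_meas [measurable]: "h \<in> borel_measurable borel"
    by (intro borel_measurable_continuous_onI linear_continuous_on) (use lin in \<open>simp add: linear_conv_bounded_linear\<close>)
  have T_eq: "h -` box l u = g ` box l u"
    using hg by (auto simp: image_iff) metis
  have T_borel: "h -` box l u \<in> sets borel"
    using measurable_sets[OF h_meas, of "box l u"] by simp
  have "bounded (h -` box l u)"
    unfolding T_eq using lin by (intro bounded_linear_image) (auto simp: linear_conv_bounded_linear)
  then have T: "h -` box l u \<in> lmeasurable"
    using T_borel by (intro bounded_set_imp_lmeasurable) auto
  have cb: "measure lebesgue (h ` cbox a b) = 1 * measure lebesgue (cbox a b)" for a b
  proof (cases "cbox a b = {}")
    case False
    \<comment> \<open>\<open>measure_shear_interval\<close> wants a nonnegative \<open>n\<close>-th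
      coordinate of the lower corner; \<open>?v\<close> moves that coordinate to 0, and
      \<open>?w\<close> undoes the move after the shear.\<close>
    let ?v = "\<chi> i. if i = n then - a $ n else 0"
    let ?w = "h (- ?v)"
    have ne: "cbox (?v + a) (?v + b) \<noteq> {}"
      using False by (simp add: cbox_translation)
    have "h ` cbox a b = (+) ?w ` h ` (+) ?v ` cbox a b"
      unfolding image_comp o_def by (simp flip: linear_add[OF lin(1)])
    then have "measure lebesgue (h ` cbox a b) = measure lebesgue (h ` (+) ?v ` cbox a b)"
      by (simp only: measure_translation)
    also have "\<dots> = measure lebesgue (h ` cbox (?v + a) (?v + b))"
      by (simp only: cbox_translation)
    also have "\<dots> = measure lebesgue (cbox (?v + a) (?v + b))"
      unfolding h_def by (rule measure_shear_interval) (use mn ne in auto)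
    also have "\<dots> = measure lebesgue (cbox a b)"
      by (simp only: cbox_translation measure_translation)
    finally show ?thesis by simp
  qed simp
  have "measure lebesgue (h ` (h -` box l u)) = 1 * measure lebesgue (h -` box l u)"
    using measure_linear_sufficient[OF lin(1) T cb] by simp
  also have "h ` (h -` box l u) = box l u"
    using hg by (metis surj_def surj_image_vimage_eq)
  finally have *: "measure lebesgue (h -` box l u) = measure lebesgue (box l u)" by simp
  have "emeasure (distr lborel borel h) (box l u) = emeasure lebesgue (h -` box l u)"
    using T_borel by (simp add: emeasure_distr)
  also have "\<dots> = ennreal (measure lebesgue (h -` box l u))"
    using T by (simp add: emeasure_eq_measure2 fmeasurableD2)
  also have "\<dots> = ennreal (measure lebesgue (box l u))" by (simp only: *)
  also have "\<dots> = (\<Prod>b\<in>Basis. (u - l) \<bullet> b)"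
    using le by (simp add: measure_lborel_box_eq inner_diff_left)
  finally show "emeasure (distr lborel borel h) (box l u) = (\<Prod>b\<in>Basis. (u - l) \<bullet> b)" .
qed simp

text \<open>A transposition of coordinates maps boxes to boxes and permutes the factors of their
  volume.\<close>

lemma lborel_swap:
  fixes m n :: "'n :: finite"
  shows "lborel = distr lborel borel (\<lambda>x :: real ^ 'n. \<chi> i. x $ Transposition.transpose m n i)"
    (is "_ = distr _ _ ?h")
proof (rule lborel_eqI)
  fix l u :: "real ^ 'n" assume le: "\<And>b. b \<in> Basis \<Longrightarrow> l \<bullet> b \<le> u \<bullet> b"
  have le': "l $ i \<le> u $ i" for i
    using le[of "axis i 1"] by (simp add: inner_axis axis_in_Basis_iff)
  have lin: "linear ?h"
    by (auto intro!: linearI simp: plus_vec_def scaleR_vec_def)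
  have h_meas [measurable]: "?h \<in> borel_measurable borel"
    by (intro borel_measurable_continuous_onI linear_continuous_on) (use lin in \<open>simp add: linear_conv_bounded_linear\<close>)
  have T: "?h -` box l u = box (?h l) (?h u)"
    by (auto simp: mem_box_cart) (metis transpose_involutory)+
  have prod: "(\<Prod>b\<in>Basis. f b) = (\<Prod>i\<in>UNIV. f (axis i 1))" for f :: "real ^ 'n \<Rightarrow> real"
    by (simp add: Basis_vec_def UNION_singleton_eq_range prod.reindex inj_on_def axis_eq_axis)
  have "emeasure (distr lborel borel ?h) (box l u) = emeasure lborel (box (?h l) (?h u))"
    by (simp add: emeasure_distr T)
  also have "\<dots> = ennreal (\<Prod>b\<in>Basis. (?h u - ?h l) \<bullet> b)"
    using le' by (subst emeasure_lborel_box) (auto simp: Basis_vec_def inner_axis)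
  also have "(\<Prod>b\<in>Basis. (?h u - ?h l) \<bullet> b) = (\<Prod>b\<in>Basis. (u - l) \<bullet> b)"
    using prod.permute[OF permutes_swap_id[of m UNIV n], of "\<lambda>i. (u - l) $ i"]
    by (simp add: prod inner_axis o_def)
  finally show "emeasure (distr lborel borel ?h) (box l u) = (\<Prod>b\<in>Basis. (u - l) \<bullet> b)" by simp
qed simp

text \<open>Determinant and substitution are both multiplicative, so induction over elementary
  matrices works: a zero row is excluded by \<open>det A \<noteq> 0\<close>, a diagonal matrix
  scales the coordinates, and swaps and shears have determinant of modulus 1. \<open>f\<close> stays
  arbitrary because the product case uses the hypothesis on the second factor for \<open>f\<close>
  composed with the first.\<close>

lemma nn_integral_lborel_linear_det:
  fixes A :: "real ^ 'n ^ 'n"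
  assumes "det A \<noteq> 0" "f \<in> borel_measurable borel"
  shows "(\<integral>\<^sup>+x. f x \<partial>lborel) = ennreal \<bar>det A\<bar> * (\<integral>\<^sup>+x. f (A *v x) \<partial>lborel)"
  using assms
proof (induction A arbitrary: f rule: induct_matrix_elementary_alt)
  case (1 A B)
  note [measurable] = 1(4)
  have "det A \<noteq> 0" "det B \<noteq> 0" using 1(3) by (auto simp: det_mul)
  have "(\<integral>\<^sup>+x. f x \<partial>lborel) = ennreal \<bar>det A\<bar> * (\<integral>\<^sup>+x. f (A *v x) \<partial>lborel)"
    by (rule 1) fact+
  also have "(\<integral>\<^sup>+x. f (A *v x) \<partial>lborel) = ennreal \<bar>det B\<bar> * (\<integral>\<^sup>+x. f (A *v (B *v x)) \<partial>lborel)"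
    by (rule 1(2)[OF \<open>det B \<noteq> 0\<close>]) measurable
  finally show ?case
    by (simp add: det_mul abs_mult ennreal_mult mult.assoc matrix_vector_mul_assoc)
next
  case (2 A i)
  then show ?case using det_zero_row(2) by blast
next
  case (3 A)
  note [measurable] = 3(3)
  have det: "det A = (\<Prod>i\<in>UNIV. A $ i $ i)" by (rule det_diagonal) (use 3 in auto)
  define c where "c b = (A *v b) \<bullet> b" for b
  have c_axis: "c (axis i 1) = A $ i $ i" for i
    by (simp add: c_def inner_axis matrix_vector_mult_basis column_def)
  have A_eq: "A *v x = 0 + (\<Sum>j\<in>Basis. (c j * (x \<bullet> j)) *\<^sub>R j)" for x
  proof -
    have "(\<Sum>j\<in>UNIV. A $ i $ j * x $ j) = A $ i $ i * x $ i" for i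
      by (rule trans[OF sum.mono_neutral_right[of UNIV "{i}"]]) (use 3(1) in auto)
    moreover have "(\<Sum>j\<in>Basis. (c j * (x \<bullet> j)) *\<^sub>R j) = (\<Sum>i\<in>UNIV. (A $ i $ i * x $ i) *\<^sub>R axis i 1)"
      by (simp add: Basis_vec_def UNION_singleton_eq_range sum.reindex inj_on_def axis_eq_axis
          c_axis inner_axis)
    moreover have "(\<Sum>i\<in>UNIV. (A $ i $ i * x $ i) *\<^sub>R axis i 1) $ j = A $ j $ j * x $ j" for j
      by (simp add: axis_def if_distrib cong: if_cong)
    ultimately show ?thesis
      by (simp add: vec_eq_iff matrix_vector_mult_def)
  qed
  have c_nz: "c j \<noteq> 0" if "j \<in> Basis" for j
    using that 3(2) by (auto simp: Basis_vec_def c_axis det)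
  from lborel_affine_euclidean[of c 0, OF c_nz]
  have "lborel = density (distr lborel borel ((*v) A)) (\<lambda>_. ennreal (\<Prod>j\<in>Basis. \<bar>c j\<bar>))"
    by (simp only: A_eq[symmetric])
  also have "(\<Prod>j\<in>Basis. \<bar>c j\<bar>) = \<bar>det A\<bar>"
    by (simp add: det Basis_vec_def UNION_singleton_eq_range prod.reindex inj_on_def axis_eq_axis c_axis abs_prod)
  finally have eq: "lborel = density (distr lborel borel ((*v) A)) (\<lambda>_. ennreal \<bar>det A\<bar>)" .
  have "(\<integral>\<^sup>+x. f x \<partial>lborel)
      = (\<integral>\<^sup>+x. f x \<partial>density (distr lborel borel ((*v) A)) (\<lambda>_. ennreal \<bar>det A\<bar>))"
    using eq by simp
  then show ?case
    by (simp add: nn_integral_density nn_integral_distr nn_integral_cmult)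
next
  case (4 m n)
  note [measurable] = 4(3)
  let ?A = "\<chi> i j. mat 1 $ i $ Transposition.transpose m n j :: real ^ 'n ^ 'n"
  let ?h = "\<lambda>x :: real ^ 'n. \<chi> i. x $ Transposition.transpose m n i"
  have A: "?A *v x = ?h x" for x
  proof -
    have "(\<Sum>j\<in>UNIV. mat 1 $ i $ Transposition.transpose m n j * x $ j) = x $ Transposition.transpose m n i" for i
      by (rule trans[OF sum.mono_neutral_right[of UNIV "{Transposition.transpose m n i}"]])
         (auto simp: mat_def transpose_eq_iff)
    then show ?thesis by (simp add: vec_eq_iff matrix_vector_mult_def)
  qed
  have det: "\<bar>det ?A\<bar> = 1"
    by (subst det_permute_columns) (simp_all add: permutes_swap_id sign_swap_id)
  have [measurable]: "?h \<in> borel_measurable borel"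
    using measurable_matrix_vector_mul[of ?A] by (simp only: A[abs_def])
  have "(\<integral>\<^sup>+x. f x \<partial>lborel) = (\<integral>\<^sup>+x. f x \<partial>distr lborel borel ?h)"
    using lborel_swap[of m n] by simp
  then show ?case
    unfolding A det by (simp add: nn_integral_distr)
next
  case (5 m n)
  note [measurable] = 5(3)
  let ?A = "\<chi> i j. of_bool (i = m \<and> j = n \<or> i = j) :: real ^ 'n ^ 'n"
  let ?h = "\<lambda>x :: real ^ 'n. \<chi> i. if i = m then x $ m + x $ n else x $ i"
  have A: "?A *v x = ?h x" for x
  proof -
    have "(\<Sum>j\<in>UNIV. of_bool (m = m \<and> j = n \<or> m = j) * x $ j) = x $ m + x $ n"
      by (rule trans[OF sum.mono_neutral_right[of UNIV "{m, n}"]]) (use 5(1) in auto)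
    moreover have "(\<Sum>j\<in>UNIV. of_bool (i = m \<and> j = n \<or> i = j) * x $ j) = x $ i" if "i \<noteq> m" for i
      by (rule trans[OF sum.mono_neutral_right[of UNIV "{i}"]]) (use that in auto)
    ultimately show ?thesis by (simp add: vec_eq_iff matrix_vector_mult_def)
  qed
  have "?A = (\<chi> k. if k = m then row m (mat 1) + 1 *s row n (mat 1) else row k (mat 1))"
    using 5(1) by (auto simp: vec_eq_iff row_def mat_def)
  then have det: "det ?A = 1"
    using det_row_operation[OF 5(1), of "mat 1 :: real ^ 'n ^ 'n" 1] by simp
  have [measurable]: "?h \<in> borel_measurable borel"
    using measurable_matrix_vector_mul[of ?A] by (simp only: A[abs_def])
  have "(\<integral>\<^sup>+x. f x \<partial>lborel) = (\<integral>\<^sup>+x. f x \<partial>distr lborel borel ?h)"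
    using lborel_shear[OF 5(1)] by simp
  then show ?case
    unfolding A det by (simp add: nn_integral_distr)
qed

lemma nn_integral_lborel_linear:
  fixes A :: "real ^ 'n ^ 'n"
  assumes A: "invertible A" and f: "f \<in> borel_measurable borel"
  shows "(\<integral>\<^sup>+x. f x \<partial>lborel) = ennreal \<bar>det A\<bar> * (\<integral>\<^sup>+x. f (A *v x) \<partial>lborel)"
  using assms by (intro nn_integral_lborel_linear_det) (auto simp: invertible_det_nz)

text \<open>Rephrased as an equation of measures, the substitution rule carries over to Bochner
  integrals and to almost-everywhere statements.\<close>

lemma lborel_linear:
  fixes A :: "real ^ 'n ^ 'n"
  assumes A: "invertible A"
  shows "lborel = density (distr lborel borel ((*v) A)) (\<lambda>_. ennreal \<bar>det A\<bar>)"
proof (rule measure_eqI)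
  fix S :: "(real ^ 'n) set" assume "S \<in> sets lborel"
  then have [measurable]: "S \<in> sets borel" by simp
  show "emeasure lborel S = emeasure (density (distr lborel borel ((*v) A)) (\<lambda>_. ennreal \<bar>det A\<bar>)) S"
    using nn_integral_lborel_linear[OF A, of "indicator S"]
      nn_integral_distr[of "(*v) A" lborel borel "indicator S"]
    by (simp add: emeasure_density nn_integral_cmult)
qed simp

lemma lborel_integral_linear:
  fixes A :: "real ^ 'n ^ 'n" and f :: "real ^ 'n \<Rightarrow> complex"
  assumes A: "invertible A" and f [measurable]: "f \<in> borel_measurable borel"
  shows "(\<integral>x. f x \<partial>lborel) = \<bar>det A\<bar> *\<^sub>R (\<integral>x. f (A *v x) \<partial>lborel)"
proof -
  have "(\<integral>x. f x \<partial>lborel)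
      = (\<integral>x. f x \<partial>density (distr lborel borel ((*v) A)) (\<lambda>_. ennreal \<bar>det A\<bar>))"
    using lborel_linear[OF A] by simp
  also have "\<dots> = \<bar>det A\<bar> *\<^sub>R (\<integral>x. f (A *v x) \<partial>lborel)"
    by (simp add: integral_density integral_distr)
  finally show ?thesis .
qed

lemma AE_lborel_linear:
  fixes A :: "real ^ 'n ^ 'n"
  assumes A: "invertible A" and P: "AE x in lborel. P x"
  shows "AE x in lborel. P (A *v x)"
proof -
  have d: "ennreal \<bar>det A\<bar> > 0"
    using A by (simp add: invertible_det_nz)
  have "AE x in density (distr lborel borel ((*v) A)) (\<lambda>_. ennreal \<bar>det A\<bar>). P x"
    by (subst lborel_linear[OF A, symmetric]) (rule P)
  then have "AE x in distr lborel borel ((*v) A). P x"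
    using d by (simp add: AE_density)
  then show ?thesis
    by (intro AE_distrD[where M = lborel and M' = borel]) auto
qed

lemma nn_integral_lborel_translation:
  fixes t :: "'a::euclidean_space"
  assumes f [measurable]: "f \<in> borel_measurable borel"
  shows "(\<integral>\<^sup>+x. f (x + t) \<partial>lborel) = (\<integral>\<^sup>+x. f x \<partial>lborel)"
proof -
  have "(\<integral>\<^sup>+x. f x \<partial>lborel) = (\<integral>\<^sup>+x. f x \<partial>distr lborel borel ((+) t))"
    by (simp add: lborel_distr_plus)
  also have "\<dots> = (\<integral>\<^sup>+x. f (x + t) \<partial>lborel)"
    by (simp add: nn_integral_distr add.commute)
  finally show ?thesis ..
qed

section \<open>Integer vectors and the unit cube as fundamental domain\<close>

definition int_vecs :: "(real ^ 'n) set" where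
  "int_vecs = {z. \<forall>i. z $ i \<in> \<int>}"

lemma countable_int_vecs: "countable (int_vecs :: (real ^ 'n) set)"
proof -
  have "int_vecs \<subseteq> range (\<lambda>z :: int ^ 'n. \<chi> i. real_of_int (z $ i))"
  proof
    fix z :: "real ^ 'n" assume "z \<in> int_vecs"
    then have "z $ i = real_of_int \<lfloor>z $ i\<rfloor>" for i
      by (metis (mono_tags) Ints_cases floor_of_int int_vecs_def mem_Collect_eq)
    then have "z = (\<chi> i. real_of_int ((\<chi> j. \<lfloor>z $ j\<rfloor>) $ i))"
      unfolding vec_eq_iff by simp
    then show "z \<in> range (\<lambda>z :: int ^ 'n. \<chi> i. real_of_int (z $ i))" by blast
  qed
  then show ?thesis
    by (meson countable_image countable_subset countableI_type)
qed

lemma int_vecs_closed: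
  fixes x y :: "real ^ 'n"
  shows "(0 :: real ^ 'n) \<in> int_vecs" "x \<in> int_vecs \<Longrightarrow> - x \<in> int_vecs"
  "x \<in> int_vecs \<Longrightarrow> y \<in> int_vecs \<Longrightarrow> x + y \<in> int_vecs"
  "x \<in> int_vecs \<Longrightarrow> y \<in> int_vecs \<Longrightarrow> x - y \<in> int_vecs"
  by (simp_all add: int_vecs_def Ints_add Ints_diff Ints_minus)

lemma inner_int_vecs:
  assumes "x \<in> int_vecs" "y \<in> int_vecs" shows "x \<bullet> y \<in> \<int>"
  using assms by (simp add: int_vecs_def inner_vec_def Ints_sum Ints_mult)

definition unit_cube :: "(real ^ 'n) set" where
  "unit_cube = {x. \<forall>i. 0 \<le> x $ i \<and> x $ i < 1}"

lemma unit_cube_measurable [measurable]: "unit_cube \<in> sets borel"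
  unfolding unit_cube_def by measurable

text \<open>The half-open cube is a fundamental domain: the only integer vector whose subtraction
  moves \<open>x\<close> into it is the componentwise floor.\<close>

lemma nn_integral_unit_cube_translates:
  fixes x :: "real ^ 'n"
  shows "(\<integral>\<^sup>+m. indicator unit_cube (x - m) \<partial>count_space int_vecs) = 1"
proof -
  let ?m = "\<chi> i. real_of_int \<lfloor>x $ i\<rfloor>"
  have m: "?m \<in> int_vecs"
    by (simp add: int_vecs_def)
  have eq: "x - m \<in> unit_cube \<longleftrightarrow> m = ?m" if "m \<in> int_vecs" for m :: "real ^ 'n"
  proof -
    have *: "0 \<le> x $ i - m $ i \<and> x $ i - m $ i < 1 \<longleftrightarrow> m $ i = real_of_int \<lfloor>x $ i\<rfloor>" for i
    proof -
      have "m $ i \<in> \<int>"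
        using that unfolding int_vecs_def by blast
      then obtain k where k: "m $ i = real_of_int k"
        by (rule Ints_cases)
      have "\<lfloor>x $ i\<rfloor> = k \<longleftrightarrow> real_of_int k \<le> x $ i \<and> x $ i < real_of_int k + 1"
        by (rule floor_eq_iff)
      then show ?thesis unfolding k of_int_eq_iff by linarith
    qed
    show ?thesis
      unfolding unit_cube_def vec_eq_iff mem_Collect_eq vector_minus_component * by simp
  qed
  have "(\<integral>\<^sup>+m. indicator unit_cube (x - m) \<partial>count_space int_vecs)
     = (\<integral>\<^sup>+m. indicator {?m} m \<partial>count_space int_vecs)"
    by (rule nn_integral_cong) (simp add: indicator_def eq del: vec_lambda_eta)
  also have "\<dots> = emeasure (count_space int_vecs) {?m}"
    using m by (intro nn_integral_indicator) simp
  also have "\<dots> = 1"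
    using m by (subst emeasure_count_space_finite) auto
  finally show ?thesis .
qed

lemma nn_integral_int_vecs_reflect:
  "(\<integral>\<^sup>+m. f (- m) \<partial>count_space int_vecs) = (\<integral>\<^sup>+m. f m \<partial>count_space (int_vecs :: (real ^ 'n) set))"
  by (rule nn_integral_bij_count_space)
     (auto simp: bij_betw_def inj_on_def int_vecs_closed image_iff intro!: bexI[where x = "- _"])

text \<open>Multiply by the partition of unity formed by the translated cubes, exchange sum and
  integral (the integer vectors are countable), and move every piece back to the cube.\<close>

lemma nn_integral_periodize:
  fixes f :: "real ^ 'n \<Rightarrow> ennreal"
  assumes f [measurable]: "f \<in> borel_measurable borel"
  shows "(\<integral>\<^sup>+x. f x \<partial>lborel)
    = (\<integral>\<^sup>+x. indicator unit_cube x * (\<integral>\<^sup>+m. f (x + m) \<partial>count_space int_vecs) \<partial>lborel)"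
proof -
  have "(\<integral>\<^sup>+x. f x \<partial>lborel)
    = (\<integral>\<^sup>+x. (\<integral>\<^sup>+m. indicator unit_cube (x - m) * f x \<partial>count_space int_vecs) \<partial>lborel)"
    by (simp add: nn_integral_multc nn_integral_unit_cube_translates)
  also have "\<dots> = (\<integral>\<^sup>+m. (\<integral>\<^sup>+x. indicator unit_cube (x - m) * f x \<partial>lborel) \<partial>count_space int_vecs)"
    by (rule nn_integral_count_space_nn_integral) (auto simp: countable_int_vecs)
  also have "\<dots> = (\<integral>\<^sup>+m. (\<integral>\<^sup>+x. indicator unit_cube x * f (x + m) \<partial>lborel) \<partial>count_space int_vecs)"
  proof (rule nn_integral_cong)
    fix m :: "real ^ 'n"
    show "(\<integral>\<^sup>+x. indicator unit_cube (x - m) * f x \<partial>lborel)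
       = (\<integral>\<^sup>+x. indicator unit_cube x * f (x + m) \<partial>lborel)"
      using nn_integral_lborel_translation[of "\<lambda>x. indicator unit_cube (x - m) * f x" m] by simp
  qed
  also have "\<dots> = (\<integral>\<^sup>+x. (\<integral>\<^sup>+m. indicator unit_cube x * f (x + m) \<partial>count_space int_vecs) \<partial>lborel)"
    by (rule nn_integral_count_space_nn_integral[symmetric]) (auto simp: countable_int_vecs)
  finally show ?thesis
    by (simp add: nn_integral_cmult)
qed

text \<open>Periodizing turns the indicator of the translated cube into the constant 1, since its
  integer translates tile as well, and leaves the periodic factor untouched.\<close>

lemma nn_integral_unit_cube_translate_periodic:
  fixes f :: "real ^ 'n \<Rightarrow> ennreal"
  assumes f [measurable]: "f \<in> borel_measurable borel"
    and per: "\<And>x m. m \<in> int_vecs \<Longrightarrow> f (x + m) = f x"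
  shows "(\<integral>\<^sup>+x. indicator unit_cube x * f (x + t) \<partial>lborel) = (\<integral>\<^sup>+x. indicator unit_cube x * f x \<partial>lborel)"
proof -
  have "(\<integral>\<^sup>+x. indicator unit_cube x * f (x + t) \<partial>lborel)
     = (\<integral>\<^sup>+x. indicator unit_cube (x - t) * f x \<partial>lborel)"
    using nn_integral_lborel_translation[of "\<lambda>x. indicator unit_cube (x - t) * f x" t] by simp
  also have "\<dots> = (\<integral>\<^sup>+x. indicator unit_cube x *
      (\<integral>\<^sup>+m. indicator unit_cube (x + m - t) * f (x + m) \<partial>count_space int_vecs) \<partial>lborel)"
    by (rule nn_integral_periodize) measurable
  also have "\<dots> = (\<integral>\<^sup>+x. indicator unit_cube x * f x \<partial>lborel)"
  proof (intro nn_integral_cong)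
    fix x :: "real ^ 'n"
    have "(\<integral>\<^sup>+m. indicator unit_cube (x + m - t) * f (x + m) \<partial>count_space int_vecs)
       = (\<integral>\<^sup>+m. indicator unit_cube (x + m - t) * f x \<partial>count_space int_vecs)"
      by (intro nn_integral_cong) (simp add: per)
    also have "\<dots> = (\<integral>\<^sup>+m. indicator unit_cube (x + m - t) \<partial>count_space int_vecs) * f x"
      by (simp add: nn_integral_multc)
    also have "(\<integral>\<^sup>+m. indicator unit_cube (x + m - t) \<partial>count_space int_vecs) = (1::ennreal)"
      using nn_integral_int_vecs_reflect[of "\<lambda>m. indicator unit_cube (x - t - m) :: ennreal"]
        nn_integral_unit_cube_translates[of "x - t"] by (simp add: algebra_simps)
    finally show "indicator unit_cube x *
      (\<integral>\<^sup>+m. indicator unit_cube (x + m - t) * f (x + m) \<partial>count_space int_vecs) = indicator unit_cube x * f x"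
      by simp
  qed
  finally show ?thesis .
qed

lemma unit_cube_between:
  "box 0 1 \<subseteq> unit_cube" "unit_cube \<subseteq> cbox 0 (1 :: real ^ 'n)"
  by (simp_all add: unit_cube_def mem_box_cart less_imp_le subset_eq)

lemma emeasure_unit_cube: "emeasure lborel (unit_cube :: (real ^ 'n) set) = 1"
proof -
  have *: "(1 :: real ^ 'n) \<bullet> b = 1" if "b \<in> Basis" for b
    using that by (auto simp: Basis_vec_def inner_axis)
  have 1: "emeasure lborel (box 0 1 :: (real ^ 'n) set) = 1"
     "emeasure lborel (cbox 0 1 :: (real ^ 'n) set) = 1"
    by (simp_all add: emeasure_lborel_box_eq emeasure_lborel_cbox_eq *)
  show ?thesis
    using emeasure_mono[of "box 0 1" "unit_cube :: (real ^ 'n) set" lborel]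
      emeasure_mono[of "unit_cube :: (real ^ 'n) set" "cbox 0 1" lborel]
    by (simp add: 1 antisym unit_cube_between)
qed

section \<open>Characters and the square norm\<close>

definition character :: "real ^ 'n \<Rightarrow> real ^ 'n \<Rightarrow> complex" where
  "character m x = cis (2 * pi * (m \<bullet> x))"

abbreviation cube_character :: "real ^ 'n \<Rightarrow> real ^ 'n \<Rightarrow> complex" where
  "cube_character m \<equiv> \<lambda>x. indicator unit_cube x * character m x"

abbreviation exp_sum :: "(real ^ 'n) set \<Rightarrow> (real ^ 'n \<Rightarrow> complex) \<Rightarrow> real ^ 'n \<Rightarrow> complex" where
  "exp_sum F c x \<equiv> \<Sum>l\<in>F. c l * character l x"

lemma character_measurable [measurable]:
  "character m \<in> borel_measurable borel" "(\<lambda>m. character m x) \<in> borel_measurable borel"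
  unfolding character_def[abs_def] cis_conv_exp by measurable

lemma continuous_on_character [continuous_intros]: "continuous_on A (character m)"
  unfolding character_def[abs_def] cis_conv_exp by (intro continuous_intros)

lemma norm_character [simp]: "cmod (character m x) = 1"
  by (simp add: character_def)

lemma character_simps:
  "character (m + n) x = character m x * character n x"
  "character m (x + y) = character m x * character m y"
  "character (- m) x = cnj (character m x)"
  "character m (- x) = cnj (character m x)"
  "character 0 x = 1" "character m 0 = 1"
  "character m x * cnj (character m x) = 1"
  "cnj (character m x) * character m x = 1"
  by (simp_all add: character_def inner_simps cis_mult ring_distribs cis_cnj)

lemma character_int: "m \<in> int_vecs \<Longrightarrow> x \<in> int_vecs \<Longrightarrow> character m x = 1"
  unfolding character_def by (intro cis_multiple_2pi inner_int_vecs)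

section \<open>Orthogonality of characters on the unit cube\<close>

lemma integrable_indicator_bounded:
  fixes f :: "real ^ 'n \<Rightarrow> 'b :: {banach, second_countable_topology}"
  assumes f [measurable]: "f \<in> borel_measurable borel" and b: "\<And>x. norm (f x) \<le> B"
    and A [measurable]: "A \<in> sets borel" and A': "emeasure lborel A < \<infinity>"
  shows "integrable lborel (\<lambda>x. indicator A x *\<^sub>R f x)"
  by (rule integrableI_bounded_set_indicator[where B = B]) (use assms in auto)

text \<open>Half a period in direction \<open>m\<close>, the vector \<open>t\<close> with
  \<open>m \<bullet> t = 1 / 2\<close>, turns the cosine into its negative, while integrals of
  periodic functions over the cube do not see translations. That invariance is stated for
  nonnegative functions, which is why \<open>1 + cos\<close> and \<open>1 - cos\<close> are
  compared. The phase \<open>\<phi>\<close> covers the sine as well, through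
  \<open>\<phi> = - pi / 2\<close>.\<close>

lemma integral_unit_cube_cos:
  assumes m: "m \<in> int_vecs" "m \<noteq> (0 :: real ^ 'n)"
  shows "(\<integral>x. indicator unit_cube x * cos (2 * pi * (m \<bullet> x) + \<phi>) \<partial>lborel) = 0"
proof -
  let ?c = "\<lambda>s x. indicator unit_cube x * (1 + s * cos (2 * pi * (m \<bullet> x) + \<phi>)) :: real"
  have int: "integrable lborel (\<lambda>x. indicator unit_cube x * cos (2 * pi * (m \<bullet> x) + \<phi>))"
       "integrable lborel (indicator unit_cube :: real ^ 'n \<Rightarrow> real)"
    using integrable_indicator_bounded[of "\<lambda>x. cos (2 * pi * (m \<bullet> x) + \<phi>)" 1 unit_cube]
    by (simp_all add: emeasure_unit_cube)
  have int2: "integrable lborel (?c s)" for s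
    using int by (simp add: ring_distribs mult.left_commute[of _ s])
  have nonneg: "0 \<le> 1 + s * cos y" if "\<bar>s\<bar> = 1" for s y :: real
  proof -
    have "s = 1 \<or> s = - 1" using that by linarith
    then show ?thesis using cos_ge_minus_one[of y] cos_le_one[of y] by (elim disjE; hypsubst; linarith)
  qed
  have nn: "(\<integral>\<^sup>+x. ennreal (?c s x) \<partial>lborel) = ennreal (\<integral>x. ?c s x \<partial>lborel)" if "\<bar>s\<bar> = 1" for s
  proof (intro nn_integral_eq_integral int2 AE_I2 mult_nonneg_nonneg)
    fix x show "0 \<le> 1 + s * cos (2 * pi * (m \<bullet> x) + \<phi>)"
      using that by (rule nonneg)
  qed simp
  define t where "t = (1 / (2 * (m \<bullet> m))) *\<^sub>R m"
  have t: "m \<bullet> t = 1 / 2" using m by (simp add: t_def)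
  let ?g = "\<lambda>x. ennreal (1 + cos (2 * pi * (m \<bullet> x) + \<phi>))"
  have per: "cos (2 * pi * (m \<bullet> (x + z)) + \<phi>) = cos (2 * pi * (m \<bullet> x) + \<phi>)" if z: "z \<in> int_vecs" for x z
  proof -
    obtain k where k: "m \<bullet> z = real_of_int k" using inner_int_vecs[OF m(1) z] by (rule Ints_cases)
    have "2 * pi * (m \<bullet> (x + z)) + \<phi> = (2 * pi * (m \<bullet> x) + \<phi>) + 2 * pi * real_of_int k"
      by (simp add: inner_add_right k algebra_simps)
    then have "\<exists>n :: int. 2 * pi * (m \<bullet> (x + z)) + \<phi> = 2 * pi * (m \<bullet> x) + \<phi> + 2 * pi * of_int n"
      by blast
    then show ?thesis unfolding sin_cos_eq_iff[symmetric] by blast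
  qed
  have "(\<integral>\<^sup>+x. indicator unit_cube x * ?g (x + t) \<partial>lborel) = (\<integral>\<^sup>+x. indicator unit_cube x * ?g x \<partial>lborel)"
    by (rule nn_integral_unit_cube_translate_periodic) (simp_all add: per)
  also have "\<dots> = (\<integral>\<^sup>+x. ennreal (?c 1 x) \<partial>lborel)"
    by (intro nn_integral_cong) (simp split: split_indicator)
  also have "(\<integral>\<^sup>+x. indicator unit_cube x * ?g (x + t) \<partial>lborel) = (\<integral>\<^sup>+x. ennreal (?c (-1) x) \<partial>lborel)"
  proof (intro nn_integral_cong)
    fix x :: "real ^ 'n"
    have "2 * pi * (m \<bullet> (x + t)) + \<phi> = (2 * pi * (m \<bullet> x) + \<phi>) + pi"
      by (simp add: inner_add_right t algebra_simps)
    then have "cos (2 * pi * (m \<bullet> (x + t)) + \<phi>) = - cos (2 * pi * (m \<bullet> x) + \<phi>)"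
      by (simp only: cos_periodic_pi)
    then show "indicator unit_cube x * ?g (x + t) = ennreal (?c (-1) x)"
      by (simp split: split_indicator)
  qed
  finally have eq: "ennreal (\<integral>x. ?c (-1) x \<partial>lborel) = ennreal (\<integral>x. ?c 1 x \<partial>lborel)"
    using nn[of 1] nn[of "-1"] by simp
  have J: "0 \<le> (\<integral>x. ?c s x \<partial>lborel)" if "\<bar>s\<bar> = 1" for s
  proof (intro Bochner_Integration.integral_nonneg mult_nonneg_nonneg)
    fix x show "0 \<le> 1 + s * cos (2 * pi * (m \<bullet> x) + \<phi>)"
      using that by (rule nonneg)
  qed simp
  have "(\<integral>x. ?c (-1) x \<partial>lborel) = (\<integral>x. ?c 1 x \<partial>lborel)"
    using eq J[of 1] J[of "-1"] by simp
  then show ?thesis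
    using int by (simp add: ring_distribs)
qed

lemma integral_unit_cube_character:
  fixes m :: "real ^ 'n"
  assumes m: "m \<in> int_vecs"
  shows "(\<integral>x. indicator unit_cube x * character m x \<partial>lborel) = (if m = 0 then 1 else 0)"
proof (cases "m = 0")
  case True
  have "(\<integral>x. indicator unit_cube x *\<^sub>R (1::complex) \<partial>lborel) = 1"
    by (subst Bochner_Integration.integral_scaleR_left) (simp_all add: emeasure_unit_cube measure_def)
  then show ?thesis by (simp add: True character_simps scaleR_conv_of_real of_real_indicator)
next
  case False
  let ?I = "\<integral>x. indicator unit_cube x * character m x \<partial>lborel"
  have eq: "indicator unit_cube x * character m x = indicator unit_cube x *\<^sub>R character m x" for x
    by (simp split: split_indicator)
  have int: "integrable lborel (\<lambda>x. indicator unit_cube x * character m x)"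
    unfolding eq by (rule integrable_indicator_bounded[where B = 1]) (auto simp: emeasure_unit_cube)
  have "Re ?I = (\<integral>x. indicator unit_cube x * cos (2 * pi * (m \<bullet> x) + 0) \<partial>lborel)"
    unfolding integral_Re[OF int, symmetric]
    by (intro Bochner_Integration.integral_cong) (auto simp: character_def split: split_indicator)
  moreover have "Im ?I = (\<integral>x. indicator unit_cube x * cos (2 * pi * (m \<bullet> x) + - (pi / 2)) \<partial>lborel)"
    unfolding integral_Im[OF int, symmetric]
    by (intro Bochner_Integration.integral_cong)
       (auto simp: character_def cos_diff split: split_indicator)
  ultimately show ?thesis
    using False by (simp only: integral_unit_cube_cos[OF m False] complex_eq_iff) simp
qed

text \<open>With values in \<open>ennreal\<close> the quantity makes sense for every measurable
  function, so Tonelli, substitution and comparison need no integrability; membership in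
  \<open>L2\<close> becomes finiteness (\<open>L2_iff\<close>).\<close>

definition sq_norm :: "(real ^ 'n \<Rightarrow> complex) \<Rightarrow> ennreal" where
  "sq_norm f = (\<integral>\<^sup>+x. ennreal ((cmod (f x))\<^sup>2) \<partial>lborel)"

lemma L2_iff: "f \<in> L2 \<longleftrightarrow> f \<in> borel_measurable borel \<and> sq_norm f < \<infinity>"
  unfolding L2_def sq_norm_def by (auto simp: integrable_iff_bounded)

lemma sq_norm_L2: "f \<in> L2 \<Longrightarrow> sq_norm f = ennreal ((L2_norm f)\<^sup>2)"
  unfolding L2_def sq_norm_def L2_norm_def by (auto simp: nn_integral_eq_integral)

lemma norm_add_sq_le: "(cmod (a + b))\<^sup>2 \<le> 2 * (cmod a)\<^sup>2 + 2 * (cmod b)\<^sup>2"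
proof -
  have "(cmod (a + b))\<^sup>2 \<le> (cmod a + cmod b)\<^sup>2"
    by (intro power_mono norm_triangle_ineq) auto
  also have "\<dots> \<le> 2 * (cmod a)\<^sup>2 + 2 * (cmod b)\<^sup>2"
    using sum_squares_bound[of "cmod a" "cmod b"] by (simp add: power2_sum)
  finally show ?thesis .
qed

lemma sq_norm_add:
  assumes [measurable]: "f \<in> borel_measurable borel" "g \<in> borel_measurable borel"
  shows "sq_norm (\<lambda>x. f x + g x) \<le> 2 * sq_norm f + 2 * sq_norm g"
proof -
  have "sq_norm (\<lambda>x. f x + g x) \<le> (\<integral>\<^sup>+x. 2 * ennreal ((cmod (f x))\<^sup>2) + 2 * ennreal ((cmod (g x))\<^sup>2) \<partial>lborel)"
    unfolding sq_norm_def
  proof (intro nn_integral_mono)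
    fix x
    have "ennreal ((cmod (f x + g x))\<^sup>2) \<le> ennreal (2 * (cmod (f x))\<^sup>2 + 2 * (cmod (g x))\<^sup>2)"
      by (intro ennreal_leI norm_add_sq_le)
    then show "ennreal ((cmod (f x + g x))\<^sup>2) \<le> 2 * ennreal ((cmod (f x))\<^sup>2) + 2 * ennreal ((cmod (g x))\<^sup>2)"
      by (simp add: ennreal_plus ennreal_mult)
  qed
  also have "\<dots> = 2 * sq_norm f + 2 * sq_norm g"
    by (simp add: nn_integral_add nn_integral_cmult sq_norm_def)
  finally show ?thesis .
qed

text \<open>Squares are kept instead of norms, at the price of a factor 2 at each use; the error
  budgets \<open>e / 4\<close> and \<open>e / 16\<close> further on pay for one and for two
  uses.\<close>

lemma sq_norm_triangle:
  assumes [measurable]: "f \<in> borel_measurable borel" "g \<in> borel_measurable borel" "h \<in> borel_measurable borel"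
    and "sq_norm (\<lambda>x. f x - g x) < ennreal a" "sq_norm (\<lambda>x. g x - h x) < ennreal b"
  shows "sq_norm (\<lambda>x. f x - h x) < ennreal (2 * a + 2 * b)"
proof -
  have ab: "a > 0" "b > 0"
    using assms(4,5) by (metis ennreal_neg not_less not_less_zero zero_le)+
  have "sq_norm (\<lambda>x. f x - h x) = sq_norm (\<lambda>x. (f x - g x) + (g x - h x))"
    by simp
  also have "\<dots> \<le> 2 * sq_norm (\<lambda>x. f x - g x) + 2 * sq_norm (\<lambda>x. g x - h x)"
    by (rule sq_norm_add) measurable
  also have "\<dots> < 2 * ennreal a + 2 * ennreal b"
    using assms(4,5) by (intro add_strict_mono ennreal_mult_strict_left_mono) auto
  also have "\<dots> = ennreal (2 * a + 2 * b)"
    using ab by (simp add: ennreal_plus ennreal_mult)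
  finally show ?thesis .
qed

lemma sq_norm_diff_commute: "sq_norm (\<lambda>x. f x - g x) = sq_norm (\<lambda>x. g x - f x)"
  by (simp add: sq_norm_def norm_minus_commute)

lemma sq_norm_dominated:
  assumes [measurable]: "\<And>n. u n \<in> borel_measurable borel" "f \<in> borel_measurable borel"
    and w [measurable]: "w \<in> borel_measurable borel" and wfin: "(\<integral>\<^sup>+x. w x \<partial>lborel) < \<infinity>"
    and bound: "\<And>n. AE x in lborel. ennreal ((cmod (u n x - f x))\<^sup>2) \<le> w x"
    and lim: "AE x in lborel. (\<lambda>n. u n x) \<longlonglongrightarrow> f x"
  shows "(\<lambda>n. sq_norm (\<lambda>x. u n x - f x)) \<longlonglongrightarrow> 0"
proof -
  have "(\<lambda>n. \<integral>\<^sup>+x. ennreal ((cmod (u n x - f x))\<^sup>2) \<partial>lborel) \<longlonglongrightarrow> (\<integral>\<^sup>+(x::real^'a). 0 \<partial>lborel)"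
  proof (rule nn_integral_dominated_convergence[where w = w])
    show "AE x in lborel. (\<lambda>n. ennreal ((cmod (u n x - f x))\<^sup>2)) \<longlonglongrightarrow> 0"
      using lim
    proof eventually_elim
      case (elim x)
      then have "(\<lambda>n. (cmod (u n x - f x))\<^sup>2) \<longlonglongrightarrow> (cmod (f x - f x))\<^sup>2"
        by (intro tendsto_intros)
      then show ?case
        using tendsto_ennrealI by fastforce
    qed
  qed (use bound wfin in auto)
  then show ?thesis by (simp add: sq_norm_def)
qed

section \<open>Density of trigonometric polynomials\<close>

definition trig_poly :: "(real ^ 'n \<Rightarrow> complex) \<Rightarrow> bool" where
  "trig_poly p \<longleftrightarrow> (\<exists>F c. finite F \<and> F \<subseteq> int_vecs \<and> p = (\<lambda>x. \<Sum>m\<in>F. c m * character m x))"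

lemma trig_polyI:
  "finite F \<Longrightarrow> F \<subseteq> int_vecs \<Longrightarrow> trig_poly (\<lambda>x. \<Sum>m\<in>F. c m * character m x)"
  unfolding trig_poly_def by blast

lemma trig_poly_monomial:
  assumes "m \<in> int_vecs" shows "trig_poly (\<lambda>x. c * character m x)"
  using trig_polyI[of "{m}" "\<lambda>_. c"] assms by simp

lemma trig_poly_const: "trig_poly (\<lambda>x. c)"
  using trig_poly_monomial[OF int_vecs_closed(1), of c] by (simp add: character_simps)

lemma trig_poly_add:
  assumes "trig_poly p" "trig_poly q"
  shows "trig_poly (\<lambda>x. p x + q x)"
proof -
  obtain F c where F: "finite F" "F \<subseteq> int_vecs" "p = (\<lambda>x. \<Sum>m\<in>F. c m * character m x)"
    using assms(1) unfolding trig_poly_def by blast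
  obtain G d where G: "finite G" "G \<subseteq> int_vecs" "q = (\<lambda>x. \<Sum>m\<in>G. d m * character m x)"
    using assms(2) unfolding trig_poly_def by blast
  let ?e = "\<lambda>m. (if m \<in> F then c m else 0) + (if m \<in> G then d m else 0)"
  have 1: "(\<Sum>m\<in>F. c m * character m x) = (\<Sum>m\<in>F \<union> G. (if m \<in> F then c m else 0) * character m x)" for x
    using F G by (intro sum.mono_neutral_cong_left) auto
  have 2: "(\<Sum>m\<in>G. d m * character m x) = (\<Sum>m\<in>F \<union> G. (if m \<in> G then d m else 0) * character m x)" for x
    using F G by (intro sum.mono_neutral_cong_left) auto
  have "(\<lambda>x. p x + q x) = (\<lambda>x. \<Sum>m\<in>F \<union> G. ?e m * character m x)"
    unfolding F(3) G(3) 1 2 by (simp add: sum.distrib ring_distribs)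
  then show ?thesis
    using trig_polyI[of "F \<union> G" ?e] F G by simp
qed

lemma trig_poly_sum:
  "finite I \<Longrightarrow> (\<And>i. i \<in> I \<Longrightarrow> trig_poly (p i)) \<Longrightarrow> trig_poly (\<lambda>x. \<Sum>i\<in>I. p i x)"
  by (induction I rule: finite_induct) (auto intro: trig_poly_const trig_poly_add)

lemma trig_poly_mult:
  assumes "trig_poly p" "trig_poly q"
  shows "trig_poly (\<lambda>x. p x * q x)"
proof -
  obtain F c where F: "finite F" "F \<subseteq> int_vecs" "p = (\<lambda>x. \<Sum>m\<in>F. c m * character m x)"
    using assms(1) unfolding trig_poly_def by blast
  obtain G d where G: "finite G" "G \<subseteq> int_vecs" "q = (\<lambda>x. \<Sum>m\<in>G. d m * character m x)"
    using assms(2) unfolding trig_poly_def by blast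
  have "p x * q x = (\<Sum>m\<in>F. \<Sum>n\<in>G. (c m * d n) * character (m + n) x)" for x
    unfolding F(3) G(3) by (simp add: sum_product character_simps mult_ac)
  moreover have "trig_poly (\<lambda>x. \<Sum>m\<in>F. \<Sum>n\<in>G. (c m * d n) * character (m + n) x)"
    using F G by (intro trig_poly_sum trig_poly_monomial int_vecs_closed) auto
  ultimately show ?thesis by presburger
qed

lemma trig_poly_continuous: "trig_poly p \<Longrightarrow> continuous_on A p"
  unfolding trig_poly_def by (auto intro!: continuous_intros)

lemma trig_poly_measurable: "trig_poly p \<Longrightarrow> p \<in> borel_measurable borel"
  by (intro borel_measurable_continuous_onI trig_poly_continuous)

lemma trig_poly_cos_sin:
  fixes i :: "'n :: finite"
  shows "trig_poly (\<lambda>x :: real ^ 'n. of_real (cos (2 * pi * (x $ i))))"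
  "trig_poly (\<lambda>x :: real ^ 'n. of_real (sin (2 * pi * (x $ i))))"
proof -
  have ax: "(axis i 1 :: real ^ 'n) \<in> int_vecs" by (auto simp: int_vecs_def axis_def)
  have ch: "character (axis i 1) x = cis (2 * pi * (x $ i))" for x :: "real ^ 'n"
    by (simp add: character_def inner_axis')
  have "of_real (cos (2 * pi * (x $ i))) =
      (1/2) * character (axis i 1) x + (1/2) * character (- axis i 1) x" for x :: "real ^ 'n"
    by (simp add: character_simps ch complex_eq_iff)
  then show "trig_poly (\<lambda>x :: real ^ 'n. of_real (cos (2 * pi * (x $ i))))"
    by (simp only:) (intro trig_poly_add trig_poly_monomial ax int_vecs_closed)
  have "of_real (sin (2 * pi * (x $ i))) =
      (- \<i>/2) * character (axis i 1) x + (\<i>/2) * character (- axis i 1) x" for x :: "real ^ 'n"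
    by (simp add: character_simps ch complex_eq_iff)
  then show "trig_poly (\<lambda>x :: real ^ 'n. of_real (sin (2 * pi * (x $ i))))"
    by (simp only:) (intro trig_poly_add trig_poly_monomial ax int_vecs_closed)
qed

lemma cis_2pi_eqD:
  assumes "cis (2 * pi * s) = cis (2 * pi * t)"
  shows "s - t \<in> \<int>"
proof -
  have "sin (2 * pi * s) = sin (2 * pi * t) \<and> cos (2 * pi * s) = cos (2 * pi * t)"
    using assms by (simp add: complex_eq_iff)
  then obtain n :: int where "2 * pi * s = 2 * pi * t + 2 * pi * real_of_int n"
    unfolding sin_cos_eq_iff by blast
  then have "s = t + real_of_int n" by (simp flip: distrib_left)
  then show ?thesis by simp
qed

text \<open>The map \<open>q\<close> wraps the closed cube onto the torus, embedded in
  \<open>complex ^ 'n\<close>. Vanishing off the open box makes \<open>\<phi>\<close> agree on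
  opposite faces, so it descends to a function on \<open>K\<close>, where Stone-Weierstrass applies
  to the real functions that become trigonometric polynomials after composition with
  \<open>q\<close>.\<close>

lemma trig_poly_uniform_approx:
  fixes \<phi> :: "real ^ 'n \<Rightarrow> real"
  assumes cont: "continuous_on (cbox 0 1) \<phi>" and zero: "\<And>x. x \<notin> box 0 1 \<Longrightarrow> \<phi> x = 0"
    and e: "e > 0"
  obtains p where "trig_poly p" "\<And>x. x \<in> cbox 0 1 \<Longrightarrow> cmod (of_real (\<phi> x) - p x) < e"
proof -
  define q :: "real ^ 'n \<Rightarrow> complex ^ 'n" where "q x = (\<chi> i. cis (2 * pi * (x $ i)))" for x
  define K where "K = q ` cbox 0 1"
  have q_cont: "continuous_on A q" for A
    unfolding q_def cis_conv_exp by (intro continuous_intros continuous_on_vec_lambda)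
  have K: "compact K"
    unfolding K_def by (intro compact_continuous_image q_cont compact_cbox)
  \<comment> \<open>Points with the same image differ by integers in each coordinate; inside the
    closed cube a nonzero difference is 1 or -1, which puts both points on the boundary, where
    \<open>\<phi>\<close> is 0.\<close>
  have fib: "\<phi> x = \<phi> y" if "x \<in> cbox 0 1" "y \<in> cbox 0 1" "q x = q y" for x y
  proof (cases "x = y")
    case False
    then obtain i where i: "x $ i \<noteq> y $ i" by (auto simp: vec_eq_iff)
    have "cis (2 * pi * (x $ i)) = cis (2 * pi * (y $ i))"
      using that(3) by (simp add: q_def vec_eq_iff)
    then have "x $ i - y $ i \<in> \<int>" by (rule cis_2pi_eqD)
    then obtain n where "x $ i - y $ i = real_of_int n" by (rule Ints_cases)
    then have n: "x $ i = y $ i + real_of_int n" by simp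
    have b: "0 \<le> x $ i" "x $ i \<le> 1" "0 \<le> y $ i" "y $ i \<le> 1"
      using that(1,2) by (auto simp: mem_box_cart)
    have "n \<noteq> 0" "\<bar>real_of_int n\<bar> \<le> 1" using n i b by auto
    then have "n = 1 \<or> n = - 1" by linarith
    then have "(x $ i = 1 \<and> y $ i = 0) \<or> (x $ i = 0 \<and> y $ i = 1)"
      using n b by auto
    then have "x \<notin> box 0 1" "y \<notin> box 0 1"
      by (auto simp: mem_box_cart intro!: exI[of _ i])
    then show ?thesis by (simp add: zero)
  qed simp
  define \<Phi> where "\<Phi> z = \<phi> (SOME x. x \<in> cbox 0 1 \<and> q x = z)" for z
  have \<Phi>: "\<Phi> (q x) = \<phi> x" if "x \<in> cbox 0 1" for x
  proof -
    have "(SOME y. y \<in> cbox 0 1 \<and> q y = q x) \<in> cbox 0 1 \<and> q (SOME y. y \<in> cbox 0 1 \<and> q y = q x) = q x"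
      by (rule someI[of "\<lambda>y. y \<in> cbox 0 1 \<and> q y = q x"]) (use that in simp)
    then show ?thesis
      unfolding \<Phi>_def using that by (intro fib) auto
  qed
  \<comment> \<open>\<open>q\<close> is a closed map on the compact cube, hence a quotient map onto
    \<open>K\<close>: the preimage of \<open>B\<close> under \<open>\<Phi>\<close> is the image
    under \<open>q\<close> of a closed set.\<close>
  have \<Phi>_cont: "continuous_on K \<Phi>"
    unfolding continuous_on_closed_invariant
  proof (intro allI impI)
    fix B :: "real set" assume B: "closed B"
    have "closed (cbox 0 1 \<inter> \<phi> -` B)"
      using cont B by (intro continuous_closed_preimage) auto
    then have "compact (cbox 0 1 \<inter> (cbox 0 1 \<inter> \<phi> -` B))"
      by (intro compact_Int_closed) auto
    then have "closed (q ` (cbox 0 1 \<inter> \<phi> -` B))"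
      by (intro compact_imp_closed compact_continuous_image q_cont) (simp flip: Int_assoc)
    moreover have "q ` (cbox 0 1 \<inter> \<phi> -` B) \<inter> K = \<Phi> -` B \<inter> K"
    proof (intro set_eqI iffI)
      fix z assume "z \<in> q ` (cbox 0 1 \<inter> \<phi> -` B) \<inter> K"
      then show "z \<in> \<Phi> -` B \<inter> K" by (auto simp: \<Phi>)
    next
      fix z assume z: "z \<in> \<Phi> -` B \<inter> K"
      then obtain x where "x \<in> cbox 0 1" "z = q x" by (auto simp: K_def)
      then show "z \<in> q ` (cbox 0 1 \<inter> \<phi> -` B) \<inter> K" using z by (auto simp: \<Phi>)
    qed
    ultimately show "\<exists>A. closed A \<and> A \<inter> K = \<Phi> -` B \<inter> K" by blast
  qed
  have "\<exists>g. (continuous_on K g \<and> trig_poly (\<lambda>x. of_real (g (q x)))) \<and> (\<forall>z\<in>K. \<bar>\<Phi> z - g z\<bar> < e)"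
  proof (rule Stone_Weierstrass_HOL[OF K _ _ _ _ _ \<Phi>_cont e])
    fix z w assume "z \<in> K \<and> w \<in> K \<and> z \<noteq> w"
    then obtain i where "z $ i \<noteq> w $ i" by (auto simp: vec_eq_iff)
    then consider "Re (z $ i) \<noteq> Re (w $ i)" | "Im (z $ i) \<noteq> Im (w $ i)"
      by (auto simp: complex_eq_iff)
    then show "\<exists>g. (continuous_on K g \<and> trig_poly (\<lambda>x. of_real (g (q x)))) \<and> g z \<noteq> g w"
    proof cases
      case 1
      then show ?thesis
        by (intro exI[of _ "\<lambda>z. Re (z $ i)"])
           (auto intro!: continuous_intros simp: q_def trig_poly_cos_sin)
    next
      case 2
      then show ?thesis
        by (intro exI[of _ "\<lambda>z. Im (z $ i)"])
           (auto intro!: continuous_intros simp: q_def trig_poly_cos_sin)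
    qed
  qed (auto intro!: continuous_intros trig_poly_const trig_poly_add trig_poly_mult)
  then obtain g where g: "trig_poly (\<lambda>x. of_real (g (q x)))" "\<And>z. z \<in> K \<Longrightarrow> \<bar>\<Phi> z - g z\<bar> < e"
    by blast
  show ?thesis
  proof (rule that[OF g(1)])
    fix x :: "real ^ 'n" assume x: "x \<in> cbox 0 1"
    have "\<bar>\<phi> x - g (q x)\<bar> < e"
      using g(2)[of "q x"] x \<Phi>[OF x] by (auto simp: K_def)
    then show "cmod (of_real (\<phi> x) - of_real (g (q x))) < e"
      by (metis norm_of_real of_real_diff)
  qed
qed

lemma sq_norm_unit_cube_le:
  fixes f :: "real ^ 'n \<Rightarrow> complex"
  assumes "\<And>x. x \<in> unit_cube \<Longrightarrow> cmod (f x) \<le> d" "\<And>x. x \<notin> unit_cube \<Longrightarrow> f x = 0"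
  shows "sq_norm f \<le> ennreal (d\<^sup>2)"
proof -
  have "sq_norm f \<le> (\<integral>\<^sup>+x. ennreal (d\<^sup>2) * indicator unit_cube x \<partial>(lborel :: (real ^ 'n) measure))"
    unfolding sq_norm_def
    by (rule nn_integral_mono) (use assms in \<open>auto simp: power_mono ennreal_leI split: split_indicator\<close>)
  also have "\<dots> = ennreal (d\<^sup>2)"
    by (subst nn_integral_cmult_indicator) (simp_all add: emeasure_unit_cube)
  finally show ?thesis .
qed

text \<open>A continuous retraction onto the disc of radius \<open>B\<close>; it bounds continuous
  approximants without destroying their continuity or moving a limit that lies in the disc.\<close>

lemma clamp_norm:
  fixes w :: complex
  assumes B: "B > 0"
  shows "cmod (w / of_real (max 1 (cmod w / B))) \<le> B"
    and "cmod w \<le> B \<Longrightarrow> w / of_real (max 1 (cmod w / B)) = w"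
proof -
  show "cmod (w / of_real (max 1 (cmod w / B))) \<le> B"
    using B by (auto simp: norm_divide max_def field_simps)
  show "w / of_real (max 1 (cmod w / B)) = w" if "cmod w \<le> B"
    using that B by (simp add: max_absorb1)
qed

text \<open>A measurable function is almost everywhere a limit of continuous ones, over whose size
  and support nothing is known. Clamping bounds them, a cutoff confines them to the open box, and
  what the cutoff loses is the boundary of the cube, a null set; then dominated convergence
  applies.\<close>

lemma continuous_approx_unit_cube:
  fixes f :: "real ^ 'n \<Rightarrow> complex"
  assumes f [measurable]: "f \<in> borel_measurable borel" and B: "\<And>x. cmod (f x) \<le> B"
    and zero: "\<And>x. x \<notin> unit_cube \<Longrightarrow> f x = 0" and e: "e > 0"
  obtains \<phi> where "continuous_on UNIV \<phi>" "\<And>x. x \<notin> box 0 1 \<Longrightarrow> \<phi> x = 0"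
    "sq_norm (\<lambda>x. \<phi> x - f x) < ennreal e"
proof -
  \<comment> \<open>\<open>B\<close> may be 0, but the clamp divides by its radius.\<close>
  define C where "C = max B 1"
  have C: "C > 0" "\<And>x. cmod (f x) \<le> C" using B by (auto simp: C_def le_max_iff_disj)
  have "f measurable_on UNIV"
    by (intro lebesgue_measurable_imp_measurable_on) (auto intro: measurable_completion)
  then obtain N g where N: "negligible N" and g: "\<And>n. continuous_on UNIV (g n)"
    and gf: "\<And>x. x \<notin> N \<Longrightarrow> (\<lambda>n. g n x) \<longlonglongrightarrow> f x"
    unfolding measurable_on_def by auto
  \<comment> \<open>Zero off the open box; at a point inside, equal to 1 as soon as \<open>n\<close>
    reaches the reciprocal of the distance to the complement.\<close>
  define cutf where "cutf n x = min 1 (real n * infdist x (- box 0 1))" for n and x :: "real ^ 'n"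
  define \<phi> where "\<phi> n x = of_real (cutf n x) * (g n x / of_real (max 1 (cmod (g n x) / C)))" for n x
  have \<phi>_cont: "continuous_on UNIV (\<phi> n)" for n
    unfolding \<phi>_def cutf_def using C(1) g
    by (intro continuous_intros) (auto simp: max_def)
  have [measurable]: "\<phi> n \<in> borel_measurable borel" for n
    by (rule borel_measurable_continuous_onI[OF \<phi>_cont])
  have cut01: "0 \<le> cutf n x" "cutf n x \<le> 1" for n x
    by (auto simp: cutf_def infdist_nonneg)
  have \<phi>0: "\<phi> n x = 0" if "x \<notin> box 0 1" for n x
    using that by (simp add: \<phi>_def cutf_def)
  have \<phi>B: "cmod (\<phi> n x) \<le> C" for n x
  proof -
    have "cmod (\<phi> n x) \<le> 1 * C"
      unfolding \<phi>_def norm_mult using cut01 C(1) clamp_norm(1)[OF C(1)]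
      by (intro mult_mono) auto
    then show ?thesis by simp
  qed
  have null: "N \<union> (cbox 0 1 - box 0 1) \<in> null_sets lebesgue"
    using N negligible_frontier_interval by (auto simp: negligible_iff_null_sets intro: null_sets.Un)
  have lim_pt: "(\<lambda>n. \<phi> n x) \<longlonglongrightarrow> f x" if x: "x \<notin> N \<union> (cbox 0 1 - box 0 1)" for x
  proof (cases "x \<in> box 0 1")
    case False
    then have "x \<notin> unit_cube"
      using x unit_cube_between(2) by blast
    then show ?thesis
      using zero[of x] \<phi>0[OF False] by simp
  next
    case True
    have "- box 0 (1 :: real ^ 'n) \<noteq> {}"
      using bounded_box[of 0 "1 :: real ^ 'n"] not_bounded_UNIV by (metis double_complement compl_top_eq)
    then have d: "infdist x (- box 0 1) > 0"
      using True in_closed_iff_infdist_zero[of "- box 0 1" x] infdist_nonneg[of x "- box 0 1"]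
      by (auto simp: less_le closed_Compl open_box)
    obtain n0 where n0: "1 \<le> real n0 * infdist x (- box 0 1)"
      using reals_Archimedean3[OF d] by (meson less_imp_le)
    have "cutf n x = 1" if "n \<ge> n0" for n
    proof -
      have "real n0 * infdist x (- box 0 1) \<le> real n * infdist x (- box 0 1)"
        using d that by (intro mult_right_mono) auto
      then show ?thesis using n0 by (simp add: cutf_def)
    qed
    then have "eventually (\<lambda>n. cutf n x = 1) sequentially"
      unfolding eventually_sequentially by blast
    then have "(\<lambda>n. cutf n x) \<longlonglongrightarrow> 1" by (rule tendsto_eventually)
    moreover have "(\<lambda>n. g n x) \<longlonglongrightarrow> f x" using gf x by blast
    ultimately have "(\<lambda>n. \<phi> n x) \<longlonglongrightarrow> of_real 1 * (f x / of_real (max 1 (cmod (f x) / C)))"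
      unfolding \<phi>_def using C(1) by (intro tendsto_intros) (auto simp: max_def)
    then show ?thesis
      using clamp_norm(2)[OF C(1) C(2)[of x]] by simp
  qed
  have "AE x in lebesgue. (\<lambda>n. \<phi> n x) \<longlonglongrightarrow> f x"
    using lim_pt by (intro AE_I'[OF null]) blast
  then have lim: "AE x in lborel. (\<lambda>n. \<phi> n x) \<longlonglongrightarrow> f x"
    by (simp add: AE_completion_iff)
  have "(\<lambda>n. sq_norm (\<lambda>x. \<phi> n x - f x)) \<longlonglongrightarrow> 0"
  proof (rule sq_norm_dominated[where w = "\<lambda>x. ennreal ((2 * C)\<^sup>2) * indicator (cbox 0 1) x"])
    show "AE x in lborel. ennreal ((cmod (\<phi> n x - f x))\<^sup>2) \<le> ennreal ((2 * C)\<^sup>2) * indicator (cbox 0 1) x" for n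
    proof (rule AE_I2)
      fix x :: "real ^ 'n"
      have "cmod (\<phi> n x - f x) \<le> 2 * C"
        using norm_triangle_ineq4[of "\<phi> n x" "f x"] \<phi>B[of n x] C(2)[of x] by linarith
      moreover have "\<phi> n x - f x = 0" if "x \<notin> cbox 0 1"
      proof -
        have "x \<notin> unit_cube" "x \<notin> box 0 1"
          using that unit_cube_between(2) box_subset_cbox[of 0 "1 :: real ^ 'n"] by blast+
        then show ?thesis using zero[of x] \<phi>0[of x] by simp
      qed
      ultimately show "ennreal ((cmod (\<phi> n x - f x))\<^sup>2) \<le> ennreal ((2 * C)\<^sup>2) * indicator (cbox 0 1) x"
        using power_mono[of "cmod (\<phi> n x - f x)" "2 * C" 2]
        by (cases "x \<in> cbox 0 1") (simp_all add: ennreal_leI)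
    qed
    show "(\<integral>\<^sup>+x. ennreal ((2 * C)\<^sup>2) * indicator (cbox 0 1) x \<partial>(lborel :: (real ^ 'n) measure)) < \<infinity>"
      by (subst nn_integral_cmult_indicator)
         (use emeasure_bounded_finite[OF bounded_cbox[of 0 "1 :: real ^ 'n"]] in \<open>simp_all add: ennreal_mult_less_top\<close>)
  qed (use lim in auto)
  then have "eventually (\<lambda>n. sq_norm (\<lambda>x. \<phi> n x - f x) < ennreal e) sequentially"
    using e by (intro order_tendstoD) auto
  then obtain n where "sq_norm (\<lambda>x. \<phi> n x - f x) < ennreal e"
    using eventually_happens'[OF sequentially_bot] by blast
  then show ?thesis
    using that[of "\<phi> n"] \<phi>_cont \<phi>0 by blast
qed

theorem trig_poly_dense_bounded:
  fixes f :: "real ^ 'n \<Rightarrow> complex"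
  assumes f [measurable]: "f \<in> borel_measurable borel" and B: "\<And>x. cmod (f x) \<le> B"
    and zero: "\<And>x. x \<notin> unit_cube \<Longrightarrow> f x = 0" and e: "e > 0"
  obtains p where "trig_poly p" "sq_norm (\<lambda>x. f x - indicator unit_cube x * p x) < ennreal e"
proof -
  obtain \<phi> where \<phi>: "continuous_on UNIV \<phi>" "\<And>x. x \<notin> box 0 1 \<Longrightarrow> \<phi> x = 0"
    "sq_norm (\<lambda>x. \<phi> x - f x) < ennreal (e / 4)"
    using continuous_approx_unit_cube[OF f B zero, of "e / 4"] e by auto
  \<comment> \<open>Real and imaginary part are approximated within \<open>d\<close> each, so the
    error is at most \<open>2 * d\<close> on a cube of measure 1, and
    \<open>4 * d\<^sup>2 = e / 8\<close> lies below \<open>e / 4\<close>.\<close>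
  define d where "d = sqrt (e / 32)"
  have d: "d > 0" "4 * d\<^sup>2 < e / 4" using e by (auto simp: d_def)
  obtain p where p: "trig_poly p" "\<And>x. x \<in> cbox 0 1 \<Longrightarrow> cmod (of_real (Re (\<phi> x)) - p x) < d"
    by (rule trig_poly_uniform_approx[of "\<lambda>x. Re (\<phi> x)" d])
       (use \<phi>(2) d(1) in \<open>auto intro!: continuous_intros continuous_on_subset[OF \<phi>(1)]\<close>)
  obtain q where q: "trig_poly q" "\<And>x. x \<in> cbox 0 1 \<Longrightarrow> cmod (of_real (Im (\<phi> x)) - q x) < d"
    by (rule trig_poly_uniform_approx[of "\<lambda>x. Im (\<phi> x)" d])
       (use \<phi>(2) d(1) in \<open>auto intro!: continuous_intros continuous_on_subset[OF \<phi>(1)]\<close>)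
  define r where "r x = p x + \<i> * q x" for x
  have r: "trig_poly r"
    unfolding r_def by (intro trig_poly_add trig_poly_mult trig_poly_const p q)
  note [measurable] = trig_poly_measurable[OF r] borel_measurable_continuous_onI[OF \<phi>(1)]
  have "sq_norm (\<lambda>x. \<phi> x - indicator unit_cube x * r x) \<le> ennreal ((2 * d)\<^sup>2)"
  proof (rule sq_norm_unit_cube_le)
    fix x :: "real ^ 'n" assume x: "x \<in> unit_cube"
    then have xc: "x \<in> cbox 0 1" using unit_cube_between(2) by blast
    have "\<phi> x - r x = (of_real (Re (\<phi> x)) - p x) + \<i> * (of_real (Im (\<phi> x)) - q x)"
      using complex_eq[of "\<phi> x"] by (simp add: r_def algebra_simps)
    then have "cmod (\<phi> x - r x) \<le> cmod (of_real (Re (\<phi> x)) - p x) + cmod (of_real (Im (\<phi> x)) - q x)"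
      by (metis norm_triangle_ineq norm_mult norm_ii mult_1)
    then show "cmod (\<phi> x - indicator unit_cube x * r x) \<le> 2 * d"
      using x p(2)[OF xc] q(2)[OF xc] by simp
  next
    fix x :: "real ^ 'n" assume "x \<notin> unit_cube"
    then show "\<phi> x - indicator unit_cube x * r x = 0"
      using \<phi>(2)[of x] unit_cube_between(1) by auto
  qed
  also have "\<dots> < ennreal (e / 4)"
    using d e by (simp add: ennreal_less_iff power_mult_distrib)
  finally have "sq_norm (\<lambda>x. \<phi> x - indicator unit_cube x * r x) < ennreal (e / 4)" .
  moreover have "sq_norm (\<lambda>x. f x - \<phi> x) < ennreal (e / 4)"
    using \<phi>(3) sq_norm_diff_commute[of f \<phi>] by simp
  ultimately have "sq_norm (\<lambda>x. f x - indicator unit_cube x * r x) < ennreal (2 * (e / 4) + 2 * (e / 4))"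
    by (intro sq_norm_triangle[of f \<phi>]) measurable
  then show ?thesis using that[OF r] by simp
qed

text \<open>Discarding the large values leaves a bounded function and is harmless by dominated
  convergence, with \<open>f\<close> itself providing the majorant.\<close>

theorem trig_poly_dense:
  fixes f :: "real ^ 'n \<Rightarrow> complex"
  assumes f: "f \<in> L2" and zero: "\<And>x. x \<notin> unit_cube \<Longrightarrow> f x = 0" and e: "e > 0"
  obtains p where "trig_poly p" "sq_norm (\<lambda>x. f x - indicator unit_cube x * p x) < ennreal e"
proof -
  have [measurable]: "f \<in> borel_measurable borel" and fin: "sq_norm f < \<infinity>"
    using f by (auto simp: L2_iff)
  define u where "u n x = (if cmod (f x) \<le> real n then f x else 0)" for n x
  have [measurable]: "u n \<in> borel_measurable borel" for n
    unfolding u_def by measurable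
  have "(\<lambda>n. sq_norm (\<lambda>x. u n x - f x)) \<longlonglongrightarrow> 0"
  proof (rule sq_norm_dominated[where w = "\<lambda>x. ennreal ((cmod (f x))\<^sup>2)"])
    show "AE x in lborel. ennreal ((cmod (u n x - f x))\<^sup>2) \<le> ennreal ((cmod (f x))\<^sup>2)" for n
      by (rule AE_I2) (simp add: u_def)
    show "AE x in lborel. (\<lambda>n. u n x) \<longlonglongrightarrow> f x"
    proof (intro AE_I2 tendsto_eventually)
      fix x
      obtain n0 where "cmod (f x) \<le> real n0" using real_arch_simple by blast
      then have "u n x = f x" if "n \<ge> n0" for n
        using that of_nat_mono[OF that, where 'a = real] unfolding u_def by simp
      then show "\<forall>\<^sub>F n in sequentially. u n x = f x"
        unfolding eventually_sequentially by blast
    qed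
  qed (use fin in \<open>auto simp: sq_norm_def\<close>)
  then have "eventually (\<lambda>n. sq_norm (\<lambda>x. u n x - f x) < ennreal (e / 4)) sequentially"
    using e by (intro order_tendstoD) auto
  then obtain n where "sq_norm (\<lambda>x. u n x - f x) < ennreal (e / 4)"
    using eventually_happens'[OF sequentially_bot] by blast
  then have n: "sq_norm (\<lambda>x. f x - u n x) < ennreal (e / 4)"
    using sq_norm_diff_commute[of f "u n"] by simp
  have un: "u n \<in> borel_measurable borel" "\<And>x. cmod (u n x) \<le> real n"
      "\<And>x. x \<notin> unit_cube \<Longrightarrow> u n x = 0"
    using zero by (measurable, simp_all add: u_def)
  have e4: "e / 4 > 0" using e by simp
  obtain p where p: "trig_poly p" "sq_norm (\<lambda>x. u n x - indicator unit_cube x * p x) < ennreal (e / 4)"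
    by (rule trig_poly_dense_bounded[OF un e4])
  note [measurable] = trig_poly_measurable[OF p(1)]
  have "sq_norm (\<lambda>x. f x - indicator unit_cube x * p x) < ennreal (2 * (e / 4) + 2 * (e / 4))"
    using n p(2) by (intro sq_norm_triangle[of f "u n"]) measurable
  then show ?thesis using that[OF p(1)] by simp
qed

section \<open>Parseval's identity\<close>

lemma borel_measurable_cnj [measurable]:
  "f \<in> borel_measurable M \<Longrightarrow> (\<lambda>x. cnj (f x)) \<in> borel_measurable M"
  by (rule borel_measurable_continuous_on[OF continuous_on_cnj[OF continuous_on_id]])

lemma L2_measurable: "f \<in> L2 \<Longrightarrow> f \<in> borel_measurable borel"
  by (simp add: L2_iff)

lemma L2_add [intro]:
  assumes "f \<in> L2" "g \<in> L2" shows "(\<lambda>x. f x + g x) \<in> L2"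
proof -
  have "sq_norm (\<lambda>x. f x + g x) \<le> 2 * sq_norm f + 2 * sq_norm g"
    using assms by (intro sq_norm_add L2_measurable)
  also have "\<dots> < \<infinity>"
    using assms by (simp add: L2_iff ennreal_mult_less_top)
  finally show ?thesis using assms by (simp add: L2_iff borel_measurable_add)
qed

lemma sq_norm_cmult: "f \<in> borel_measurable borel \<Longrightarrow> sq_norm (\<lambda>x. c * f x) = ennreal ((cmod c)\<^sup>2) * sq_norm f"
  unfolding sq_norm_def by (simp add: norm_mult power_mult_distrib ennreal_mult nn_integral_cmult)

lemma L2_cmult [intro]: "f \<in> L2 \<Longrightarrow> (\<lambda>x. c * f x) \<in> L2"
  by (auto simp: L2_iff sq_norm_cmult ennreal_mult_less_top)

lemma L2_diff [intro]: "f \<in> L2 \<Longrightarrow> g \<in> L2 \<Longrightarrow> (\<lambda>x. f x - g x) \<in> L2"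
  using L2_add[of f "\<lambda>x. -1 * g x"] L2_cmult[of g "-1"] by simp

lemma L2_zero [simp]: "(\<lambda>x. 0) \<in> L2"
  by (simp add: L2_iff sq_norm_def)

lemma L2_sum [intro]: "(\<And>i. i \<in> I \<Longrightarrow> f i \<in> L2) \<Longrightarrow> (\<lambda>x. \<Sum>i\<in>I. f i x) \<in> L2"
  by (induction I rule: infinite_finite_induct) auto

lemma L2_mult_bounded:
  assumes f: "f \<in> L2" and [measurable]: "b \<in> borel_measurable borel" and b: "\<And>x. cmod (b x) \<le> 1"
  shows "(\<lambda>x. f x * b x) \<in> L2"
proof -
  have "sq_norm (\<lambda>x. f x * b x) \<le> sq_norm f"
    unfolding sq_norm_def norm_mult using b
    by (intro nn_integral_mono ennreal_leI power_mono mult_right_le_one_le) auto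
  also have "\<dots> < \<infinity>" using f by (simp add: L2_iff)
  finally show ?thesis using f by (simp add: L2_iff borel_measurable_times)
qed

lemma L2_indicator_mult:
  assumes "f \<in> L2" "A \<in> sets borel"
  shows "(\<lambda>x. indicator A x * f x) \<in> L2"
  using L2_mult_bounded[OF assms(1), of "indicator A"] assms(2) by (simp add: mult.commute indicator_def)

definition inner_L2 :: "(real ^ 'n \<Rightarrow> complex) \<Rightarrow> (real ^ 'n \<Rightarrow> complex) \<Rightarrow> complex" where
  "inner_L2 f g = (\<integral>x. f x * cnj (g x) \<partial>lborel)"

lemma integrable_L2_mult:
  assumes f: "f \<in> L2" and g: "g \<in> L2"
  shows "integrable lborel (\<lambda>x. f x * cnj (g x))"
proof (rule Bochner_Integration.integrable_bound)
  show "integrable lborel (\<lambda>x. (cmod (f x))\<^sup>2 + (cmod (g x))\<^sup>2)"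
    using f g by (auto simp: L2_def)
  show "AE x in lborel. norm (f x * cnj (g x)) \<le> norm ((cmod (f x))\<^sup>2 + (cmod (g x))\<^sup>2)"
  proof (rule AE_I2)
    fix x
    have "2 * (cmod (f x) * cmod (g x)) \<le> (cmod (f x))\<^sup>2 + (cmod (g x))\<^sup>2"
      using sum_squares_bound[of "cmod (f x)" "cmod (g x)"] by simp
    moreover have "0 \<le> cmod (f x) * cmod (g x)" by simp
    ultimately show "norm (f x * cnj (g x)) \<le> norm ((cmod (f x))\<^sup>2 + (cmod (g x))\<^sup>2)"
      unfolding norm_mult complex_mod_cnj real_norm_def by linarith
  qed
  have [measurable]: "f \<in> borel_measurable borel" "g \<in> borel_measurable borel"
    using f g by (auto simp: L2_measurable)
  show "(\<lambda>x. f x * cnj (g x)) \<in> borel_measurable lborel"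
    by measurable
qed

lemma inner_L2_self: "inner_L2 f f = of_real ((L2_norm f)\<^sup>2)"
proof -
  have "f x * cnj (f x) = of_real ((cmod (f x))\<^sup>2)" for x
    by (simp only: complex_norm_square)
  then have "inner_L2 f f = (\<integral>x. complex_of_real ((cmod (f x))\<^sup>2) \<partial>lborel)"
    by (simp only: inner_L2_def)
  also have "\<dots> = of_real (\<integral>x. (cmod (f x))\<^sup>2 \<partial>lborel)"
    by (rule integral_complex_of_real)
  finally show ?thesis
    by (simp add: L2_norm_def integral_nonneg_AE)
qed

lemma inner_L2_add_left:
  "f \<in> L2 \<Longrightarrow> g \<in> L2 \<Longrightarrow> h \<in> L2 \<Longrightarrow> inner_L2 (\<lambda>x. f x + g x) h = inner_L2 f h + inner_L2 g h"
  unfolding inner_L2_def ring_distribs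
  by (intro Bochner_Integration.integral_add integrable_L2_mult)

lemma inner_L2_cmult_left: "inner_L2 (\<lambda>x. c * f x) g = c * inner_L2 f g"
  by (simp add: inner_L2_def mult.assoc)

lemma inner_L2_commute: "inner_L2 g f = cnj (inner_L2 f g)"
proof -
  have "(\<integral>x. cnj (f x * cnj (g x)) \<partial>lborel) = cnj (\<integral>x. f x * cnj (g x) \<partial>lborel)"
    by (rule integral_bounded_linear'[OF bounded_linear_cnj bounded_linear_cnj]) simp
  then show ?thesis by (simp add: inner_L2_def mult.commute)
qed

lemma inner_L2_sum_left:
  assumes "\<And>i. i \<in> I \<Longrightarrow> f i \<in> L2" "g \<in> L2"
  shows "inner_L2 (\<lambda>x. \<Sum>i\<in>I. f i x) g = (\<Sum>i\<in>I. inner_L2 (f i) g)"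
  unfolding inner_L2_def sum_distrib_right
  by (intro Bochner_Integration.integral_sum integrable_L2_mult assms)

lemma L2_norm_diff_sq:
  assumes f: "f \<in> L2" and g: "g \<in> L2"
  shows "(L2_norm (\<lambda>x. f x - g x))\<^sup>2 = (L2_norm f)\<^sup>2 + (L2_norm g)\<^sup>2 - 2 * Re (inner_L2 f g)"
proof -
  have m1: "(\<lambda>x. -1 * g x) \<in> L2" using g by blast
  have dL2: "(\<lambda>x. f x + -1 * g x) \<in> L2" by (rule L2_add[OF f m1])
  have L: "inner_L2 (\<lambda>x. f x + -1 * g x) h = inner_L2 f h - inner_L2 g h" if "h \<in> L2" for h
    using inner_L2_add_left[OF f m1 that] by (simp only: inner_L2_cmult_left) simp
  have "of_real ((L2_norm (\<lambda>x. f x - g x))\<^sup>2) = inner_L2 (\<lambda>x. f x + -1 * g x) (\<lambda>x. f x + -1 * g x)"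
    unfolding inner_L2_self by simp
  also have "\<dots> = inner_L2 f (\<lambda>x. f x + -1 * g x) - inner_L2 g (\<lambda>x. f x + -1 * g x)"
    by (rule L[OF dL2])
  also have "\<dots> = cnj (inner_L2 f f - inner_L2 g f) - cnj (inner_L2 f g - inner_L2 g g)"
    unfolding inner_L2_commute[of _ "\<lambda>x. f x + -1 * g x"] L[OF f] L[OF g] ..
  also have "\<dots> = of_real ((L2_norm f)\<^sup>2) + of_real ((L2_norm g)\<^sup>2) - (cnj (inner_L2 g f) + cnj (inner_L2 f g))"
    by (simp add: inner_L2_self)
  also have "cnj (inner_L2 g f) + cnj (inner_L2 f g) = of_real (2 * Re (inner_L2 f g))"
    unfolding inner_L2_commute[of g f] by (simp add: complex_eq_iff)
  finally have "complex_of_real ((L2_norm (\<lambda>x. f x - g x))\<^sup>2)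
      = of_real ((L2_norm f)\<^sup>2 + (L2_norm g)\<^sup>2 - 2 * Re (inner_L2 f g))"
    by simp
  then show ?thesis unfolding of_real_eq_iff .
qed

lemma cube_character_L2: "cube_character m \<in> L2"
proof -
  have "sq_norm (cube_character m) \<le> ennreal (1\<^sup>2)"
    by (rule sq_norm_unit_cube_le) (auto simp: norm_mult)
  then have "sq_norm (cube_character m) < \<infinity>"
    by (rule le_less_trans) simp
  then show ?thesis by (simp add: L2_iff)
qed

lemma inner_cube_character:
  assumes "m \<in> int_vecs" "n \<in> int_vecs"
  shows "inner_L2 (cube_character m) (cube_character n)
    = (if m = n then 1 else 0)"
proof -
  have "indicator unit_cube x * character m x * cnj (indicator unit_cube x * character n x)
      = indicator unit_cube x * character (m - n) x" for x
    using character_simps(1)[of m "- n" x] by (simp add: character_simps split: split_indicator)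
  then show ?thesis
    unfolding inner_L2_def using integral_unit_cube_character[OF int_vecs_closed(4)[OF assms]]
    by (simp only: right_minus_eq)
qed

lemma inner_cube_trig_poly:
  assumes F: "finite F" "F \<subseteq> int_vecs" and n: "n \<in> int_vecs"
  shows "inner_L2 (\<lambda>x. \<Sum>m\<in>F. c m * (indicator unit_cube x * character m x))
      (cube_character n) = (if n \<in> F then c n else 0)"
proof -
  have "inner_L2 (\<lambda>x. \<Sum>m\<in>F. c m * (indicator unit_cube x * character m x))
      (cube_character n)
     = (\<Sum>m\<in>F. c m * inner_L2 (cube_character m) (cube_character n))"
    unfolding inner_L2_cmult_left[symmetric]
    by (intro inner_L2_sum_left L2_cmult cube_character_L2)
  also have "\<dots> = (\<Sum>m\<in>F. if n = m then c m else 0)"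
    using F n by (intro sum.cong) (auto simp: inner_cube_character)
  also have "\<dots> = (if n \<in> F then c n else 0)"
    using F by (simp add: sum.delta)
  finally show ?thesis .
qed

lemma cube_trig_poly_norm:
  assumes F: "finite F" "F \<subseteq> int_vecs"
  shows "(L2_norm (\<lambda>x. \<Sum>m\<in>F. c m * (indicator unit_cube x * character m x)))\<^sup>2 = (\<Sum>m\<in>F. (cmod (c m))\<^sup>2)"
proof -
  let ?g = "\<lambda>x. \<Sum>m\<in>F. c m * (indicator unit_cube x * character m x)"
  have g: "?g \<in> L2" by (intro L2_sum L2_cmult cube_character_L2)
  have "of_real ((L2_norm ?g)\<^sup>2) = (\<Sum>m\<in>F. c m * inner_L2 (cube_character m) ?g)"
    unfolding inner_L2_self[symmetric] inner_L2_cmult_left[symmetric]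
    by (intro inner_L2_sum_left L2_cmult cube_character_L2 g)
  also have "\<dots> = (\<Sum>m\<in>F. c m * cnj (c m))"
  proof (intro sum.cong refl)
    fix m assume m: "m \<in> F"
    show "c m * inner_L2 (cube_character m) ?g = c m * cnj (c m)"
      unfolding inner_L2_commute[of _ ?g] using inner_cube_trig_poly[OF F, of m c] F m by auto
  qed
  also have "\<dots> = of_real (\<Sum>m\<in>F. (cmod (c m))\<^sup>2)"
    by (simp flip: complex_norm_square)
  finally show ?thesis unfolding of_real_eq_iff .
qed

text \<open>Pythagoras for the orthonormal characters. With \<open>c = a\<close> it yields Bessel's
  inequality; for other \<open>c\<close> it says that the Fourier coefficients leave the smallest
  error. \<open>parseval_unit_cube\<close> uses both.\<close>

lemma L2_norm_diff_trig_poly: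
  fixes h :: "real ^ 'n \<Rightarrow> complex"
  assumes h: "h \<in> L2" and F: "finite F" "F \<subseteq> int_vecs"
  defines "a \<equiv> \<lambda>m. inner_L2 h (cube_character m)"
  shows "(L2_norm (\<lambda>x. h x - (\<Sum>m\<in>F. c m * (indicator unit_cube x * character m x))))\<^sup>2
    = (L2_norm h)\<^sup>2 - (\<Sum>m\<in>F. (cmod (a m))\<^sup>2) + (\<Sum>m\<in>F. (cmod (a m - c m))\<^sup>2)"
proof -
  let ?g = "\<lambda>x. \<Sum>m\<in>F. c m * (indicator unit_cube x * character m x)"
  have g: "?g \<in> L2" by (intro L2_sum L2_cmult cube_character_L2)
  have "inner_L2 ?g h = (\<Sum>m\<in>F. c m * inner_L2 (cube_character m) h)"
    unfolding inner_L2_cmult_left[symmetric]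
    by (intro inner_L2_sum_left L2_cmult cube_character_L2 h)
  then have gh: "inner_L2 ?g h = (\<Sum>m\<in>F. c m * cnj (a m))"
    unfolding a_def inner_L2_commute[of _ h] .
  have "(cmod (a m - c m))\<^sup>2 = (cmod (a m))\<^sup>2 + (cmod (c m))\<^sup>2 - 2 * Re (c m * cnj (a m))" for m
    by (simp add: cmod_power2 power2_diff algebra_simps)
  then have "(\<Sum>m\<in>F. (cmod (a m - c m))\<^sup>2)
     = (\<Sum>m\<in>F. (cmod (a m))\<^sup>2) + (\<Sum>m\<in>F. (cmod (c m))\<^sup>2) - 2 * Re (inner_L2 ?g h)"
    unfolding gh by (simp add: sum.distrib sum_subtractf sum_distrib_left)
  moreover have "Re (inner_L2 h ?g) = Re (inner_L2 ?g h)"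
    unfolding inner_L2_commute[of h ?g] by simp
  ultimately show ?thesis
    unfolding L2_norm_diff_sq[OF h g] cube_trig_poly_norm[OF F] by linarith
qed

lemma nn_integral_count_space_has_sum:
  assumes s: "(f has_sum S) A" and nn: "\<And>x. x \<in> A \<Longrightarrow> f x \<ge> (0::real)"
  shows "(\<integral>\<^sup>+x. ennreal (f x) \<partial>count_space A) = ennreal S"
proof -
  have "f summable_on A" using s by (auto simp: summable_on_def)
  then have "(\<lambda>x. norm (f x)) summable_on A"
    by (subst summable_on_iff_abs_summable_on_real[symmetric])
  then have abs: "Infinite_Set_Sum.abs_summable_on f A"
    by (simp only: abs_summable_equivalent)
  show ?thesis
    using nn_integral_conv_infsetsum[OF abs nn] infsetsum_infsum[OF abs] infsumI[OF s] by simp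
qed

text \<open>Bessel's inequality bounds all finite sums from above. A trigonometric polynomial close
  to \<open>h\<close>, with frequencies in \<open>F\<close>, bounds the sums over supersets of
  \<open>F\<close> from below, because the Fourier coefficients approximate no worse than its
  own.\<close>

lemma parseval_unit_cube:
  fixes h :: "real ^ 'n \<Rightarrow> complex"
  assumes h: "h \<in> L2" and zero: "\<And>x. x \<notin> unit_cube \<Longrightarrow> h x = 0"
  shows "(\<integral>\<^sup>+m. ennreal ((cmod (inner_L2 h (cube_character m)))\<^sup>2) \<partial>count_space int_vecs)
    = sq_norm h"
proof -
  let ?a = "\<lambda>m. inner_L2 h (cube_character m)"
  have "((\<lambda>m. (cmod (?a m))\<^sup>2) has_sum (L2_norm h)\<^sup>2) int_vecs"
    unfolding has_sum_def
  proof (rule tendstoI)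
    fix e :: real assume e: "e > 0"
    obtain p where p: "trig_poly p" "sq_norm (\<lambda>x. h x - indicator unit_cube x * p x) < ennreal e"
      by (rule trig_poly_dense[OF h zero e])
    obtain F c where F: "finite F" "F \<subseteq> int_vecs" "p = (\<lambda>x. \<Sum>m\<in>F. c m * character m x)"
      using p(1) unfolding trig_poly_def by blast
    have eq: "indicator unit_cube x * p x = (\<Sum>m\<in>F. c m * (indicator unit_cube x * character m x))" for x
      unfolding F(3) sum_distrib_left by (simp add: mult_ac)
    have "(\<lambda>x. h x - (\<Sum>m\<in>F. c m * (indicator unit_cube x * character m x))) \<in> L2"
      by (intro L2_diff h L2_sum L2_cmult cube_character_L2)
    from sq_norm_L2[OF this] p(2) e
    have less: "(L2_norm (\<lambda>x. h x - (\<Sum>m\<in>F. c m * (indicator unit_cube x * character m x))))\<^sup>2 < e"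
      by (simp add: eq ennreal_less_iff)
    have "dist (\<Sum>m\<in>G. (cmod (?a m))\<^sup>2) ((L2_norm h)\<^sup>2) < e" if G: "finite G" "F \<subseteq> G" "G \<subseteq> int_vecs" for G
    proof -
      have "(\<Sum>m\<in>F. (cmod (?a m))\<^sup>2) \<le> (\<Sum>m\<in>G. (cmod (?a m))\<^sup>2)"
        using G by (intro sum_mono2) auto
      moreover have "(\<Sum>m\<in>G. (cmod (?a m))\<^sup>2) \<le> (L2_norm h)\<^sup>2"
        using L2_norm_diff_trig_poly[OF h G(1,3), of ?a]
          zero_le_power2[of "L2_norm (\<lambda>x. h x - (\<Sum>m\<in>G. ?a m * (indicator unit_cube x * character m x)))"]
        by simp
      moreover have "(L2_norm h)\<^sup>2 - (\<Sum>m\<in>F. (cmod (?a m))\<^sup>2) < e"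
        using L2_norm_diff_trig_poly[OF h F(1,2), of c] less
          sum_nonneg[of F "\<lambda>m. (cmod (?a m - c m))\<^sup>2"] by simp
      ultimately show ?thesis by (simp add: dist_real_def abs_if)
    qed
    then show "\<forall>\<^sub>F G in finite_subsets_at_top int_vecs. dist (\<Sum>m\<in>G. (cmod (?a m))\<^sup>2) ((L2_norm h)\<^sup>2) < e"
      unfolding eventually_finite_subsets_at_top using F by blast
  qed
  from nn_integral_count_space_has_sum[OF this] show ?thesis
    by (simp add: sq_norm_L2[OF h])
qed

section \<open>Plancherel's theorem\<close>

lemma nn_integral_lborel_affine:
  fixes t :: "'a :: euclidean_space"
  assumes [measurable]: "f \<in> borel_measurable borel" and r: "r > 0"
  shows "(\<integral>\<^sup>+x. f x \<partial>lborel) = ennreal (r ^ DIM('a)) * (\<integral>\<^sup>+x. f (t + r *\<^sub>R x) \<partial>lborel)"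
proof -
  have "(\<integral>\<^sup>+x. f x \<partial>lborel)
      = (\<integral>\<^sup>+x. f x \<partial>density (distr lborel borel (\<lambda>x. t + r *\<^sub>R x)) (\<lambda>_. \<bar>r\<bar> ^ DIM('a)))"
    using lborel_affine[of r t] r by simp
  then show ?thesis
    using r by (simp add: nn_integral_density nn_integral_distr nn_integral_cmult ennreal_power)
qed

lemma lborel_integral_affine:
  fixes t :: "'a :: euclidean_space" and f :: "'a \<Rightarrow> complex"
  assumes [measurable]: "f \<in> borel_measurable borel" and r: "r > 0"
  shows "(\<integral>x. f x \<partial>lborel) = (r ^ DIM('a)) *\<^sub>R (\<integral>x. f (t + r *\<^sub>R x) \<partial>lborel)"
proof -
  have "(\<integral>x. f x \<partial>lborel)
      = (\<integral>x. f x \<partial>density (distr lborel borel (\<lambda>x. t + r *\<^sub>R x)) (\<lambda>_. ennreal (r ^ DIM('a))))"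
    using lborel_affine[of r t] r by (simp add: ennreal_power)
  then show ?thesis
    using r by (simp add: integral_density integral_distr)
qed

text \<open>For square-integrable functions bounded support implies integrability, so that the
  Fourier integral converges. The generators on the frequency side have it because \<open>W\<close>
  is bounded.\<close>

definition bounded_support :: "('a :: real_normed_vector \<Rightarrow> complex) \<Rightarrow> bool" where
  "bounded_support f \<longleftrightarrow> (\<exists>R. \<forall>x. norm x > R \<longrightarrow> f x = 0)"

lemma bounded_support_indicator:
  assumes "bounded A" shows "bounded_support (\<lambda>x. indicator A x * f x)"
proof -
  obtain R where "\<And>x. x \<in> A \<Longrightarrow> norm x \<le> R" using assms by (auto simp: bounded_iff)
  then show ?thesis unfolding bounded_support_def by (intro exI[of _ R]) (force split: split_indicator)
qed

lemma bounded_support_diff: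
  assumes "bounded_support f" "bounded_support g"
  shows "bounded_support (\<lambda>x. f x - g x)"
proof -
  obtain R S where "\<And>x. norm x > R \<Longrightarrow> f x = 0" "\<And>x. norm x > S \<Longrightarrow> g x = 0"
    using assms unfolding bounded_support_def by blast
  then show ?thesis unfolding bounded_support_def by (intro exI[of _ "max R S"]) simp
qed

lemma bounded_support_cmult: "bounded_support f \<Longrightarrow> bounded_support (\<lambda>x. c * f x)"
  unfolding bounded_support_def by auto

lemma bounded_support_sum:
  assumes "finite I" "\<And>i. i \<in> I \<Longrightarrow> bounded_support (f i)"
  shows "bounded_support (\<lambda>x. \<Sum>i\<in>I. f i x)"
proof -
  obtain R where "\<And>i x. i \<in> I \<Longrightarrow> norm x > R i \<Longrightarrow> f i x = 0"
    using assms(2) unfolding bounded_support_def by metis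
  then show ?thesis unfolding bounded_support_def using assms(1)
    by (intro exI[of _ "Max (insert 0 (R ` I))"]) (auto intro!: sum.neutral)
qed

lemma L2_bounded_support_integrable:
  assumes f: "f \<in> L2" and b: "bounded_support f"
  shows "integrable lborel f"
proof -
  have [measurable]: "f \<in> borel_measurable borel" using f by (rule L2_measurable)
  obtain R where R: "\<And>x. norm x > R \<Longrightarrow> f x = 0" using b unfolding bounded_support_def by blast
  show ?thesis
  proof (rule Bochner_Integration.integrable_bound)
    have "emeasure lborel (cball 0 R :: (real ^ 'a) set) < \<infinity>"
      by (intro emeasure_bounded_finite bounded_cball)
    then have "integrable lborel (indicator (cball 0 R) :: real ^ 'a \<Rightarrow> real)"
      by simp
    then show "integrable lborel (\<lambda>x. (cmod (f x))\<^sup>2 + indicator (cball 0 R) x)"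
      using f by (intro Bochner_Integration.integrable_add) (auto simp: L2_def)
    show "AE x in lborel. norm (f x) \<le> norm ((cmod (f x))\<^sup>2 + indicator (cball 0 R) x)"
    proof (rule AE_I2)
      fix x
      have "cmod (f x) \<le> (cmod (f x))\<^sup>2 + 1"
        using sum_squares_bound[of "cmod (f x)" 1] norm_ge_zero[of "f x"] unfolding power_one by linarith
      then show "norm (f x) \<le> norm ((cmod (f x))\<^sup>2 + indicator (cball 0 R) x)"
        using R[of x] by (cases "norm x > R") auto
    qed
  qed simp
qed

text \<open>The sign \<open>s\<close> treats the transform (\<open>s = -1\<close>) and its inverse
  (\<open>s = 1\<close>) together, so that Plancherel and the inversion are stated once for
  both.\<close>

definition fourier :: "real \<Rightarrow> (real ^ 'n \<Rightarrow> complex) \<Rightarrow> real ^ 'n \<Rightarrow> complex" where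
  "fourier s f \<zeta> = (\<integral>x. f x * character (s *\<^sub>R \<zeta>) x \<partial>lborel)"

lemma fourier_integral_eq: "fourier_integral f = fourier (-1) f"
  unfolding fourier_integral_def fourier_def character_def cis_conv_exp
  by (intro ext Bochner_Integration.integral_cong refl) (simp add: mult_ac)

lemma fourier_measurable [measurable]:
  assumes [measurable]: "f \<in> borel_measurable borel"
  shows "fourier s f \<in> borel_measurable borel"
  unfolding fourier_def[abs_def] character_def cis_conv_exp by measurable

lemma integrable_mult_character:
  assumes "integrable lborel f"
  shows "integrable lborel (\<lambda>x. f x * character \<zeta> x)"
proof (rule Bochner_Integration.integrable_bound[OF assms])
  show "(\<lambda>x. f x * character \<zeta> x) \<in> borel_measurable lborel"
    using borel_measurable_integrable[OF assms] by measurable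
qed (auto simp: norm_mult)

lemma fourier_diff:
  assumes "integrable lborel f" "integrable lborel g"
  shows "fourier s (\<lambda>x. f x - g x) \<zeta> = fourier s f \<zeta> - fourier s g \<zeta>"
  unfolding fourier_def ring_distribs
  by (intro Bochner_Integration.integral_diff integrable_mult_character assms)

lemma fourier_sum:
  assumes "\<And>i. i \<in> I \<Longrightarrow> integrable lborel (f i)"
  shows "fourier s (\<lambda>x. \<Sum>i\<in>I. f i x) \<zeta> = (\<Sum>i\<in>I. fourier s (f i) \<zeta>)"
  unfolding fourier_def sum_distrib_right
  by (intro Bochner_Integration.integral_sum integrable_mult_character assms)

lemma fourier_cmult: "fourier s (\<lambda>x. c * f x) \<zeta> = c * fourier s f \<zeta>"
  by (simp add: fourier_def mult.assoc)

lemma fourier_cnj: "fourier (- s) (\<lambda>x. cnj (f x)) \<zeta> = cnj (fourier s f \<zeta>)"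
proof -
  have "character (- s *\<^sub>R \<zeta>) x = cnj (character (s *\<^sub>R \<zeta>) x)" for x
    using character_simps(3)[of "s *\<^sub>R \<zeta>" x] by simp
  then show ?thesis
    unfolding fourier_def by (simp flip: Bochner_Integration.integral_cnj)
qed

lemma plancherel_unit_cube:
  fixes h :: "real ^ 'n \<Rightarrow> complex"
  assumes h: "h \<in> L2" and zero: "\<And>x. x \<notin> unit_cube \<Longrightarrow> h x = 0"
  shows "sq_norm (fourier (-1) h) = sq_norm h"
proof -
  have [measurable]: "h \<in> borel_measurable borel" using h by (rule L2_measurable)
  have *: "(\<integral>\<^sup>+m. ennreal ((cmod (fourier (-1) h (a + m)))\<^sup>2) \<partial>count_space int_vecs) = sq_norm h" for a
  proof -
    let ?h = "\<lambda>x. h x * character (- a) x"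
    have "inner_L2 ?h (cube_character m) = fourier (-1) h (a + m)" for m
      unfolding inner_L2_def fourier_def
    proof (intro Bochner_Integration.integral_cong refl)
      fix x
      show "h x * character (- a) x * cnj (indicator unit_cube x * character m x)
          = h x * character (-1 *\<^sub>R (a + m)) x"
        using zero[of x] character_simps(1)[of "- a" "- m" x]
        by (cases "x \<in> unit_cube") (simp_all add: character_simps)
    qed
    moreover have "?h \<in> L2" by (rule L2_mult_bounded[OF h]) simp_all
    ultimately have "(\<integral>\<^sup>+m. ennreal ((cmod (fourier (-1) h (a + m)))\<^sup>2) \<partial>count_space int_vecs) = sq_norm ?h"
      using parseval_unit_cube[of ?h] zero by simp
    then show ?thesis by (simp add: sq_norm_def norm_mult)
  qed
  have "sq_norm (fourier (-1) h) = (\<integral>\<^sup>+a. indicator unit_cube a * sq_norm h \<partial>(lborel :: (real ^ 'n) measure))"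
    unfolding sq_norm_def[of "fourier (-1) h"]
    by (subst nn_integral_periodize) (simp_all add: *)
  also have "\<dots> = sq_norm h"
    by (simp add: nn_integral_multc emeasure_unit_cube)
  finally show ?thesis .
qed

theorem plancherel:
  fixes h :: "real ^ 'n \<Rightarrow> complex"
  assumes h: "h \<in> L2" and b: "bounded_support h" and s: "\<bar>s\<bar> = 1"
  shows "fourier s h \<in> L2" "sq_norm (fourier s h) = sq_norm h"
proof -
  have minus: "sq_norm (fourier (-1) h) = sq_norm h" if h: "h \<in> L2" and b: "bounded_support h"
    for h :: "real ^ 'n \<Rightarrow> complex"
  proof -
    let ?d = "DIM(real ^ 'n)"
    have [measurable]: "h \<in> borel_measurable borel" using h by (rule L2_measurable)
    obtain R where R0: "\<And>x. norm x > R \<Longrightarrow> h x = 0" using b unfolding bounded_support_def by blast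
    \<comment> \<open>The cube with corner \<open>t\<close> and side \<open>r\<close> reaches from
      \<open>- \<bar>R\<bar> - 1\<close> to \<open>\<bar>R\<bar> + 1\<close> in every coordinate and
      so contains the support of \<open>h\<close>; the absolute value guards against a negative
      \<open>R\<close>.\<close>
    define r where "r = 2 * (\<bar>R\<bar> + 1)"
    define t where "t = (- (\<bar>R\<bar> + 1)) *\<^sub>R (1 :: real ^ 'n)"
    have r: "r > 0" by (simp add: r_def)
    define g where "g y = h (t + r *\<^sub>R y)" for y
    have [measurable]: "g \<in> borel_measurable borel" unfolding g_def by measurable
    have sh: "sq_norm h = ennreal (r ^ ?d) * sq_norm g"
      unfolding sq_norm_def g_def by (rule nn_integral_lborel_affine) (use r in simp_all)
    have "sq_norm g < \<infinity>"
    proof (rule ccontr)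
      assume "\<not> sq_norm g < \<infinity>"
      then have "sq_norm g = \<infinity>" by (simp add: less_top[symmetric])
      then have "sq_norm h = \<infinity>" using sh r by (simp add: ennreal_mult_eq_top_iff)
      then show False using h by (simp add: L2_iff)
    qed
    then have gL2: "g \<in> L2" by (simp add: L2_iff)
    have g0: "g y = 0" if "y \<notin> unit_cube" for y
    proof -
      have "\<not> (\<forall>i. 0 \<le> y $ i \<and> y $ i < 1)"
        using that by (simp add: unit_cube_def)
      then obtain i where i: "y $ i < 0 \<or> y $ i \<ge> 1"
        by (meson not_le)
      have comp: "(t + r *\<^sub>R y) $ i = r * (y $ i) - (\<bar>R\<bar> + 1)"
        by (simp add: t_def)
      have "\<bar>(t + r *\<^sub>R y) $ i\<bar> > R"
        using i
      proof
        assume "y $ i < 0"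
        then have "r * (y $ i) < 0" using r by (simp add: mult_pos_neg)
        then show ?thesis unfolding comp by linarith
      next
        assume "y $ i \<ge> 1"
        then have "r * (y $ i) \<ge> r * 1" using r by (intro mult_left_mono) auto
        then have "r * (y $ i) - (\<bar>R\<bar> + 1) \<ge> \<bar>R\<bar> + 1" unfolding r_def by simp
        then show ?thesis unfolding comp by linarith
      qed
      then have "norm (t + r *\<^sub>R y) > R"
        using component_le_norm_cart[of "t + r *\<^sub>R y" i] by linarith
      then show ?thesis unfolding g_def by (rule R0)
    qed
    have ft: "fourier (-1) h \<zeta> = (r ^ ?d) *\<^sub>R (character (- \<zeta>) t * fourier (-1) g (r *\<^sub>R \<zeta>))" for \<zeta>
    proof -
      have "fourier (-1) h \<zeta> = (r ^ ?d) *\<^sub>R (\<integral>y. h (t + r *\<^sub>R y) * character (- 1 *\<^sub>R \<zeta>) (t + r *\<^sub>R y) \<partial>lborel)"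
        unfolding fourier_def by (rule lborel_integral_affine) (use r in simp_all)
      also have "(\<integral>y. h (t + r *\<^sub>R y) * character (- 1 *\<^sub>R \<zeta>) (t + r *\<^sub>R y) \<partial>lborel)
         = (\<integral>y. character (- \<zeta>) t * (g y * character (- 1 *\<^sub>R (r *\<^sub>R \<zeta>)) y) \<partial>lborel)"
        unfolding g_def character_simps by (simp add: character_def cis_cnj mult_ac)
      finally show ?thesis by (simp add: fourier_def)
    qed
    \<comment> \<open>One of the two factors \<open>r ^ ?d\<close> is consumed by the substitution
      in the frequency variable; the other is the factor in \<open>sh\<close>.\<close>
    have "sq_norm (fourier (-1) h)
      = (\<integral>\<^sup>+\<zeta>. ennreal (r ^ ?d) * (ennreal (r ^ ?d) * ennreal ((cmod (fourier (-1) g (0 + r *\<^sub>R \<zeta>)))\<^sup>2)) \<partial>lborel)"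
      unfolding sq_norm_def
    proof (rule nn_integral_cong)
      fix \<zeta> :: "real ^ 'n"
      have "(cmod (fourier (-1) h \<zeta>))\<^sup>2 = r ^ ?d * (r ^ ?d * (cmod (fourier (-1) g (0 + r *\<^sub>R \<zeta>)))\<^sup>2)"
        using r by (simp add: ft norm_mult power_mult_distrib power2_eq_square)
      then show "ennreal ((cmod (fourier (-1) h \<zeta>))\<^sup>2)
         = ennreal (r ^ ?d) * (ennreal (r ^ ?d) * ennreal ((cmod (fourier (-1) g (0 + r *\<^sub>R \<zeta>)))\<^sup>2))"
        using r by (simp add: ennreal_mult)
    qed
    also have "\<dots> = ennreal (r ^ ?d) * (ennreal (r ^ ?d) * (\<integral>\<^sup>+\<zeta>. ennreal ((cmod (fourier (-1) g (0 + r *\<^sub>R \<zeta>)))\<^sup>2) \<partial>lborel))"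
      by (simp add: nn_integral_cmult)
    also have "ennreal (r ^ ?d) * (\<integral>\<^sup>+\<zeta>. ennreal ((cmod (fourier (-1) g (0 + r *\<^sub>R \<zeta>)))\<^sup>2) \<partial>lborel) = sq_norm (fourier (-1) g)"
      unfolding sq_norm_def by (rule nn_integral_lborel_affine[symmetric]) (use r in simp_all)
    also have "\<dots> = sq_norm g" by (rule plancherel_unit_cube[OF gL2 g0])
    finally show ?thesis using sh by simp
  qed
  have s': "s = - 1 \<or> s = 1" using s by linarith
  show "sq_norm (fourier s h) = sq_norm h"
    using s'
  proof
    assume "s = 1"
    \<comment> \<open>Conjugation exchanges the two signs and preserves the norm.\<close>
    have "sq_norm (fourier 1 h) = sq_norm (fourier (-1) (\<lambda>x. cnj (h x)))"
      by (simp add: sq_norm_def fourier_cnj)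
    also have "\<dots> = sq_norm (\<lambda>x. cnj (h x))"
      by (rule minus) (use h b in \<open>simp_all add: L2_iff sq_norm_def bounded_support_def borel_measurable_cnj\<close>)
    also have "\<dots> = sq_norm h" by (simp add: sq_norm_def)
    finally show ?thesis by (simp add: \<open>s = 1\<close>)
  qed (simp add: minus[OF h b])
  then show "fourier s h \<in> L2" using h by (simp add: L2_iff fourier_measurable)
qed

lemma L2_norm_eq_sq_norm: "f \<in> L2 \<Longrightarrow> g \<in> L2 \<Longrightarrow> L2_norm f = L2_norm g \<longleftrightarrow> sq_norm f = sq_norm g"
  by (simp add: sq_norm_L2) (auto simp: L2_norm_def power2_eq_iff_nonneg)

text \<open>The kernel has modulus \<open>cmod (G \<zeta>) * cmod (f x)\<close>, hence is integrable
  on the product, and Fubini exchanges the integrals.\<close>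

lemma fourier_adjoint:
  fixes f G :: "real ^ 'n \<Rightarrow> complex"
  assumes f: "integrable lborel f" and G: "integrable lborel G"
  shows "inner_L2 (fourier (- s) G) f = inner_L2 G (fourier s f)"
proof -
  have [measurable]: "f \<in> borel_measurable borel" "G \<in> borel_measurable borel"
    using f G by auto
  let ?K = "\<lambda>\<zeta> x. G \<zeta> * character (- s *\<^sub>R x) \<zeta> * cnj (f x)"
  have nK: "norm (?K \<zeta> x) = cmod (G \<zeta>) * cmod (f x)" for \<zeta> x
    by (simp add: norm_mult)
  have "integrable (lborel \<Otimes>\<^sub>M lborel) (case_prod ?K)"
  proof (rule lborel_pair.Fubini_integrable)
    show "case_prod ?K \<in> borel_measurable (lborel \<Otimes>\<^sub>M lborel)"
      unfolding character_def cis_conv_exp by measurable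
    show "integrable lborel (\<lambda>\<zeta>. \<integral>x. norm (case (\<zeta>, x) of (\<zeta>, x) \<Rightarrow> ?K \<zeta> x) \<partial>lborel)"
      unfolding prod.case nK using G by simp
    show "AE \<zeta> in lborel. integrable lborel (\<lambda>x. case (\<zeta>, x) of (\<zeta>, x) \<Rightarrow> ?K \<zeta> x)"
    proof (rule AE_I2)
      fix \<zeta> :: "real ^ 'n"
      have "integrable lborel (\<lambda>x. G \<zeta> * (cnj (f x) * character (- s *\<^sub>R \<zeta>) x))"
        using f by (intro integrable_mult_right integrable_mult_character) simp
      then show "integrable lborel (\<lambda>x. case (\<zeta>, x) of (\<zeta>, x) \<Rightarrow> ?K \<zeta> x)"
        by (simp add: character_def mult_ac inner_commute)
    qed
  qed
  then have "(\<integral>x. (\<integral>\<zeta>. ?K \<zeta> x \<partial>lborel) \<partial>lborel) = (\<integral>\<zeta>. (\<integral>x. ?K \<zeta> x \<partial>lborel) \<partial>lborel)"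
    by (rule lborel_pair.Fubini_integral)
  moreover have "(\<integral>\<zeta>. ?K \<zeta> x \<partial>lborel) = fourier (- s) G x * cnj (f x)" for x
    by (simp add: fourier_def)
  moreover have "(\<integral>x. ?K \<zeta> x \<partial>lborel) = G \<zeta> * cnj (fourier s f \<zeta>)" for \<zeta>
  proof -
    have "?K \<zeta> x = G \<zeta> * cnj (f x * character (s *\<^sub>R \<zeta>) x)" for x
      by (simp add: character_def cis_cnj inner_commute)
    then have "(\<integral>x. ?K \<zeta> x \<partial>lborel) = (\<integral>x. G \<zeta> * cnj (f x * character (s *\<^sub>R \<zeta>) x) \<partial>lborel)"
      by (simp only:)
    also have "\<dots> = G \<zeta> * (\<integral>x. cnj (f x * character (s *\<^sub>R \<zeta>) x) \<partial>lborel)"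
      by (rule integral_mult_right_zero)
    finally show ?thesis
      unfolding fourier_def Bochner_Integration.integral_cnj .
  qed
  ultimately show ?thesis unfolding inner_L2_def by (simp only:)
qed

text \<open>Both sides expand to the same expression, because the transform is isometric and
  \<open>fourier (- s)\<close> is its adjoint. Taking for \<open>G\<close> a truncation of \<open>fourier s f\<close> gives the
  inversion theorem.\<close>

lemma fourier_inverse_distance:
  fixes f G :: "real ^ 'n \<Rightarrow> complex"
  assumes f: "f \<in> L2" "bounded_support f" and G: "G \<in> L2" "bounded_support G" and s: "\<bar>s\<bar> = 1"
  shows "L2_norm (\<lambda>x. fourier (- s) G x - f x) = L2_norm (\<lambda>\<zeta>. G \<zeta> - fourier s f \<zeta>)"
proof -
  have Ff: "fourier s f \<in> L2" "sq_norm (fourier s f) = sq_norm f"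
    using plancherel[OF f s] by blast+
  have FG: "fourier (- s) G \<in> L2" "sq_norm (fourier (- s) G) = sq_norm G"
    using plancherel[OF G, of "- s"] s by auto
  have "L2_norm (fourier s f) = L2_norm f" "L2_norm (fourier (- s) G) = L2_norm G"
    using L2_norm_eq_sq_norm Ff FG f G by blast+
  then have "(L2_norm (\<lambda>x. fourier (- s) G x - f x))\<^sup>2 = (L2_norm (\<lambda>\<zeta>. G \<zeta> - fourier s f \<zeta>))\<^sup>2"
    unfolding L2_norm_diff_sq[OF FG(1) f(1)] L2_norm_diff_sq[OF G(1) Ff(1)]
    by (simp add: fourier_adjoint L2_bounded_support_integrable f G)
  then show ?thesis
    by (rule power2_eq_imp_eq) (simp_all add: L2_norm_def integral_nonneg_AE)
qed

lemma truncation_tendsto: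
  fixes f :: "real ^ 'n \<Rightarrow> complex"
  assumes f: "f \<in> L2"
  shows "(\<lambda>n. sq_norm (\<lambda>x. indicator (ball 0 (real n)) x * f x - f x)) \<longlonglongrightarrow> 0"
    and "(\<lambda>n. L2_norm (\<lambda>x. indicator (ball 0 (real n)) x * f x - f x)) \<longlonglongrightarrow> 0"
proof -
  have [measurable]: "f \<in> borel_measurable borel" using f by (rule L2_measurable)
  let ?u = "\<lambda>n x. indicator (ball 0 (real n)) x * f x"
  have uL2: "?u n \<in> L2" for n using f by (intro L2_indicator_mult) auto
  note [measurable] = L2_measurable[OF uL2]
  show lim: "(\<lambda>n. sq_norm (\<lambda>x. ?u n x - f x)) \<longlonglongrightarrow> 0"
  proof (rule sq_norm_dominated[where w = "\<lambda>x. ennreal ((cmod (f x))\<^sup>2)"])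
    show "AE x in lborel. ennreal ((cmod (?u n x - f x))\<^sup>2) \<le> ennreal ((cmod (f x))\<^sup>2)" for n
      by (rule AE_I2) (simp split: split_indicator)
    show "AE x in lborel. (\<lambda>n. ?u n x) \<longlonglongrightarrow> f x"
    proof (intro AE_I2 tendsto_eventually)
      fix x :: "real ^ 'n"
      obtain n0 where n0: "norm x < real n0" using reals_Archimedean2 by blast
      have "?u n x = f x" if "n \<ge> n0" for n
        using n0 of_nat_mono[OF that, where 'a = real] by (simp add: indicator_def)
      then show "\<forall>\<^sub>F n in sequentially. ?u n x = f x"
        unfolding eventually_sequentially by blast
    qed
  qed (use f in \<open>simp_all add: L2_iff sq_norm_def\<close>)
  from lim have "(\<lambda>n. ennreal ((L2_norm (\<lambda>x. ?u n x - f x))\<^sup>2)) \<longlonglongrightarrow> ennreal 0"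
    by (simp add: sq_norm_L2[OF L2_diff[OF uL2 f]])
  then have "(\<lambda>n. (L2_norm (\<lambda>x. ?u n x - f x))\<^sup>2) \<longlonglongrightarrow> 0"
    by (subst (asm) tendsto_ennreal_iff) auto
  then have "(\<lambda>n. sqrt ((L2_norm (\<lambda>x. ?u n x - f x))\<^sup>2)) \<longlonglongrightarrow> sqrt 0"
    by (rule tendsto_real_sqrt)
  then show "(\<lambda>n. L2_norm (\<lambda>x. ?u n x - f x)) \<longlonglongrightarrow> 0"
    by (simp add: L2_norm_def integral_nonneg_AE)
qed

theorem is_fourier_transform_inverse:
  fixes h :: "real ^ 'n \<Rightarrow> complex"
  assumes h: "h \<in> L2" "bounded_support h"
  shows "is_fourier_transform (fourier 1 h) h"
proof -
  let ?\<psi> = "fourier 1 h"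
  let ?u = "\<lambda>n x. indicator (ball 0 (real n)) x * ?\<psi> x"
  have \<psi>: "?\<psi> \<in> L2" using plancherel(1)[OF h, of 1] by simp
  have u: "?u n \<in> L2" "bounded_support (?u n)" for n
    using \<psi> by (auto intro: L2_indicator_mult bounded_support_indicator)
  have "fourier_integral (?u n) \<in> L2" for n
    unfolding fourier_integral_eq by (rule plancherel(1)[OF u]) simp
  moreover have "(\<lambda>n. L2_norm (\<lambda>x. ?u n x - ?\<psi> x)) \<longlonglongrightarrow> 0"
    by (rule truncation_tendsto(2)[OF \<psi>])
  \<comment> \<open>Truncating \<open>?\<psi>\<close> makes equal errors on both sides, so one limit
    settles both convergence conditions of the definition.\<close>
  moreover have "L2_norm (\<lambda>\<zeta>. fourier_integral (?u n) \<zeta> - h \<zeta>) = L2_norm (\<lambda>x. ?u n x - ?\<psi> x)" for n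
    unfolding fourier_integral_eq using fourier_inverse_distance[OF h u, of 1] by simp
  ultimately show ?thesis
    unfolding is_fourier_transform_def using \<psi> h(1) u L2_bounded_support_integrable[OF u]
    by (intro conjI exI[of _ ?u]) simp_all
qed

section \<open>Riesz bases of exponentials on multi-tiles\<close>

definition exponential_riesz_bounds :: "real \<Rightarrow> real \<Rightarrow> (real ^ 'n) set \<Rightarrow> (real ^ 'n) set \<Rightarrow> bool" where
  "exponential_riesz_bounds C1 C2 \<Lambda> W \<longleftrightarrow> 0 < C1 \<and> C1 \<le> C2 \<and> (\<forall>F c. finite F \<longrightarrow> F \<subseteq> \<Lambda> \<longrightarrow>
     ennreal (C1 * (\<Sum>l\<in>F. (cmod (c l))\<^sup>2)) \<le> sq_norm (\<lambda>x. indicator W x * exp_sum F c x) \<and>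
     sq_norm (\<lambda>x. indicator W x * exp_sum F c x) \<le> ennreal (C2 * (\<Sum>l\<in>F. (cmod (c l))\<^sup>2)))"

text \<open>The space \<open>L\<^sup>2(W)\<close> is modelled by multiplication with the indicator
  of \<open>W\<close>, so \<open>h\<close> ranges over \<open>L2\<close> on the whole space.\<close>

definition exponentials_dense :: "(real ^ 'n) set \<Rightarrow> (real ^ 'n) set \<Rightarrow> bool" where
  "exponentials_dense \<Lambda> W \<longleftrightarrow> (\<forall>h\<in>L2. \<forall>e>0. \<exists>F c. finite F \<and> F \<subseteq> \<Lambda> \<and>
     sq_norm (\<lambda>x. indicator W x * (h x - exp_sum F c x)) < ennreal e)"

definition exponential_riesz_basis :: "(real ^ 'n) set \<Rightarrow> (real ^ 'n) set \<Rightarrow> bool" where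
  "exponential_riesz_basis \<Lambda> W \<longleftrightarrow>
     (\<exists>C1 C2. exponential_riesz_bounds C1 C2 \<Lambda> W) \<and> exponentials_dense \<Lambda> W"

lemma exponential_riesz_boundsD:
  assumes "exponential_riesz_bounds C1 C2 \<Lambda> W"
  shows "0 < C1" "C1 \<le> C2"
    and "finite F \<Longrightarrow> F \<subseteq> \<Lambda> \<Longrightarrow> ennreal (C1 * (\<Sum>l\<in>F. (cmod (c l))\<^sup>2))
      \<le> sq_norm (\<lambda>x. indicator W x * exp_sum F c x)"
    and "finite F \<Longrightarrow> F \<subseteq> \<Lambda> \<Longrightarrow> sq_norm (\<lambda>x. indicator W x * exp_sum F c x)
      \<le> ennreal (C2 * (\<Sum>l\<in>F. (cmod (c l))\<^sup>2))"
  using assms unfolding exponential_riesz_bounds_def by simp_all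

lemma exponentials_denseD:
  assumes "exponentials_dense \<Lambda> W" "h \<in> L2" "e > 0"
  obtains F c where "finite F" "F \<subseteq> \<Lambda>"
    "sq_norm (\<lambda>x. indicator W x * (h x - exp_sum F c x)) < ennreal e"
  using bspec[OF assms(1)[unfolded exponentials_dense_def] assms(2)] assms(3) that by blast

section \<open>Lagrange interpolation and Vandermonde systems\<close>

lemma norm_sum_mult_sq_le:
  fixes a b :: "'i \<Rightarrow> complex"
  shows "(cmod (\<Sum>i\<in>I. a i * b i))\<^sup>2 \<le> (\<Sum>i\<in>I. (cmod (a i))\<^sup>2) * (\<Sum>i\<in>I. (cmod (b i))\<^sup>2)"
proof -
  have "(cmod (\<Sum>i\<in>I. a i * b i))\<^sup>2 \<le> (\<Sum>i\<in>I. cmod (a i) * cmod (b i))\<^sup>2"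
    by (intro power_mono order_trans[OF norm_sum]) (simp_all add: norm_mult)
  also have "\<dots> \<le> (\<Sum>i\<in>I. (cmod (a i))\<^sup>2) * (\<Sum>i\<in>I. (cmod (b i))\<^sup>2)"
    by (rule Cauchy_Schwarz_ineq_sum)
  finally show ?thesis .
qed

lemma poly_eq_sum_lessThan:
  fixes p :: "'a :: comm_semiring_1 poly"
  assumes "degree p < k"
  shows "poly p x = (\<Sum>j<k. coeff p j * x ^ j)"
  unfolding poly_altdef using assms
  by (intro sum.mono_neutral_left) (auto simp: coeff_eq_0)

text \<open>The coefficients of the Lagrange basis polynomials invert the Vandermonde matrix, as
  evaluation at the nodes and interpolation undo each other in degree below \<open>k\<close>. Both
  identities are needed: the first recovers coefficients from values and gives the lower Riesz
  bound, the second realizes prescribed values and gives density. The nodes are indexed by a set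
  \<open>S\<close> because they will belong to translates.\<close>

lemma lagrange_inverse_vandermonde:
  fixes w :: "'m \<Rightarrow> complex"
  assumes S: "finite S" "inj_on w S" "card S = k" and k: "k \<ge> 1"
  shows "\<exists>u. (\<forall>y j. j < k \<longrightarrow> y j = (\<Sum>m\<in>S. u m j * (\<Sum>i<k. w m ^ i * y i)))
     \<and> (\<forall>v. \<forall>m\<in>S. (\<Sum>j<k. w m ^ j * (\<Sum>m'\<in>S. u m' j * v m')) = v m)"
proof -
  define l where "l m = (\<Prod>n\<in>S - {m}. smult (1 / (w m - w n)) [:- w n, 1:])" for m
  have l_deg: "degree (l m) < k" if "m \<in> S" for m
  proof -
    have "degree (l m) \<le> (\<Sum>n\<in>S - {m}. degree (smult (1 / (w m - w n)) [:- w n, 1:]))"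
      unfolding l_def by (rule order_trans[OF degree_prod_sum_le]) (use S(1) in \<open>simp_all add: o_def\<close>)
    also have "\<dots> \<le> (\<Sum>n\<in>S - {m}. 1)"
      by (intro sum_mono) (auto intro: order_trans[OF degree_smult_le])
    also have "\<dots> < k" using S that k by simp
    finally show ?thesis .
  qed
  have l_val: "poly (l m) (w n) = (if n = m then 1 else 0)" if "m \<in> S" "n \<in> S" for m n
  proof (cases "n = m")
    case True
    have "w m \<noteq> w n'" if "n' \<in> S - {m}" for n'
      using S(2) that \<open>m \<in> S\<close> by (auto simp: inj_on_def)
    then show ?thesis
      by (auto simp: l_def poly_prod True simp flip: diff_divide_distrib intro!: prod.neutral)
  next
    case False
    then show ?thesis
      using S(1) that by (auto simp: l_def poly_prod intro!: prod_zero bexI[of _ n])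
  qed
  define u where "u m j = coeff (l m) j" for m j
  have lw: "(\<Sum>j<k. w n ^ j * u m j) = (if n = m then 1 else 0)" if "m \<in> S" "n \<in> S" for m n
    using poly_eq_sum_lessThan[OF l_deg[OF that(1)], of "w n"] l_val[OF that] by (simp add: u_def mult.commute)
  have 1: "y j = (\<Sum>m\<in>S. u m j * (\<Sum>i<k. w m ^ i * y i))" if j: "j < k" for y j
  proof -
    define p where "p = (\<Sum>i<k. monom (y i) i)"
    have p_coeff: "coeff p i = (if i < k then y i else 0)" for i
      by (simp add: p_def coeff_sum coeff_monom)
    have p_val: "poly p x = (\<Sum>i<k. x ^ i * y i)" for x
      by (simp add: p_def poly_sum poly_monom mult.commute)
    \<comment> \<open>\<open>q\<close> interpolates \<open>p\<close> at the \<open>k\<close> nodes;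
      the difference has degree below \<open>k\<close> and \<open>k\<close> roots, so it
      vanishes.\<close>
    define q where "q = (\<Sum>m\<in>S. smult (poly p (w m)) (l m))"
    have "poly (p - q) (w n) = 0" if "n \<in> S" for n
    proof -
      have "poly q (w n) = (\<Sum>m\<in>S. if n = m then poly p (w m) else 0)"
        unfolding q_def poly_sum poly_smult using that by (intro sum.cong) (auto simp: l_val)
      then show ?thesis using that S(1) by simp
    qed
    then have "w ` S \<subseteq> {x. poly (p - q) x = 0}" by auto
    moreover have "card (w ` S) = k" using S by (simp add: card_image)
    moreover have "degree (p - q) < k"
    proof -
      have "coeff (p - q) i = 0" if "i \<ge> k" for i
      proof -
        have "coeff (l m) i = 0" if "m \<in> S" for m
          using l_deg[OF that] \<open>i \<ge> k\<close> by (intro coeff_eq_0) simp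
        then show ?thesis using that by (simp add: p_coeff q_def coeff_sum)
      qed
      then have "degree (p - q) \<le> k - 1" using k by (intro degree_le) auto
      then show ?thesis using k by simp
    qed
    ultimately have "p - q = 0"
      using card_poly_roots_bound[of "p - q"] card_mono[of "{x. poly (p - q) x = 0}" "w ` S"] poly_roots_finite[of "p - q"]
      by force
    then have "coeff p j = coeff q j" by simp
    then show ?thesis using j by (simp add: p_coeff q_def coeff_sum u_def p_val mult.commute)
  qed
  have 2: "(\<Sum>j<k. w m ^ j * (\<Sum>m'\<in>S. u m' j * v m')) = v m" if m: "m \<in> S" for v m
  proof -
    have "(\<Sum>j<k. w m ^ j * (\<Sum>m'\<in>S. u m' j * v m')) = (\<Sum>m'\<in>S. (\<Sum>j<k. w m ^ j * u m' j) * v m')"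
      unfolding sum_distrib_left sum_distrib_right by (subst sum.swap) (simp add: mult.assoc)
    also have "\<dots> = (\<Sum>m'\<in>S. if m = m' then v m' else 0)"
      using m by (intro sum.cong) (auto simp: lw)
    also have "\<dots> = v m" using m S(1) by simp
    finally show ?thesis .
  qed
  show ?thesis using 1 2 by blast
qed

section \<open>Integer vectors in bounded sets and generic shifts\<close>

lemma finite_bounded_int_vecs:
  assumes B: "bounded B" shows "finite (int_vecs \<inter> B :: (real ^ 'n) set)"
proof -
  obtain R where R: "\<And>x. x \<in> B \<Longrightarrow> norm x \<le> R" using B by (auto simp: bounded_iff)
  let ?N = "real_of_int ` {- \<lceil>R\<rceil>..\<lceil>R\<rceil>}"
  have "int_vecs \<inter> B \<subseteq> (\<lambda>f. \<chi> i. f i) ` (PiE UNIV (\<lambda>_ :: 'n. ?N))"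
  proof
    fix x assume x: "x \<in> int_vecs \<inter> B"
    have "x $ i \<in> ?N" for i
    proof -
      have "x $ i \<in> \<int>" using x unfolding int_vecs_def by blast
      then obtain z where z: "x $ i = real_of_int z" by (rule Ints_cases)
      have "\<bar>x $ i\<bar> \<le> R" using component_le_norm_cart[of x i] R x by fastforce
      then have "\<bar>z\<bar> \<le> \<lceil>R\<rceil>" unfolding z by linarith
      then show ?thesis unfolding z by (intro imageI) (simp add: abs_le_iff)
    qed
    then have "vec_nth x \<in> PiE UNIV (\<lambda>_. ?N)" by (simp add: PiE_def)
    then show "x \<in> (\<lambda>f. \<chi> i. f i) ` (PiE UNIV (\<lambda>_. ?N))"
      by (rule rev_image_eqI) simp
  qed
  moreover have "finite (PiE UNIV (\<lambda>_ :: 'n. ?N))" by (intro finite_PiE) auto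
  ultimately show ?thesis by (meson finite_imageI finite_subset)
qed

text \<open>Moving \<open>b\<close> along the new vector \<open>v\<close> spoils the condition for
  each \<open>u\<close> at one parameter \<open>t\<close> at most, and there are infinitely many
  parameters. If \<open>v \<bullet> u = 0\<close>, the inner product with \<open>u\<close> does not
  change at all; the value then excluded, 0 by division by zero, does no harm.\<close>

lemma exists_nonorthogonal:
  fixes V :: "'a :: real_inner set"
  assumes "finite V" "0 \<notin> V"
  shows "\<exists>b. \<forall>v\<in>V. b \<bullet> v \<noteq> 0"
  using assms
proof (induction V rule: finite_induct)
  case (insert v V)
  then obtain b where b: "\<forall>u\<in>V. b \<bullet> u \<noteq> 0" by auto
  have v: "v \<bullet> v \<noteq> 0" using insert.prems by auto
  have "finite (insert (- (b \<bullet> v) / (v \<bullet> v)) ((\<lambda>u. - (b \<bullet> u) / (v \<bullet> u)) ` V))"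
    using insert.hyps by simp
  from ex_new_if_finite[OF infinite_UNIV_char_0 this]
  obtain t where t: "t \<noteq> - (b \<bullet> v) / (v \<bullet> v)" "\<And>u. u \<in> V \<Longrightarrow> t \<noteq> - (b \<bullet> u) / (v \<bullet> u)"
    by auto
  have "(b + t *\<^sub>R v) \<bullet> u \<noteq> 0" if "u \<in> insert v V" for u
  proof
    assume "(b + t *\<^sub>R v) \<bullet> u = 0"
    then have eq: "t * (v \<bullet> u) = - (b \<bullet> u)" by (simp add: inner_add_left)
    show False
    proof (cases "v \<bullet> u = 0")
      case True
      then show False using eq b that v by auto
    next
      case False
      then have "t = - (b \<bullet> u) / (v \<bullet> u)" using eq by (simp add: field_simps)
      then show False using t that by auto
    qed
  qed
  then show ?case by blast
qed auto

text \<open>A nonzero number of modulus below 1 is not an integer; smallness thus turns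
  non-orthogonality into non-integrality, which is what separates characters.\<close>

lemma exists_small_nonorthogonal:
  fixes V :: "'a :: real_inner set"
  assumes V: "finite V" "0 \<notin> V" and e: "e > 0"
  obtains b where "\<And>v. v \<in> V \<Longrightarrow> b \<bullet> v \<noteq> 0" "\<And>v. v \<in> V \<Longrightarrow> \<bar>b \<bullet> v\<bar> < e"
proof -
  obtain a where a: "\<forall>v\<in>V. a \<bullet> v \<noteq> 0" using exists_nonorthogonal[OF V] by blast
  \<comment> \<open>\<open>K\<close> exceeds every \<open>\<bar>a \<bullet> v\<bar>\<close>; the
    summand 1 keeps it positive and the bound strict.\<close>
  define K where "K = 1 + (\<Sum>v\<in>V. \<bar>a \<bullet> v\<bar>)"
  have K: "K > 0" by (simp add: K_def add_pos_nonneg sum_nonneg)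
  have aK: "\<bar>a \<bullet> v\<bar> < K" if "v \<in> V" for v
    using member_le_sum[of v V "\<lambda>v. \<bar>a \<bullet> v\<bar>"] V that by (simp add: K_def)
  show ?thesis
  proof (rule that[of "(e / K) *\<^sub>R a"])
    fix v assume v: "v \<in> V"
    show "(e / K) *\<^sub>R a \<bullet> v \<noteq> 0" using a v e K by simp
    have "\<bar>(e / K) *\<^sub>R a \<bullet> v\<bar> = e * (\<bar>a \<bullet> v\<bar> / K)" using e K by (simp add: abs_mult)
    also have "\<dots> < e * 1" using aK[OF v] e K by (intro mult_strict_left_mono) auto
    finally show "\<bar>(e / K) *\<^sub>R a \<bullet> v\<bar> < e" by simp
  qed
qed

lemma character_scale_nat: "character (real j *\<^sub>R b) x = character b x ^ j"
  unfolding character_def Complex.DeMoivre by (rule arg_cong[where f = cis]) simp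

section \<open>Folding a multi-tile onto the unit cube\<close>

locale integer_multitile =
  fixes W :: "(real ^ 'n) set" and k :: nat
  assumes W_borel [measurable]: "W \<in> sets borel" and W_bounded: "bounded W" and k: "k \<ge> 1"
    and tiling: "AE x in lborel. card {m \<in> int_vecs. x + m \<in> W} = k"
begin

text \<open>All fibres over the cube are subsets of this one set, which is finite because
  \<open>W\<close> and the cube are bounded; hence only finitely many fibres occur.\<close>

definition M :: "(real ^ 'n) set" where
  "M = {m \<in> int_vecs. \<exists>x\<in>unit_cube. x + m \<in> W}"

lemma M_int: "M \<subseteq> int_vecs"
  by (auto simp: M_def)

lemma finite_M: "finite M"
proof -
  obtain R where R: "\<And>x. x \<in> W \<Longrightarrow> norm x \<le> R" using W_bounded by (auto simp: bounded_iff)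
  have "bounded (unit_cube :: (real ^ 'n) set)"
    using unit_cube_between(2) by (rule bounded_subset[OF bounded_cbox])
  then obtain R' where R': "\<And>x. x \<in> unit_cube \<Longrightarrow> norm (x :: real ^ 'n) \<le> R'" by (auto simp: bounded_iff)
  have "M \<subseteq> int_vecs \<inter> cball 0 (R + R')"
  proof
    fix m assume "m \<in> M"
    then obtain x where x: "x \<in> unit_cube" "x + m \<in> W" "m \<in> int_vecs" by (auto simp: M_def)
    then have "norm m \<le> R + R'"
      using R[OF x(2)] R'[OF x(1)] norm_triangle_ineq4[of "x + m" x] by simp
    then show "m \<in> int_vecs \<inter> cball 0 (R + R')" using x by simp
  qed
  then show ?thesis
    using finite_bounded_int_vecs[OF bounded_cball] finite_subset by blast
qed

definition fibre :: "real ^ 'n \<Rightarrow> (real ^ 'n) set" where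
  "fibre x = {m \<in> M. x + m \<in> W}"

lemma finite_fibre: "finite (fibre x)"
  by (simp add: fibre_def finite_M)

lemma card_fibre: "AE x in lborel. x \<in> unit_cube \<longrightarrow> card (fibre x) = k"
  using tiling
proof eventually_elim
  case (elim x)
  have "fibre x = {m \<in> int_vecs. x + m \<in> W}" if "x \<in> unit_cube"
    using that by (auto simp: fibre_def M_def)
  then show ?case using elim by simp
qed

text \<open>Periodization of the integrand cut off to \<open>W\<close>: over a point of the cube the
  sum over all integer vectors reduces to the finite fibre.\<close>

lemma nn_integral_fold:
  assumes [measurable]: "f \<in> borel_measurable borel"
  shows "(\<integral>\<^sup>+x. indicator W x * f x \<partial>lborel)
    = (\<integral>\<^sup>+x. indicator unit_cube x * (\<Sum>m\<in>fibre x. f (x + m)) \<partial>lborel)"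
proof -
  have "(\<integral>\<^sup>+x. indicator W x * f x \<partial>lborel) = (\<integral>\<^sup>+x. indicator unit_cube x *
      (\<integral>\<^sup>+m. indicator W (x + m) * f (x + m) \<partial>count_space int_vecs) \<partial>lborel)"
    by (rule nn_integral_periodize) measurable
  also have "\<dots> = (\<integral>\<^sup>+x. indicator unit_cube x * (\<Sum>m\<in>fibre x. f (x + m)) \<partial>lborel)"
  proof (rule nn_integral_cong)
    fix x :: "real ^ 'n"
    have "(\<integral>\<^sup>+m. indicator W (x + m) * f (x + m) \<partial>count_space int_vecs) = (\<Sum>m\<in>fibre x. f (x + m))"
      if "x \<in> unit_cube"
    proof -
      have "(\<integral>\<^sup>+m. indicator W (x + m) * f (x + m) \<partial>count_space int_vecs)
        = (\<Sum>m\<in>fibre x. indicator W (x + m) * f (x + m))"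
        using that M_int
        by (intro nn_integral_count_space' finite_fibre) (auto simp: fibre_def M_def split: split_indicator)
      also have "\<dots> = (\<Sum>m\<in>fibre x. f (x + m))"
        by (intro sum.cong) (auto simp: fibre_def)
      finally show ?thesis .
    qed
    then show "indicator unit_cube x * (\<integral>\<^sup>+m. indicator W (x + m) * f (x + m) \<partial>count_space int_vecs)
      = indicator unit_cube x * (\<Sum>m\<in>fibre x. f (x + m))"
      by (simp split: split_indicator)
  qed
  finally show ?thesis .
qed

text \<open>Folding the constant 1 counts the fibres. The resulting positivity is what later forces
  \<open>D\<close> to be countable.\<close>

lemma emeasure_multitile: "emeasure lborel W = of_nat k"
proof -
  have "emeasure lborel W = (\<integral>\<^sup>+x. indicator unit_cube x * of_nat (card (fibre x)) \<partial>lborel)"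
    using nn_integral_fold[of "\<lambda>_. 1"] by simp
  also have "\<dots> = (\<integral>\<^sup>+x. of_nat k * indicator unit_cube x \<partial>(lborel :: (real ^ 'n) measure))"
    by (rule nn_integral_cong_AE) (use card_fibre in eventually_elim, simp split: split_indicator)
  also have "\<dots> = of_nat k"
    by (subst nn_integral_cmult_indicator) (simp_all add: emeasure_unit_cube)
  finally show ?thesis .
qed

end

text \<open>\<open>nodes\<close> makes the Vandermonde nodes of every fibre distinct, so that each
  system is uniquely solvable; \<open>shift\<close> makes the representation
  \<open>real j *\<^sub>R b + l\<close> of a frequency unique.\<close>

locale integer_multitile_shift = integer_multitile W k
  for W :: "(real ^ 'n) set" and k :: nat +
  fixes b :: "real ^ 'n"
  assumes nodes: "inj_on (character b) M"
    and shift: "\<And>i j. i < k \<Longrightarrow> j < k \<Longrightarrow> (real i - real j) *\<^sub>R b \<in> int_vecs \<Longrightarrow> i = j"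
begin

text \<open>The inverse matrix is chosen once for each set \<open>S\<close>, not for each point, so
  it is constant where the fibre is. This leaves finitely many matrices to bound and keeps the
  coefficient functions measurable.\<close>

definition dual :: "(real ^ 'n) set \<Rightarrow> real ^ 'n \<Rightarrow> nat \<Rightarrow> complex" where
  "dual S = (SOME u. (\<forall>y j. j < k \<longrightarrow> y j = (\<Sum>m\<in>S. u m j * (\<Sum>i<k. character b m ^ i * y i)))
     \<and> (\<forall>v. \<forall>m\<in>S. (\<Sum>j<k. character b m ^ j * (\<Sum>m'\<in>S. u m' j * v m')) = v m))"

lemma dual:
  assumes S: "S \<subseteq> M" "card S = k"
  shows "j < k \<Longrightarrow> y j = (\<Sum>m\<in>S. dual S m j * (\<Sum>i<k. character b m ^ i * y i))"
    and "m \<in> S \<Longrightarrow> (\<Sum>j<k. character b m ^ j * (\<Sum>m'\<in>S. dual S m' j * v m')) = v m"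
proof -
  have "finite S" "inj_on (character b) S"
    using S finite_M nodes by (auto intro: finite_subset inj_on_subset)
  from someI_ex[OF lagrange_inverse_vandermonde[OF this S(2) k]]
  show "j < k \<Longrightarrow> y j = (\<Sum>m\<in>S. dual S m j * (\<Sum>i<k. character b m ^ i * y i))"
    and "m \<in> S \<Longrightarrow> (\<Sum>j<k. character b m ^ j * (\<Sum>m'\<in>S. dual S m' j * v m')) = v m"
    unfolding dual_def[symmetric] by blast+
qed

definition selections :: "(real ^ 'n) set set" where
  "selections = {S. S \<subseteq> M \<and> card S = k}"

lemma finite_selections: "finite selections"
  unfolding selections_def using finite_M by simp

text \<open>The squared Frobenius norm of the inverse matrix belonging to \<open>S\<close>.\<close>

definition K :: "(real ^ 'n) set \<Rightarrow> real" where
  "K S = (\<Sum>j<k. \<Sum>m\<in>S. (cmod (dual S m j))\<^sup>2)"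

text \<open>Summing over all selections bounds every inverse at once, without a maximum; the added 1
  keeps the denominator positive and gives \<open>C \<le> 1\<close>, hence
  \<open>C \<le> (real k)\<^sup>2\<close>.\<close>

definition C :: real where
  "C = 1 / (1 + sum K selections)"

lemma K_nonneg: "K S \<ge> 0"
  by (auto simp: K_def intro!: sum_nonneg)

lemma C: "C > 0" "C \<le> (real k)\<^sup>2"
proof -
  have s: "sum K selections \<ge> 0" by (intro sum_nonneg K_nonneg)
  then show "C > 0" by (simp add: C_def)
  have "C \<le> 1" using s by (simp add: C_def)
  also have "1 \<le> (real k)\<^sup>2" using k by simp
  finally show "C \<le> (real k)\<^sup>2" .
qed

text \<open>Cauchy-Schwarz twice. From below it is applied to the inverse matrix, whose Frobenius
  norm enters; from above the entries have modulus 1, so each of the \<open>k\<close> rows costs a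
  factor \<open>k\<close>.\<close>

lemma vandermonde_bounds:
  assumes S: "S \<in> selections"
  shows "C * (\<Sum>j<k. (cmod (y j))\<^sup>2) \<le> (\<Sum>m\<in>S. (cmod (\<Sum>j<k. character b m ^ j * y j))\<^sup>2)"
    and "(\<Sum>m\<in>S. (cmod (\<Sum>j<k. character b m ^ j * y j))\<^sup>2) \<le> (real k)\<^sup>2 * (\<Sum>j<k. (cmod (y j))\<^sup>2)"
proof -
  have S': "S \<subseteq> M" "card S = k" using S by (auto simp: selections_def)
  let ?v = "\<lambda>m. \<Sum>j<k. character b m ^ j * y j"
  let ?V = "\<Sum>m\<in>S. (cmod (?v m))\<^sup>2"
  have V: "?V \<ge> 0" by (intro sum_nonneg) auto
  have "(\<Sum>j<k. (cmod (y j))\<^sup>2) \<le> (\<Sum>j<k. (\<Sum>m\<in>S. (cmod (dual S m j))\<^sup>2) * ?V)"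
  proof (intro sum_mono)
    fix j assume "j \<in> {..<k}"
    then have "y j = (\<Sum>m\<in>S. dual S m j * ?v m)" using dual(1)[OF S'] by auto
    then show "(cmod (y j))\<^sup>2 \<le> (\<Sum>m\<in>S. (cmod (dual S m j))\<^sup>2) * ?V"
      using norm_sum_mult_sq_le[of "\<lambda>m. dual S m j" ?v S] by simp
  qed
  also have "\<dots> = K S * ?V" by (simp add: K_def sum_distrib_right)
  also have "\<dots> \<le> (1 + sum K selections) * ?V"
    using V member_le_sum[OF S, of K] K_nonneg finite_selections by (intro mult_right_mono) auto
  finally have le: "(\<Sum>j<k. (cmod (y j))\<^sup>2) \<le> (1 + sum K selections) * ?V" .
  have pos: "1 + sum K selections > 0" by (intro add_pos_nonneg sum_nonneg K_nonneg) auto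
  show "C * (\<Sum>j<k. (cmod (y j))\<^sup>2) \<le> ?V"
    using le pos unfolding C_def by (simp add: field_simps)
  have "?V \<le> (\<Sum>m\<in>S. real k * (\<Sum>j<k. (cmod (y j))\<^sup>2))"
  proof (intro sum_mono)
    fix m
    show "(cmod (?v m))\<^sup>2 \<le> real k * (\<Sum>j<k. (cmod (y j))\<^sup>2)"
      using norm_sum_mult_sq_le[of "\<lambda>j. character b m ^ j" y "{..<k}"] by (simp add: norm_power)
  qed
  also have "\<dots> = (real k)\<^sup>2 * (\<Sum>j<k. (cmod (y j))\<^sup>2)"
    using S'(2) by (simp add: power2_eq_square)
  finally show "?V \<le> (real k)\<^sup>2 * (\<Sum>j<k. (cmod (y j))\<^sup>2)" .
qed

text \<open>The pointwise matrix bounds are integrated over the cube, where almost every fibre is a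
  selection. The link between \<open>g\<close> and \<open>y\<close> is left abstract, since
  \<open>g\<close> is an exponential sum for the Riesz bounds and an approximation error for
  density.\<close>

lemma folded_bounds:
  assumes g [measurable]: "g \<in> borel_measurable borel" and y [measurable]: "\<And>j. y j \<in> borel_measurable borel"
    and gy: "AE x in lborel. x \<in> unit_cube \<longrightarrow> (\<forall>m\<in>fibre x. g (x + m) = (\<Sum>j<k. character b m ^ j * y j x))"
  shows "ennreal C * (\<Sum>j<k. sq_norm (\<lambda>x. indicator unit_cube x * y j x)) \<le> sq_norm (\<lambda>x. indicator W x * g x)"
    and "sq_norm (\<lambda>x. indicator W x * g x) \<le> ennreal ((real k)\<^sup>2) * (\<Sum>j<k. sq_norm (\<lambda>x. indicator unit_cube x * y j x))"
proof -
  have ind: "ennreal ((cmod (indicator A x * z))\<^sup>2) = indicator A x * ennreal ((cmod z)\<^sup>2)"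
    for A :: "(real ^ 'n) set" and x z by (simp split: split_indicator)
  have W: "sq_norm (\<lambda>x. indicator W x * g x)
      = (\<integral>\<^sup>+x. indicator unit_cube x * ennreal (\<Sum>m\<in>fibre x. (cmod (g (x + m)))\<^sup>2) \<partial>lborel)"
    unfolding sq_norm_def ind by (subst nn_integral_fold) simp_all
  have Y: "ennreal c * (\<Sum>j<k. sq_norm (\<lambda>x. indicator unit_cube x * y j x))
      = (\<integral>\<^sup>+x. indicator unit_cube x * ennreal (c * (\<Sum>j<k. (cmod (y j x))\<^sup>2)) \<partial>lborel)" if c: "c \<ge> 0" for c
  proof -
    have "(\<Sum>j<k. sq_norm (\<lambda>x. indicator unit_cube x * y j x))
      = (\<integral>\<^sup>+x. (\<Sum>j<k. indicator unit_cube x * ennreal ((cmod (y j x))\<^sup>2)) \<partial>lborel)"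
      unfolding sq_norm_def ind by (rule nn_integral_sum[symmetric]) measurable
    then have "ennreal c * (\<Sum>j<k. sq_norm (\<lambda>x. indicator unit_cube x * y j x))
      = (\<integral>\<^sup>+x. ennreal c * (\<Sum>j<k. indicator unit_cube x * ennreal ((cmod (y j x))\<^sup>2)) \<partial>lborel)"
      by (simp only:) (rule nn_integral_cmult[symmetric], measurable)
    also have "\<dots> = (\<integral>\<^sup>+x. indicator unit_cube x * ennreal (c * (\<Sum>j<k. (cmod (y j x))\<^sup>2)) \<partial>lborel)"
    proof (intro nn_integral_cong)
      fix x :: "real ^ 'n"
      show "ennreal c * (\<Sum>j<k. indicator unit_cube x * ennreal ((cmod (y j x))\<^sup>2))
          = indicator unit_cube x * ennreal (c * (\<Sum>j<k. (cmod (y j x))\<^sup>2))"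
        using c by (cases "x \<in> unit_cube") (simp_all add: ennreal_mult' sum_nonneg)
    qed
    finally show ?thesis .
  qed
  have sel: "AE x in lborel. x \<in> unit_cube \<longrightarrow> fibre x \<in> selections \<and>
      (\<Sum>m\<in>fibre x. (cmod (g (x + m)))\<^sup>2) = (\<Sum>m\<in>fibre x. (cmod (\<Sum>j<k. character b m ^ j * y j x))\<^sup>2)"
    using card_fibre gy by eventually_elim (auto simp: selections_def fibre_def intro!: sum.cong)
  show "ennreal C * (\<Sum>j<k. sq_norm (\<lambda>x. indicator unit_cube x * y j x)) \<le> sq_norm (\<lambda>x. indicator W x * g x)"
    unfolding W Y[OF less_imp_le[OF C(1)]]
  proof (rule nn_integral_mono_AE)
    show "AE x in lborel. indicator unit_cube x * ennreal (C * (\<Sum>j<k. (cmod (y j x))\<^sup>2))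
        \<le> indicator unit_cube x * ennreal (\<Sum>m\<in>fibre x. (cmod (g (x + m)))\<^sup>2)"
      using sel by eventually_elim (use vandermonde_bounds(1) in \<open>simp add: ennreal_leI split: split_indicator\<close>)
  qed
  show "sq_norm (\<lambda>x. indicator W x * g x) \<le> ennreal ((real k)\<^sup>2) * (\<Sum>j<k. sq_norm (\<lambda>x. indicator unit_cube x * y j x))"
    unfolding W Y[OF zero_le_power2]
  proof (rule nn_integral_mono_AE)
    show "AE x in lborel. indicator unit_cube x * ennreal (\<Sum>m\<in>fibre x. (cmod (g (x + m)))\<^sup>2)
       \<le> indicator unit_cube x * ennreal ((real k)\<^sup>2 * (\<Sum>j<k. (cmod (y j x))\<^sup>2))"
      using sel by eventually_elim (use vandermonde_bounds(2) in \<open>simp add: ennreal_leI split: split_indicator\<close>)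
  qed
qed

section \<open>Frequencies: a union of shifted integer lattices\<close>

definition freqs :: "(real ^ 'n) set" where
  "freqs = (\<lambda>(j, l). real j *\<^sub>R b + l) ` ({..<k} \<times> int_vecs)"

lemma inj_freqs: "inj_on (\<lambda>(j, l). real j *\<^sub>R b + l) ({..<k} \<times> int_vecs)"
proof (rule inj_onI, clarify)
  fix i j :: nat and l l' :: "real ^ 'n"
  assume *: "i < k" "j < k" "l \<in> int_vecs" "l' \<in> int_vecs" "real i *\<^sub>R b + l = real j *\<^sub>R b + l'"
  then have "(real i - real j) *\<^sub>R b = l' - l" by (simp add: algebra_simps)
  then have "i = j" using * shift int_vecs_closed(4)[of l' l] by simp
  then show "i = j \<and> l = l'" using * by simp
qed

text \<open>A finite set of frequencies need not be a product, so one set \<open>G\<close> of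
  integer parts is used for all \<open>j\<close> and the missing pairs are filled with zeros. The
  quantifier over \<open>f\<close> stands inside because the same \<open>G\<close> must serve the
  exponential sum and the squares of its coefficients.\<close>

lemma sum_freqs:
  assumes F: "finite F" "F \<subseteq> freqs"
  obtains G where "finite G" "G \<subseteq> int_vecs"
    "\<forall>f :: real ^ 'n \<Rightarrow> complex.
       (\<Sum>l\<in>F. f l) = (\<Sum>j<k. \<Sum>l\<in>G. if real j *\<^sub>R b + l \<in> F then f (real j *\<^sub>R b + l) else 0)"
proof -
  let ?\<phi> = "\<lambda>(j, l). real j *\<^sub>R b + l"
  define A where "A = {p \<in> {..<k} \<times> int_vecs. ?\<phi> p \<in> F}"
  have inj: "inj_on ?\<phi> A" using inj_freqs by (rule inj_on_subset) (auto simp: A_def)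
  have img: "?\<phi> ` A = F" using F(2) unfolding freqs_def A_def by auto
  have finA: "finite A" using F(1) inj by (metis finite_imageD img)
  show ?thesis
  proof (rule that[of "snd ` A"])
    show "finite (snd ` A)" using finA by simp
    show "snd ` A \<subseteq> int_vecs" by (auto simp: A_def)
    have "(\<Sum>l\<in>F. f l) = (\<Sum>j<k. \<Sum>l\<in>snd ` A. if real j *\<^sub>R b + l \<in> F then f (real j *\<^sub>R b + l) else 0)"
      for f :: "real ^ 'n \<Rightarrow> complex"
    proof -
      have "(\<Sum>l\<in>F. f l) = (\<Sum>p\<in>A. f (?\<phi> p))"
        using sum.reindex[OF inj, of f] img by simp
      also have "\<dots> = (\<Sum>p\<in>{..<k} \<times> snd ` A. if ?\<phi> p \<in> F then f (?\<phi> p) else 0)"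
        using finA by (intro sum.mono_neutral_cong_left) (auto simp: A_def image_iff)
      also have "\<dots> = (\<Sum>j<k. \<Sum>l\<in>snd ` A. if real j *\<^sub>R b + l \<in> F then f (real j *\<^sub>R b + l) else 0)"
        by (subst sum.cartesian_product) (rule sum.cong, auto)
      finally show ?thesis .
    qed
    then show "\<forall>f :: real ^ 'n \<Rightarrow> complex. (\<Sum>l\<in>F. f l)
       = (\<Sum>j<k. \<Sum>l\<in>snd ` A. if real j *\<^sub>R b + l \<in> F then f (real j *\<^sub>R b + l) else 0)" by blast
  qed
qed

text \<open>Characters with integer frequencies are periodic, so moving by \<open>m\<close> only
  contributes the \<open>j\<close>-th power of the node \<open>character b m\<close>: an entry of
  the Vandermonde matrix.\<close>

lemma character_freq:
  "m \<in> int_vecs \<Longrightarrow> l \<in> int_vecs \<Longrightarrow>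
     character (real j *\<^sub>R b + l) (x + m) = character b m ^ j * (character (real j *\<^sub>R b) x * character l x)"
  by (simp add: character_simps character_scale_nat character_int power_mult_distrib mult_ac)

lemma sq_norm_cube_trig_poly:
  assumes "finite G" "G \<subseteq> int_vecs"
  shows "sq_norm (\<lambda>x. indicator unit_cube x * (character a x * exp_sum G d x))
    = ennreal (\<Sum>l\<in>G. (cmod (d l))\<^sup>2)"
proof -
  have "sq_norm (\<lambda>x. indicator unit_cube x * (character a x * exp_sum G d x))
     = sq_norm (\<lambda>x. \<Sum>l\<in>G. d l * (indicator unit_cube x * character l x))"
    unfolding sq_norm_def norm_mult norm_character mult_1_left
    unfolding norm_mult[symmetric] sum_distrib_left by (simp add: mult_ac)
  also have "\<dots> = ennreal ((L2_norm (\<lambda>x. \<Sum>l\<in>G. d l * (indicator unit_cube x * character l x)))\<^sup>2)"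
    by (intro sq_norm_L2 L2_sum L2_cmult cube_character_L2)
  finally show ?thesis by (simp add: cube_trig_poly_norm[OF assms])
qed

lemma riesz_bounds:
  assumes F: "finite F" "F \<subseteq> freqs"
  shows "ennreal (C * (\<Sum>l\<in>F. (cmod (c l))\<^sup>2)) \<le> sq_norm (\<lambda>x. indicator W x * exp_sum F c x)"
    and "sq_norm (\<lambda>x. indicator W x * exp_sum F c x) \<le> ennreal ((real k)\<^sup>2 * (\<Sum>l\<in>F. (cmod (c l))\<^sup>2))"
proof -
  obtain G where G: "finite G" "G \<subseteq> int_vecs"
    and sum_G': "\<forall>f :: real ^ 'n \<Rightarrow> complex. (\<Sum>l\<in>F. f l) = (\<Sum>j<k. \<Sum>l\<in>G. if real j *\<^sub>R b + l \<in> F then f (real j *\<^sub>R b + l) else 0)"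
    by (rule sum_freqs[OF F])
  note sum_G = sum_G'[rule_format]
  define d where "d j l = (if real j *\<^sub>R b + l \<in> F then c (real j *\<^sub>R b + l) else 0)" for j l
  \<comment> \<open>The modulation has modulus 1, so by orthogonality on the cube the squared norm
    of \<open>y j\<close> is the sum of the squared moduli of the \<open>d j l\<close>.\<close>
  define y where "y j x = character (real j *\<^sub>R b) x * (\<Sum>l\<in>G. d j l * character l x)" for j x
  have [measurable]: "y j \<in> borel_measurable borel" for j
    unfolding y_def by measurable
  \<comment> \<open>\<open>sum_freqs\<close> speaks of complex summands; the real squares are passed
    through \<open>of_real\<close>.\<close>
  have "complex_of_real (\<Sum>l\<in>F. (cmod (c l))\<^sup>2) = of_real (\<Sum>j<k. \<Sum>l\<in>G. (cmod (d j l))\<^sup>2)"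
    unfolding of_real_sum sum_G d_def by (intro sum.cong) auto
  then have norm_eq: "(\<Sum>l\<in>F. (cmod (c l))\<^sup>2) = (\<Sum>j<k. \<Sum>l\<in>G. (cmod (d j l))\<^sup>2)"
    unfolding of_real_eq_iff .
  have Y: "(\<Sum>j<k. sq_norm (\<lambda>x. indicator unit_cube x * y j x)) = ennreal (\<Sum>l\<in>F. (cmod (c l))\<^sup>2)"
    unfolding y_def sq_norm_cube_trig_poly[OF G] norm_eq by (simp add: sum_nonneg)
  have g: "exp_sum F c (x + m) = (\<Sum>j<k. character b m ^ j * y j x)" if "m \<in> int_vecs" for x m
  proof -
    have "exp_sum F c (x + m)
       = (\<Sum>j<k. \<Sum>l\<in>G. d j l * character (real j *\<^sub>R b + l) (x + m))"
      unfolding sum_G d_def by (intro sum.cong) auto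
    also have "\<dots> = (\<Sum>j<k. \<Sum>l\<in>G. d j l * (character b m ^ j * (character (real j *\<^sub>R b) x * character l x)))"
      using G(2) that by (intro sum.cong refl arg_cong2[where f = "(*)"] character_freq) auto
    also have "\<dots> = (\<Sum>j<k. character b m ^ j * y j x)"
      unfolding y_def sum_distrib_left by (simp add: mult_ac)
    finally show ?thesis .
  qed
  have AE: "AE x in lborel. x \<in> unit_cube \<longrightarrow>
      (\<forall>m\<in>fibre x. exp_sum F c (x + m) = (\<Sum>j<k. character b m ^ j * y j x))"
    using g M_int by (auto simp: fibre_def)
  have [measurable]: "(\<lambda>x. exp_sum F c x) \<in> borel_measurable borel" by measurable
  show "ennreal (C * (\<Sum>l\<in>F. (cmod (c l))\<^sup>2)) \<le> sq_norm (\<lambda>x. indicator W x * exp_sum F c x)"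
    using folded_bounds(1)[of "\<lambda>x. exp_sum F c x" y, OF _ _ AE] C
    by (simp add: Y ennreal_mult' )
  show "sq_norm (\<lambda>x. indicator W x * exp_sum F c x) \<le> ennreal ((real k)\<^sup>2 * (\<Sum>l\<in>F. (cmod (c l))\<^sup>2))"
    using folded_bounds(2)[of "\<lambda>x. exp_sum F c x" y, OF _ _ AE]
    by (simp add: Y ennreal_mult')
qed

end

section \<open>Approximation by exponentials on a multi-tile\<close>

lemma L2_translate:
  assumes "f \<in> L2" shows "(\<lambda>x. f (x + m)) \<in> L2"
proof -
  have [measurable]: "f \<in> borel_measurable borel" using assms by (rule L2_measurable)
  have "sq_norm (\<lambda>x. f (x + m)) = sq_norm f"
    unfolding sq_norm_def
    using nn_integral_lborel_translation[of "\<lambda>x. ennreal ((cmod (f x))\<^sup>2)" m] by simp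
  then show ?thesis using assms by (simp add: L2_iff)
qed

context integer_multitile_shift
begin

text \<open>For a selection \<open>S\<close>, the part of the cube with fibre \<open>S\<close>,
  written through finitely many membership conditions so that it is visibly measurable.\<close>

definition region :: "(real ^ 'n) set \<Rightarrow> (real ^ 'n) set" where
  "region S = {x. x \<in> unit_cube \<and> (\<forall>m\<in>M. (x + m \<in> W) = (m \<in> S))}"

lemma region_measurable [measurable]: "region S \<in> sets borel"
proof -
  have "Measurable.pred borel (\<lambda>x. \<forall>m\<in>M. (x + m \<in> W) = (m \<in> S))"
    by (rule pred_intros_finite(3)[OF finite_M]) measurable
  then have [measurable]: "{x. \<forall>m\<in>M. (x + m \<in> W) = (m \<in> S)} \<in> sets borel"
    by (simp add: pred_def)
  have "region S = unit_cube \<inter> {x. \<forall>m\<in>M. (x + m \<in> W) = (m \<in> S)}"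
    by (auto simp: region_def)
  then show ?thesis by simp
qed

lemma region_iff: "S \<in> selections \<Longrightarrow> x \<in> region S \<longleftrightarrow> x \<in> unit_cube \<and> fibre x = S"
  by (auto simp: region_def fibre_def selections_def)

text \<open>Solution of the Vandermonde system with right-hand sides \<open>h (x + m)\<close>, with
  the modulation removed; the outer sum picks the matrix of the region that contains
  \<open>x\<close>.\<close>

definition coeff_fun :: "(real ^ 'n \<Rightarrow> complex) \<Rightarrow> nat \<Rightarrow> real ^ 'n \<Rightarrow> complex" where
  "coeff_fun h j x = (\<Sum>S\<in>selections. \<Sum>m\<in>S. dual S m j *
     (indicator (region S) x * (h (x + m) * character (- (real j *\<^sub>R b)) x)))"

lemma coeff_fun_L2: "h \<in> L2 \<Longrightarrow> coeff_fun h j \<in> L2"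
  unfolding coeff_fun_def
  by (intro L2_sum L2_cmult L2_indicator_mult L2_mult_bounded L2_translate) auto

lemma coeff_fun_zero: "x \<notin> unit_cube \<Longrightarrow> coeff_fun h j x = 0"
  by (auto simp: coeff_fun_def region_def intro!: sum.neutral)

lemma coeff_fun_eq:
  assumes x: "x \<in> unit_cube" "fibre x \<in> selections"
  shows "character (real j *\<^sub>R b) x * coeff_fun h j x = (\<Sum>m\<in>fibre x. dual (fibre x) m j * h (x + m))"
proof -
  have zero: "indicator (region S) x = (0 :: complex)" if "S \<in> selections - {fibre x}" for S
    using that region_iff[of S x] by (auto simp: indicator_def)
  have "coeff_fun h j x = (\<Sum>S\<in>{fibre x}. \<Sum>m\<in>S. dual S m j *
     (indicator (region S) x * (h (x + m) * character (- (real j *\<^sub>R b)) x)))"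
    unfolding coeff_fun_def
    by (rule sum.mono_neutral_right) (use x finite_selections zero in simp_all)
  also have "\<dots> = (\<Sum>m\<in>fibre x. dual (fibre x) m j * (h (x + m) * character (- (real j *\<^sub>R b)) x))"
    using x region_iff[OF x(2), of x] by simp
  finally have "character (real j *\<^sub>R b) x * coeff_fun h j x
     = (\<Sum>m\<in>fibre x. dual (fibre x) m j * h (x + m) *
         (character (real j *\<^sub>R b) x * character (- (real j *\<^sub>R b)) x))"
    by (simp add: sum_distrib_left mult_ac)
  then show ?thesis by (simp add: character_simps)
qed

text \<open>If the coefficient functions were trigonometric polynomials themselves, the exponential
  sum would equal \<open>h\<close> almost everywhere on \<open>W\<close>. They are approximated by
  such, and \<open>folded_bounds\<close> turns the errors on the cube into an error on
  \<open>W\<close>.\<close>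

lemma dense:
  assumes h: "h \<in> L2" and e: "e > 0"
  shows "\<exists>F c. finite F \<and> F \<subseteq> freqs \<and>
    sq_norm (\<lambda>x. indicator W x * (h x - exp_sum F c x)) < ennreal e"
proof -
  have [measurable]: "h \<in> borel_measurable borel" using h by (rule L2_measurable)
  \<comment> \<open>The upper bound costs \<open>k ^ 2\<close> and there are \<open>k\<close>
    coefficient functions, so the total is at most \<open>k ^ 3 * \<delta> = e / 2\<close>.\<close>
  define \<delta> where "\<delta> = e / (2 * real k ^ 3)"
  have \<delta>: "\<delta> > 0" "(real k)\<^sup>2 * (real k * \<delta>) = e / 2"
    using k e by (auto simp: \<delta>_def power2_eq_square power3_eq_cube)
  let ?Q = "\<lambda>j q. finite (fst q) \<and> fst q \<subseteq> int_vecs \<and>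
      sq_norm (\<lambda>x. coeff_fun h j x - indicator unit_cube x * exp_sum (fst q) (snd q) x) < ennreal \<delta>"
  have "\<exists>q. ?Q j q" for j
  proof -
    obtain p where "trig_poly p" "sq_norm (\<lambda>x. coeff_fun h j x - indicator unit_cube x * p x) < ennreal \<delta>"
      by (rule trig_poly_dense[OF coeff_fun_L2[OF h] coeff_fun_zero \<delta>(1)])
    then obtain G d where "finite G" "G \<subseteq> int_vecs"
      "sq_norm (\<lambda>x. coeff_fun h j x - indicator unit_cube x * exp_sum G d x) < ennreal \<delta>"
      unfolding trig_poly_def by blast
    then show ?thesis by (intro exI[of _ "(G, d)"]) simp
  qed
  then obtain q where q: "?Q j (q j)" for j
    using choice[of ?Q] by blast
  define G where "G j = fst (q j)" for j
  define d where "d j = snd (q j)" for j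
  have G: "finite (G j)" "G j \<subseteq> int_vecs"
    and Gd: "sq_norm (\<lambda>x. coeff_fun h j x - indicator unit_cube x * (\<Sum>l\<in>G j. d j l * character l x)) < ennreal \<delta>" for j
    using q unfolding G_def d_def by blast+
  define P where "P j x = (\<Sum>l\<in>G j. d j l * character l x)" for j x
  have [measurable]: "P j \<in> borel_measurable borel" for j
    unfolding P_def by measurable
  note [measurable] = L2_measurable[OF coeff_fun_L2[OF h]]
  let ?\<phi> = "\<lambda>(j, l). real j *\<^sub>R b + l"
  let ?A = "Sigma {..<k} G"
  define F where "F = ?\<phi> ` ?A"
  \<comment> \<open>By uniqueness of the representation the pair, and with it the coefficient, can
    be read off the frequency.\<close>
  define c where "c l = (case inv_into ?A ?\<phi> l of (j, l') \<Rightarrow> d j l')" for l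
  have inj: "inj_on ?\<phi> ?A"
    using inj_freqs by (rule inj_on_subset) (use G in auto)
  have F: "finite F" "F \<subseteq> freqs"
    using G unfolding F_def freqs_def by (simp, intro image_mono) auto
  have c_eq: "c (?\<phi> p) = d (fst p) (snd p)" if "p \<in> ?A" for p
    unfolding c_def inv_into_f_f[OF inj that] by (simp add: case_prod_unfold)
  have gx: "exp_sum F c x = (\<Sum>j<k. \<Sum>l\<in>G j. d j l * character (real j *\<^sub>R b + l) x)" for x
  proof -
    have "exp_sum F c x = (\<Sum>p\<in>?A. c (?\<phi> p) * character (?\<phi> p) x)"
      unfolding F_def by (subst sum.reindex[OF inj]) simp
    also have "\<dots> = (\<Sum>(j, l)\<in>?A. d j l * character (real j *\<^sub>R b + l) x)"
      by (rule sum.cong, rule refl, subst c_eq) (simp_all add: case_prod_unfold)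
    also have "\<dots> = (\<Sum>j<k. \<Sum>l\<in>G j. d j l * character (real j *\<^sub>R b + l) x)"
      by (rule sum.Sigma[symmetric]) (use G in auto)
    finally show ?thesis .
  qed
  define y where "y j x = character (real j *\<^sub>R b) x * (coeff_fun h j x - P j x)" for j x
  have [measurable]: "y j \<in> borel_measurable borel" for j
    unfolding y_def by measurable
  have gm: "exp_sum F c (x + m) = (\<Sum>j<k. character b m ^ j * (character (real j *\<^sub>R b) x * P j x))"
    if "m \<in> int_vecs" for x m
    unfolding gx P_def sum_distrib_left
    using that G(2) by (intro sum.cong refl) (simp add: character_freq subset_iff mult_ac)
  have AE: "AE x in lborel. x \<in> unit_cube \<longrightarrow> (\<forall>m\<in>fibre x. h (x + m) - exp_sum F c (x + m)
      = (\<Sum>j<k. character b m ^ j * y j x))"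
    using card_fibre
  proof eventually_elim
    case (elim x)
    show ?case
    proof (intro impI ballI)
      fix m assume x: "x \<in> unit_cube" and m: "m \<in> fibre x"
      have sel: "fibre x \<in> selections" using elim x by (auto simp: selections_def fibre_def)
      then have S: "fibre x \<subseteq> M" "card (fibre x) = k" by (auto simp: selections_def)
      have "h (x + m) = (\<Sum>j<k. character b m ^ j * (character (real j *\<^sub>R b) x * coeff_fun h j x))"
        unfolding coeff_fun_eq[OF x sel] using dual(2)[OF S m, of "\<lambda>m. h (x + m)"] by simp
      moreover have "m \<in> int_vecs" using m M_int by (auto simp: fibre_def)
      ultimately show "h (x + m) - exp_sum F c (x + m) = (\<Sum>j<k. character b m ^ j * y j x)"
        by (simp add: gm y_def right_diff_distrib sum_subtractf)
    qed
  qed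
  have "sq_norm (\<lambda>x. indicator unit_cube x * y j x) \<le> ennreal \<delta>" for j
  proof -
    have "indicator unit_cube x * y j x = character (real j *\<^sub>R b) x * (coeff_fun h j x - indicator unit_cube x * P j x)" for x
      using coeff_fun_zero[of x h j] by (cases "x \<in> unit_cube") (simp_all add: y_def)
    then have "sq_norm (\<lambda>x. indicator unit_cube x * y j x) = sq_norm (\<lambda>x. coeff_fun h j x - indicator unit_cube x * P j x)"
      by (simp add: sq_norm_def norm_mult)
    then show ?thesis using Gd[of j] unfolding P_def by simp
  qed
  then have "(\<Sum>j<k. sq_norm (\<lambda>x. indicator unit_cube x * y j x)) \<le> (\<Sum>j<k. ennreal \<delta>)"
    by (intro sum_mono)
  also have "\<dots> = ennreal (real k * \<delta>)"
    using \<delta> by (simp add: ennreal_mult' flip: ennreal_of_nat_eq_real_of_nat)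
  finally have sum_le: "(\<Sum>j<k. sq_norm (\<lambda>x. indicator unit_cube x * y j x)) \<le> ennreal (real k * \<delta>)" .
  have "sq_norm (\<lambda>x. indicator W x * (h x - exp_sum F c x))
      \<le> ennreal ((real k)\<^sup>2) * (\<Sum>j<k. sq_norm (\<lambda>x. indicator unit_cube x * y j x))"
    by (rule folded_bounds(2)[OF _ _ AE]) measurable
  also have "\<dots> \<le> ennreal ((real k)\<^sup>2) * ennreal (real k * \<delta>)"
    using sum_le by (rule mult_left_mono) simp
  also have "\<dots> = ennreal (e / 2)"
    unfolding \<delta>(2)[symmetric] by (rule ennreal_mult'[symmetric]) simp
  also have "\<dots> < ennreal e" using e by (simp add: ennreal_less_iff)
  finally show ?thesis using F by blast
qed

theorem exponential_riesz_basis_freqs: "exponential_riesz_basis freqs W"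
proof -
  have "exponential_riesz_bounds C ((real k)\<^sup>2) freqs W"
    unfolding exponential_riesz_bounds_def using C riesz_bounds by simp
  moreover have "exponentials_dense freqs W"
    unfolding exponentials_dense_def using dense by simp
  ultimately show ?thesis unfolding exponential_riesz_basis_def by blast
qed

end

text \<open>The differences of elements of \<open>M\<close> separate the nodes. The coordinate
  vector, along an arbitrary coordinate \<open>undefined\<close>, handles the multiples of
  \<open>b\<close>: for \<open>i \<noteq> j\<close> this coordinate of
  \<open>(real i - real j) *\<^sub>R b\<close> is nonzero and below \<open>k * (1 / k) = 1\<close>
  in modulus, so it is no integer.\<close>

theorem (in integer_multitile) exponential_riesz_basis_exists: "\<exists>\<Lambda>. exponential_riesz_basis \<Lambda> W"
proof -
  let ?i = "undefined :: 'n"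
  let ?V = "insert (axis ?i 1) ((\<lambda>(m, m'). m - m') ` (M \<times> M) - {0})"
  have V: "finite ?V" "0 \<notin> ?V" using finite_M by auto
  obtain b where b: "\<And>v. v \<in> ?V \<Longrightarrow> b \<bullet> v \<noteq> 0" "\<And>v. v \<in> ?V \<Longrightarrow> \<bar>b \<bullet> v\<bar> < 1 / real k"
    using exists_small_nonorthogonal[OF V, of "1 / real k"] k by auto
  have int0: "t = 0" if "t \<in> \<int>" "\<bar>t\<bar> < 1" for t :: real
    using that by (auto elim!: Ints_cases)
  have "inj_on (character b) M"
  proof (rule inj_onI, rule ccontr)
    fix m m' assume m: "m \<in> M" "m' \<in> M" "character b m = character b m'" "m \<noteq> m'"
    then have "b \<bullet> m - b \<bullet> m' \<in> \<int>"
      unfolding character_def by (intro cis_2pi_eqD)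
    then have z: "b \<bullet> (m - m') \<in> \<int>" by (simp add: inner_diff_right)
    have v: "m - m' \<in> ?V" using m by (auto intro!: rev_image_eqI[of "(m, m')"])
    have "\<bar>b \<bullet> (m - m')\<bar> < 1 / real k" by (rule b(2)[OF v])
    also have "\<dots> \<le> 1" using k by simp
    finally show False using int0[OF z] b(1)[OF v] by simp
  qed
  moreover have "i = j" if ij: "i < k" "j < k" "(real i - real j) *\<^sub>R b \<in> int_vecs" for i j
  proof -
    have b0: "b $ ?i \<noteq> 0" "\<bar>b $ ?i\<bar> < 1 / real k"
      using b[of "axis ?i 1"] by (simp_all add: inner_axis)
    have "((real i - real j) *\<^sub>R b) $ ?i \<in> \<int>" using ij(3) unfolding int_vecs_def by blast
    then have z: "(real i - real j) * (b $ ?i) \<in> \<int>" by simp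
    have "\<bar>real i - real j\<bar> \<le> real k" using ij(1,2) by linarith
    then have "\<bar>(real i - real j) * (b $ ?i)\<bar> \<le> real k * \<bar>b $ ?i\<bar>"
      by (simp add: abs_mult mult_right_mono)
    also have "\<dots> < 1" using b0 k by (simp add: field_simps)
    finally have "(real i - real j) * (b $ ?i) = 0" using int0[OF z] by blast
    then show "i = j" using b0 by simp
  qed
  ultimately interpret integer_multitile_shift W k b
    by unfold_locales
  show ?thesis using exponential_riesz_basis_freqs by blast
qed

section \<open>Transfer from the integer lattice to a general lattice\<close>

lemma inner_transpose_inv:
  fixes L :: "real ^ 'n ^ 'n"
  assumes "invertible L"
  shows "(transpose (matrix_inv L) *v l) \<bullet> (L *v y) = l \<bullet> y"
  using invertible_mul_matrix_inv[OF assms] by (simp add: dot_lmul_matrix)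

lemma sq_norm_linear:
  fixes L :: "real ^ 'n ^ 'n"
  assumes L: "invertible L" and [measurable]: "f \<in> borel_measurable borel"
  shows "sq_norm f = ennreal \<bar>det L\<bar> * sq_norm (\<lambda>x. f (L *v x))"
  unfolding sq_norm_def by (rule nn_integral_lborel_linear[OF L]) measurable

lemma L2_linear:
  fixes L :: "real ^ 'n ^ 'n"
  assumes L: "invertible L" and f: "f \<in> L2"
  shows "(\<lambda>x. f (L *v x)) \<in> L2"
proof -
  have [measurable]: "f \<in> borel_measurable borel" using f by (rule L2_measurable)
  have "ennreal \<bar>det L\<bar> * sq_norm (\<lambda>x. f (L *v x)) < \<infinity>"
    using sq_norm_linear[OF L, of f] f by (simp add: L2_iff)
  then have "sq_norm (\<lambda>x. f (L *v x)) < \<infinity>"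
    using L by (auto simp: ennreal_mult_less_top invertible_det_nz)
  then show ?thesis by (simp add: L2_iff)
qed

text \<open>The inverse transpose cancels \<open>L\<close> in the pairing of frequencies and points,
  so exponentials correspond to exponentials, and the substitution multiplies all squared norms by
  the same factor \<open>\<bar>det L\<bar>\<close>.\<close>

lemma exponential_riesz_basis_linear:
  fixes L :: "real ^ 'n ^ 'n"
  assumes L: "invertible L" and W [measurable]: "W \<in> sets borel"
    and R: "exponential_riesz_basis \<Lambda> ((*v) L -` W)"
  shows "exponential_riesz_basis ((*v) (transpose (matrix_inv L)) ` \<Lambda>) W"
proof -
  let ?T = "(*v) (transpose (matrix_inv L))"
  let ?\<Delta> = "\<bar>det L\<bar>"
  have \<Delta>: "?\<Delta> > 0" using L by (simp add: invertible_det_nz)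
  have char: "character (?T l) (L *v y) = character l y" for l y
    unfolding character_def inner_transpose_inv[OF L] ..
  have inj: "inj ?T"
  proof (rule injI)
    fix l l' assume eq: "?T l = ?T l'"
    have "(l - l') \<bullet> y = 0" for y
      using inner_transpose_inv[OF L, of l y] inner_transpose_inv[OF L, of l' y] eq
      by (simp add: inner_diff_left)
    from this[of "l - l'"] show "l = l'" by simp
  qed
  have sum_T: "(\<Sum>l\<in>?T ` F. f l) = (\<Sum>l\<in>F. f (?T l))" for F and f :: "real ^ 'n \<Rightarrow> 'b :: comm_monoid_add"
    using inj by (subst sum.reindex) (auto intro: inj_on_subset)
  have norm_T: "sq_norm (\<lambda>x. indicator W x * (h x - exp_sum (?T ` F) c x))
      = ennreal ?\<Delta> * sq_norm (\<lambda>y. indicator ((*v) L -` W) y * (h (L *v y) - (\<Sum>l\<in>F. c (?T l) * character l y)))"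
    if h: "h \<in> borel_measurable borel" for h F c
  proof -
    note [measurable] = h
    have ind: "indicator ((*v) L -` W) y = (indicator W (L *v y) :: complex)" for y
      by (simp add: indicator_def)
    have "sq_norm (\<lambda>x. indicator W x * (h x - (\<Sum>l\<in>F. c (?T l) * character (?T l) x)))
        = ennreal ?\<Delta> * sq_norm (\<lambda>y. indicator W (L *v y) *
            (h (L *v y) - (\<Sum>l\<in>F. c (?T l) * character (?T l) (L *v y))))"
      by (rule sq_norm_linear[OF L]) measurable
    then show ?thesis
      unfolding sum_T char ind .
  qed
  obtain C1 C2 where B: "exponential_riesz_bounds C1 C2 \<Lambda> ((*v) L -` W)"
    using R unfolding exponential_riesz_basis_def by blast
  note C = exponential_riesz_boundsD(1,2)[OF B] and bounds = exponential_riesz_boundsD(3,4)[OF B]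
  have neg: "sq_norm (\<lambda>x. indicator A x * (0 - g x)) = sq_norm (\<lambda>x. indicator A x * g x)" for A :: "(real ^ 'n) set" and g
    by (simp add: sq_norm_def norm_mult)
  have "exponential_riesz_bounds (?\<Delta> * C1) (?\<Delta> * C2) (?T ` \<Lambda>) W"
    unfolding exponential_riesz_bounds_def
  proof (intro conjI allI impI)
    show "0 < ?\<Delta> * C1" "?\<Delta> * C1 \<le> ?\<Delta> * C2" using \<Delta> C by auto
    fix F c assume "finite F" "F \<subseteq> ?T ` \<Lambda>"
    then obtain F' where F': "finite F'" "F' \<subseteq> \<Lambda>" "F = ?T ` F'"
      by (meson finite_subset_image)
    have norm_F: "sq_norm (\<lambda>x. indicator W x * exp_sum F c x)
        = ennreal ?\<Delta> * sq_norm (\<lambda>y. indicator ((*v) L -` W) y * (\<Sum>l\<in>F'. c (?T l) * character l y))"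
    proof -
      have "sq_norm (\<lambda>x. indicator W x * (0 - exp_sum (?T ` F') c x))
        = ennreal ?\<Delta> * sq_norm (\<lambda>y. indicator ((*v) L -` W) y * (0 - (\<Sum>l\<in>F'. c (?T l) * character l y)))"
        by (rule norm_T) simp
      then show ?thesis unfolding neg F'(3) .
    qed
    have mult: "ennreal (?\<Delta> * a * s) = ennreal ?\<Delta> * ennreal (a * s)" for a s
      by (simp add: ennreal_mult' mult.assoc)
    have F_sum: "(\<Sum>l\<in>F. (cmod (c l))\<^sup>2) = (\<Sum>l\<in>F'. (cmod (c (?T l)))\<^sup>2)"
      unfolding F'(3) by (rule sum_T)
    show "ennreal (?\<Delta> * C1 * (\<Sum>l\<in>F. (cmod (c l))\<^sup>2)) \<le> sq_norm (\<lambda>x. indicator W x * exp_sum F c x)"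
      "sq_norm (\<lambda>x. indicator W x * exp_sum F c x) \<le> ennreal (?\<Delta> * C2 * (\<Sum>l\<in>F. (cmod (c l))\<^sup>2))"
      unfolding norm_F mult F_sum
      using bounds[OF F'(1,2), where c = "\<lambda>l. c (?T l)"] by (auto intro!: mult_left_mono)
  qed
  moreover have "exponentials_dense (?T ` \<Lambda>) W"
    unfolding exponentials_dense_def
  proof (intro ballI allI impI)
    fix h :: "real ^ 'n \<Rightarrow> complex" and e :: real assume h: "h \<in> L2" and e: "e > 0"
    have [measurable]: "h \<in> borel_measurable borel" using h by (rule L2_measurable)
    have "e / ?\<Delta> > 0" using e \<Delta> by simp
    with R L2_linear[OF L h] obtain F c where F: "finite F" "F \<subseteq> \<Lambda>"
      "sq_norm (\<lambda>x. indicator ((*v) L -` W) x * (h (L *v x) - exp_sum F c x)) < ennreal (e / ?\<Delta>)"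
      unfolding exponential_riesz_basis_def by (elim conjE exponentials_denseD)
    have "sq_norm (\<lambda>x. indicator W x * (h x - (\<Sum>l\<in>?T ` F. c (inv ?T l) * character l x)))
      = ennreal ?\<Delta> * sq_norm (\<lambda>x. indicator ((*v) L -` W) x * (h (L *v x) - exp_sum F c x))"
      unfolding norm_T[OF \<open>h \<in> borel_measurable borel\<close>] inv_f_f[OF inj] ..
    also have "\<dots> < ennreal ?\<Delta> * ennreal (e / ?\<Delta>)"
      using F(3) \<Delta> by (intro ennreal_mult_strict_left_mono) auto
    also have "\<dots> = ennreal e" using \<Delta> e by (simp flip: ennreal_mult')
    finally show "\<exists>F c. finite F \<and> F \<subseteq> ?T ` \<Lambda> \<and>
        sq_norm (\<lambda>x. indicator W x * (h x - exp_sum F c x)) < ennreal e"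
      using F(1,2) by (intro exI[of _ "?T ` F"] exI[of _ "\<lambda>l. c (inv ?T l)"]) auto
  qed
  ultimately show ?thesis unfolding exponential_riesz_basis_def by blast
qed

text \<open>A convergent sum of indicators has to become a cardinality. Finiteness must be shown
  first, because \<open>card\<close> of an infinite set is 0; it follows from boundedness of
  \<open>W\<close>.\<close>

lemma lattice_multitile_pullback:
  fixes W :: "(real ^ 'n) set"
  assumes \<Gamma>: "full_rank_lattice \<Gamma>" and k: "k \<ge> 1"
    and W [measurable]: "W \<in> sets borel" and bnd: "bounded W"
    and tiling: "translationally_tiling k \<Gamma> W"
  obtains L :: "real ^ 'n ^ 'n" where "invertible L" "integer_multitile ((*v) L -` W) k"
proof -
  obtain L :: "real ^ 'n ^ 'n" where L: "invertible L" "\<Gamma> = (*v) L ` int_vecs"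
    using \<Gamma> unfolding full_rank_lattice_def int_vecs_def by blast
  let ?W = "(*v) L -` W"
  have W': "?W \<in> sets borel"
    using measurable_sets[OF measurable_matrix_vector_mul[of L], of W] by simp
  have "?W = (*v) (matrix_inv L) ` W"
    using invertible_mul_matrix_inv[OF L(1)] by (auto simp: image_iff) metis
  then have bnd': "bounded ?W"
    using bnd by (simp add: bounded_linear_image matrix_vector_mul_bounded_linear)
  have injL: "inj ((*v) L)" using invertible_mul_matrix_inv(2)[OF L(1)] by (metis injI)
  have "AE y in lborel. card {m \<in> int_vecs. y + m \<in> ?W} = k"
    using AE_lborel_linear[OF L(1) tiling[unfolded translationally_tiling_def]]
  proof eventually_elim
    case (elim y)
    let ?S = "{m \<in> int_vecs. y + m \<in> ?W}"
    \<comment> \<open>The minus sign: a point \<open>\<xi>\<close> lies in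
      \<open>\<gamma> + W\<close> if and only if \<open>\<xi> - \<gamma>\<close> lies in
      \<open>W\<close>, whereas the locale adds integer vectors.\<close>
    let ?A = "(\<lambda>m. L *v (- m)) ` ?S"
    have "bounded ((\<lambda>x. x - y) ` ?W)" using bnd' by (rule bounded_translation_minus)
    moreover have "?S \<subseteq> int_vecs \<inter> (\<lambda>x. x - y) ` ?W"
      by (auto simp: image_iff intro!: bexI[where x = "y + _"])
    ultimately have fin: "finite ?S" using finite_bounded_int_vecs finite_subset by blast
    have inj: "inj_on (\<lambda>m. L *v (- m)) ?S"
      using injL by (auto intro!: inj_onI dest!: injD)
    have mem: "\<xi> \<in> (+) a ` W \<longleftrightarrow> \<xi> - a \<in> W" for \<xi> a :: "real ^ 'n"
    proof
      assume "\<xi> - a \<in> W"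
      then show "\<xi> \<in> (+) a ` W" by (rule rev_image_eqI) simp
    qed auto
    have A: "\<gamma> \<in> ?A \<longleftrightarrow> L *v y \<in> (+) \<gamma> ` W" if g: "\<gamma> \<in> \<Gamma>" for \<gamma>
    proof -
      obtain m where m: "m \<in> int_vecs" "\<gamma> = L *v m" using g L(2) by blast
      have "L *v y \<in> (+) \<gamma> ` W \<longleftrightarrow> L *v (y - m) \<in> W"
        unfolding m(2) mem matrix_vector_mult_diff_distrib ..
      also have "\<dots> \<longleftrightarrow> - m \<in> ?S" using int_vecs_closed(2)[OF m(1)] by simp
      also have "\<dots> \<longleftrightarrow> \<gamma> \<in> ?A"
      proof
        assume "- m \<in> ?S" then show "\<gamma> \<in> ?A" unfolding m(2) by (rule rev_image_eqI) simp
      next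
        assume "\<gamma> \<in> ?A"
        then obtain n where "n \<in> ?S" "L *v m = L *v (- n)" unfolding m(2) by blast
        then show "- m \<in> ?S" using injD[OF injL, of m "- n"] by simp
      qed
      finally show ?thesis by blast
    qed
    have "?A \<subseteq> \<Gamma>" unfolding L(2) using int_vecs_closed(2) by blast
    \<comment> \<open>Off \<open>?A\<close> the indicators vanish, so uniqueness of sums identifies
      \<open>k\<close> with the number of elements of \<open>?A\<close>.\<close>
    have "((\<lambda>_. 1 :: real) has_sum (\<Sum>_\<in>?A. 1)) ?A" using fin by (intro has_sum_finite) simp
    then have "((\<lambda>\<gamma>. indicator ((+) \<gamma> ` W) (L *v y) :: real) has_sum (\<Sum>_\<in>?A. 1)) \<Gamma>"
      using A \<open>?A \<subseteq> \<Gamma>\<close>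
      by (subst has_sum_cong_neutral[where T = ?A and g = "\<lambda>_. 1"]) (auto simp: indicator_def)
    then have "real k = (\<Sum>_\<in>?A. 1)" using elim has_sum_unique by blast
    then have "k = card ?A" by simp
    then show ?case using card_image[OF inj] by simp
  qed
  then have "integer_multitile ?W k"
    using W' bnd' k by unfold_locales
  then show ?thesis using that L(1) by blast
qed

theorem lattice_multitile:
  fixes W :: "(real ^ 'n) set"
  assumes "full_rank_lattice \<Gamma>" "k \<ge> 1" and W [measurable]: "W \<in> sets borel"
    and "bounded W" "translationally_tiling k \<Gamma> W"
  shows exponential_riesz_basis_lattice_multitile: "\<exists>\<Lambda>. exponential_riesz_basis \<Lambda> W"
    and emeasure_lattice_multitile: "emeasure lborel W > 0"
proof -
  obtain L :: "real ^ 'n ^ 'n" where L: "invertible L" and "integer_multitile ((*v) L -` W) k"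
    using lattice_multitile_pullback[OF assms] .
  then interpret integer_multitile "(*v) L -` W" k by simp
  show "\<exists>\<Lambda>. exponential_riesz_basis \<Lambda> W"
    using exponential_riesz_basis_exists exponential_riesz_basis_linear[OF L W] by blast
  have "emeasure lborel W = ennreal \<bar>det L\<bar> * (\<integral>\<^sup>+x. indicator W (L *v x) \<partial>lborel)"
    using nn_integral_lborel_linear[OF L, of "indicator W"] by simp
  also have "(\<integral>\<^sup>+x. indicator W (L *v x) \<partial>lborel) = (\<integral>\<^sup>+x. indicator ((*v) L -` W) x \<partial>lborel)"
    by (simp add: indicator_def)
  also have "\<dots> = of_nat k" using emeasure_multitile W_borel by simp
  finally show "emeasure lborel W > 0"
    using L k by (simp add: ennreal_zero_less_mult_iff invertible_det_nz)
qed

section \<open>Wavelets on the frequency side\<close>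

text \<open>Sorting a combination by its dilations leaves one exponential sum on \<open>W\<close>
  for each; the translations are negated because translation by \<open>-l\<close> appears as the
  character of \<open>l\<close> on the frequency side.\<close>

lemma sum_group_uminus:
  fixes F :: "('a \<times> 'b :: ab_group_add) set"
  assumes F: "finite F"
  shows "(\<Sum>p\<in>F. f p) = (\<Sum>a\<in>fst ` F. \<Sum>l\<in>{l. (a, - l) \<in> F}. f (a, - l))"
proof -
  let ?S = "Sigma (fst ` F) (\<lambda>a. {l. (a, - l) \<in> F})"
  let ?\<phi> = "\<lambda>(a, l). (a, - l)"
  have inj: "inj_on ?\<phi> ?S" by (auto simp: inj_on_def)
  have img: "?\<phi> ` ?S = F"
  proof (intro set_eqI iffI)
    fix p assume "p \<in> F"
    then have "(fst p, - snd p) \<in> ?S" by force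
    then show "p \<in> ?\<phi> ` ?S" by (rule rev_image_eqI) simp
  qed auto
  have fin: "finite {l. (a, - l) \<in> F}" for a
  proof -
    have "{l. (a, - l) \<in> F} \<subseteq> (\<lambda>p. - snd p) ` F" by force
    then show ?thesis using F finite_subset by blast
  qed
  have "(\<Sum>p\<in>F. f p) = (\<Sum>(a, l)\<in>?S. f (a, - l))"
    using sum.reindex[OF inj, of f] unfolding img by (simp add: o_def case_prod_unfold)
  also have "\<dots> = (\<Sum>a\<in>fst ` F. \<Sum>l\<in>{l. (a, - l) \<in> F}. f (a, - l))"
    using F fin by (intro sum.Sigma[symmetric]) auto
  finally show ?thesis .
qed

lemma sq_norm_truncation:
  assumes f: "f \<in> L2" and e: "e > 0"
  obtains n where "sq_norm (\<lambda>x. indicator (ball 0 (real n)) x * f x - f x) < ennreal e"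
proof -
  have "\<forall>\<^sub>F n in sequentially. sq_norm (\<lambda>x. indicator (ball 0 (real n)) x * f x - f x) < ennreal e"
    using e by (intro order_tendstoD(2)[OF truncation_tendsto(1)[OF f]]) simp
  then show ?thesis
    using eventually_happens'[OF sequentially_bot] that by blast
qed

lemma L2_indicator_bounded:
  fixes A :: "(real ^ 'n) set"
  assumes [measurable]: "A \<in> sets borel" "b \<in> borel_measurable borel" and "bounded A" "\<And>x. cmod (b x) \<le> 1"
  shows "(\<lambda>x. indicator A x * b x) \<in> L2"
proof -
  have "(indicator A :: real ^ 'n \<Rightarrow> complex) \<in> L2"
  proof -
    have "sq_norm (indicator A :: real ^ 'n \<Rightarrow> complex) = (\<integral>\<^sup>+x. indicator A x \<partial>lborel)"
      unfolding sq_norm_def by (rule nn_integral_cong) (simp split: split_indicator)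
    also have "\<dots> < \<infinity>" using emeasure_bounded_finite[OF \<open>bounded A\<close>] by simp
    finally show ?thesis by (simp add: L2_iff)
  qed
  then show ?thesis using assms by (intro L2_mult_bounded)
qed

declare transpose_matrix_vector [simp del]

locale dilation_tiling =
  fixes D :: "(real ^ 'n ^ 'n) set" and W :: "(real ^ 'n) set"
  assumes D_invertible: "A \<in> D \<Longrightarrow> invertible A"
    and W_borel [measurable]: "W \<in> sets borel" and W_bounded: "bounded W" and W_pos: "emeasure lborel W > 0"
    and unique: "AE \<eta> in lborel. \<exists>!A. A \<in> D \<and> transpose A *v \<eta> \<in> W"
begin

text \<open>For \<open>A\<close> in \<open>D\<close> this is \<open>A\<^sup>-\<^sup>T W\<close>,
  written as a preimage so that measurability is immediate.\<close>

abbreviation tile :: "real ^ 'n ^ 'n \<Rightarrow> (real ^ 'n) set" where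
  "tile A \<equiv> (*v) (transpose A) -` W"

lemma tile_borel [measurable]: "tile A \<in> sets borel"
  using measurable_sets[OF measurable_matrix_vector_mul[of "transpose A"], of W] by simp

lemma tile_bounded:
  assumes "A \<in> D" shows "bounded (tile A)"
proof -
  have inv: "invertible (transpose A)" using D_invertible[OF assms] by (rule transpose_invertible)
  have "tile A = (*v) (matrix_inv (transpose A)) ` W"
    using invertible_mul_matrix_inv[OF inv] by (auto simp: image_iff) metis
  then show ?thesis
    using W_bounded by (simp add: bounded_linear_image matrix_vector_mul_bounded_linear)
qed

lemma indicator_tile: "indicator W (transpose A *v \<eta>) = indicator (tile A) \<eta>"
  by (simp add: indicator_def)

text \<open>Almost every point lies in just one tile, so inside a ball the tile measures have
  bounded finite sums and only countably many are nonzero. Every tile has positive measure, as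
  \<open>W\<close> has, hence meets some ball of integer radius in positive measure.\<close>

lemma countable_D: "countable D"
proof -
  define \<mu> where "\<mu> n A = measure lborel (tile A \<inter> ball 0 (real n))" for n A
  have fin: "emeasure lborel (tile A \<inter> ball 0 (real n)) < \<infinity>" for A n
    by (intro emeasure_bounded_finite) auto
  have summ: "\<mu> n summable_on D" for n
  proof (rule nonneg_bdd_above_summable_on)
    show "0 \<le> \<mu> n A" for A by (simp add: \<mu>_def)
    show "bdd_above (sum (\<mu> n) ` {F. F \<subseteq> D \<and> finite F})"
    proof (rule bdd_aboveI2)
      fix F assume "F \<in> {F. F \<subseteq> D \<and> finite F}"
      then have F: "F \<subseteq> D" "finite F" by auto
      have "ennreal (sum (\<mu> n) F) = (\<Sum>A\<in>F. emeasure lborel (tile A \<inter> ball 0 (real n)))"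
        unfolding \<mu>_def using fin
        by (subst sum_ennreal[symmetric]) (auto simp: emeasure_eq_ennreal_measure less_top intro!: sum.cong)
      also have "\<dots> = (\<integral>\<^sup>+\<eta>. (\<Sum>A\<in>F. indicator (tile A \<inter> ball 0 (real n)) \<eta>) \<partial>lborel)"
      proof -
        have "(\<Sum>A\<in>F. emeasure lborel (tile A \<inter> ball 0 (real n)))
            = (\<Sum>A\<in>F. \<integral>\<^sup>+\<eta>. indicator (tile A \<inter> ball 0 (real n)) \<eta> \<partial>lborel)"
          by (intro sum.cong refl nn_integral_indicator[symmetric]) simp
        also have "\<dots> = (\<integral>\<^sup>+\<eta>. (\<Sum>A\<in>F. indicator (tile A \<inter> ball 0 (real n)) \<eta>) \<partial>lborel)"
          by (rule nn_integral_sum[symmetric]) (intro borel_measurable_indicator, simp)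
        finally show ?thesis .
      qed
      also have "\<dots> \<le> (\<integral>\<^sup>+\<eta>. indicator (ball 0 (real n)) \<eta> \<partial>(lborel :: (real ^ 'n) measure))"
      proof (rule nn_integral_mono_AE)
        show "AE \<eta> in lborel. (\<Sum>A\<in>F. indicator (tile A \<inter> ball 0 (real n)) \<eta>)
            \<le> (indicator (ball 0 (real n)) \<eta> :: ennreal)"
          using unique
        proof eventually_elim
          case (elim \<eta>)
          then obtain A0 where A0: "\<And>A. A \<in> D \<Longrightarrow> transpose A *v \<eta> \<in> W \<Longrightarrow> A = A0" by blast
          have "(\<Sum>A\<in>F. indicator (tile A \<inter> ball 0 (real n)) \<eta>)
              \<le> (\<Sum>A\<in>F. if A = A0 then indicator (ball 0 (real n)) \<eta> else (0 :: ennreal))"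
            using A0 F by (intro sum_mono) (auto split: split_indicator)
          also have "\<dots> \<le> indicator (ball 0 (real n)) \<eta>"
            using F by (simp add: sum.delta')
          finally show ?case .
        qed
      qed
      also have "\<dots> = ennreal (measure lborel (ball 0 (real n) :: (real ^ 'n) set))"
        using emeasure_bounded_finite[OF bounded_ball[of "0 :: real ^ 'n" "real n"]]
        by (simp add: emeasure_eq_ennreal_measure)
      finally show "sum (\<mu> n) F \<le> measure lborel (ball 0 (real n) :: (real ^ 'n) set)"
        by (subst (asm) ennreal_le_iff) auto
    qed
  qed
  have "D \<subseteq> (\<Union>n. {A \<in> D. \<mu> n A \<noteq> 0})"
  proof
    fix A assume A: "A \<in> D"
    have inv: "invertible (transpose A)" using D_invertible[OF A] by (rule transpose_invertible)
    have "emeasure lborel W = ennreal \<bar>det (transpose A)\<bar> * emeasure lborel (tile A)"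
      using nn_integral_lborel_linear[OF inv, of "indicator W"] by (simp add: indicator_tile)
    then have pos: "emeasure lborel (tile A) \<noteq> 0" using W_pos by auto
    have "tile A = (\<Union>n. tile A \<inter> ball 0 (real n))"
      by (auto intro: reals_Archimedean2)
    then have "\<exists>n. emeasure lborel (tile A \<inter> ball 0 (real n)) \<noteq> 0"
      using pos emeasure_UN_eq_0[of lborel "\<lambda>n. tile A \<inter> ball 0 (real n)"] by (auto simp: image_subset_iff)
    then obtain n where "emeasure lborel (tile A \<inter> ball 0 (real n)) \<noteq> 0" by blast
    then have "\<mu> n A \<noteq> 0" using fin[of A n] by (simp add: \<mu>_def measure_def enn2real_eq_0_iff)
    then show "A \<in> (\<Union>n. {A \<in> D. \<mu> n A \<noteq> 0})" using A by blast
  qed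
  moreover have "countable (\<Union>n. {A \<in> D. \<mu> n A \<noteq> 0})"
    using summable_countable_real[OF summ] by (intro countable_UN) auto
  ultimately show ?thesis by (rule countable_subset)
qed

section \<open>Atoms and their norms\<close>

definition scale :: "real ^ 'n ^ 'n \<Rightarrow> complex" where
  "scale A = of_real (\<bar>det A\<bar> powr (1 / 2))"

lemma scale: "A \<in> D \<Longrightarrow> scale A \<noteq> 0" "A \<in> D \<Longrightarrow> (cmod (scale A))\<^sup>2 = \<bar>det A\<bar>"
  using D_invertible[of A] by (simp_all add: scale_def powr_half_sqrt invertible_det_nz)

text \<open>At almost every point at most one summand survives, so no cross terms arise; the
  substitution by \<open>transpose A\<close> then absorbs the squared modulus
  \<open>\<bar>det A\<bar>\<close> of \<open>scale A\<close>. The Riesz constants therefore do not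
  depend on the dilations involved.\<close>

lemma sq_norm_orthogonal:
  assumes F: "finite F" "F \<subseteq> D" and Y [measurable]: "\<And>A. Y A \<in> borel_measurable borel"
  shows "sq_norm (\<lambda>\<eta>. \<Sum>A\<in>F. scale A * (indicator (tile A) \<eta> * Y A (transpose A *v \<eta>)))
    = (\<Sum>A\<in>F. sq_norm (\<lambda>\<zeta>. indicator W \<zeta> * Y A \<zeta>))"
proof -
  let ?t = "\<lambda>A \<eta>. scale A * (indicator (tile A) \<eta> * Y A (transpose A *v \<eta>))"
  have "sq_norm (\<lambda>\<eta>. \<Sum>A\<in>F. ?t A \<eta>) = (\<integral>\<^sup>+\<eta>. (\<Sum>A\<in>F. ennreal ((cmod (?t A \<eta>))\<^sup>2)) \<partial>lborel)"
    unfolding sq_norm_def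
  proof (rule nn_integral_cong_AE)
    show "AE \<eta> in lborel. ennreal ((cmod (\<Sum>A\<in>F. ?t A \<eta>))\<^sup>2) = (\<Sum>A\<in>F. ennreal ((cmod (?t A \<eta>))\<^sup>2))"
      using unique
    proof eventually_elim
      case (elim \<eta>)
      then obtain A0 where A0: "\<And>A. A \<in> D \<Longrightarrow> transpose A *v \<eta> \<in> W \<Longrightarrow> A = A0" by blast
      have zero: "?t A \<eta> = 0" if "A \<in> F" "A \<noteq> A0" for A
        using A0[of A] F(2) that by (auto split: split_indicator)
      have 1: "(\<Sum>A\<in>F. ?t A \<eta>) = (\<Sum>A\<in>F. if A = A0 then ?t A0 \<eta> else 0)"
        by (rule sum.cong) (use zero in auto)
      have 2: "(\<Sum>A\<in>F. ennreal ((cmod (?t A \<eta>))\<^sup>2)) = (\<Sum>A\<in>F. if A = A0 then ennreal ((cmod (?t A0 \<eta>))\<^sup>2) else 0)"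
        by (rule sum.cong) (use zero in auto)
      show ?case unfolding 1 2 using F(1) by (simp add: sum.delta')
    qed
  qed
  also have "\<dots> = (\<Sum>A\<in>F. sq_norm (?t A))"
    unfolding sq_norm_def by (rule nn_integral_sum) measurable
  also have "\<dots> = (\<Sum>A\<in>F. sq_norm (\<lambda>\<zeta>. indicator W \<zeta> * Y A \<zeta>))"
  proof (rule sum.cong[OF refl])
    fix A assume "A \<in> F"
    then have A: "A \<in> D" using F by blast
    have inv: "invertible (transpose A)" using D_invertible[OF A] by (rule transpose_invertible)
    have "sq_norm (?t A) = ennreal \<bar>det A\<bar> * sq_norm (\<lambda>\<eta>. indicator (tile A) \<eta> * Y A (transpose A *v \<eta>))"
      using scale(2)[OF A] by (subst sq_norm_cmult) auto
    also have "\<dots> = sq_norm (\<lambda>\<zeta>. indicator W \<zeta> * Y A \<zeta>)"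
      using sq_norm_linear[OF inv, of "\<lambda>\<zeta>. indicator W \<zeta> * Y A \<zeta>"]
      by (simp add: det_transpose indicator_tile)
    finally show "sq_norm (?t A) = sq_norm (\<lambda>\<zeta>. indicator W \<zeta> * Y A \<zeta>)" .
  qed
  finally show ?thesis .
qed

text \<open>The inverse Fourier transform of \<open>atom (A, l)\<close> is the wavelet with dilation
  \<open>A\<close> and translation \<open>l\<close>; see
  \<open>dilation_translation_eq\<close>.\<close>

definition atom :: "(real ^ 'n ^ 'n) \<times> (real ^ 'n) \<Rightarrow> real ^ 'n \<Rightarrow> complex" where
  "atom p \<eta> = scale (fst p) * (indicator (tile (fst p)) \<eta> * character (- snd p) (transpose (fst p) *v \<eta>))"

abbreviation atoms :: "((real ^ 'n ^ 'n) \<times> (real ^ 'n)) set \<Rightarrow> ((real ^ 'n ^ 'n) \<times> (real ^ 'n) \<Rightarrow> complex)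
    \<Rightarrow> real ^ 'n \<Rightarrow> complex" where
  "atoms F c \<equiv> \<lambda>\<eta>. \<Sum>p\<in>F. c p * atom p \<eta>"

lemma atom_L2: "p \<in> D \<times> \<Lambda> \<Longrightarrow> atom p \<in> L2"
  unfolding atom_def[abs_def] by (intro L2_cmult L2_indicator_bounded tile_bounded) auto

lemma atom_bounded_support: "p \<in> D \<times> \<Lambda> \<Longrightarrow> bounded_support (atom p)"
  unfolding atom_def[abs_def] by (intro bounded_support_cmult bounded_support_indicator tile_bounded) auto

lemma sum_atom_L2: "F \<subseteq> D \<times> \<Lambda> \<Longrightarrow> atoms F c \<in> L2"
  by (intro L2_sum L2_cmult atom_L2) auto

lemma sum_atom_bounded_support:
  "finite F \<Longrightarrow> F \<subseteq> D \<times> \<Lambda> \<Longrightarrow> bounded_support (atoms F c)"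
  by (intro bounded_support_sum bounded_support_cmult atom_bounded_support) auto

text \<open>Substituting \<open>\<zeta> = transpose A *v \<eta>\<close> pairs
  \<open>matrix_inv A *v x\<close> with \<open>\<zeta>\<close> to \<open>x \<bullet> \<eta>\<close>.
  The determinant enters with exponent \<open>- 1 / 2\<close> from the dilation and 1 from the
  substitution, which leaves the exponent \<open>1 / 2\<close> of \<open>scale\<close>.\<close>

lemma dilation_translation_eq:
  assumes A: "A \<in> D"
  shows "dilation A (translation l (fourier 1 (indicator W))) = fourier 1 (atom (A, l))"
proof
  fix x
  have invA: "invertible A" using D_invertible[OF A] .
  have inv: "invertible (transpose A)" using invA by (rule transpose_invertible)
  have char: "character (matrix_inv A *v x) (transpose A *v \<eta>) = character x \<eta>" for \<eta>
  proof -
    have "(matrix_inv A *v x) \<bullet> (transpose A *v \<eta>) = (\<eta> v* A) \<bullet> (matrix_inv A *v x)"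
      by (simp add: inner_commute transpose_matrix_vector)
    also have "\<dots> = x \<bullet> \<eta>"
      unfolding dot_lmul_matrix invertible_mul_matrix_inv(1)[OF invA] by (rule inner_commute)
    finally show ?thesis by (simp only: character_def)
  qed
  have "fourier 1 (indicator W) (matrix_inv A *v x - l)
      = \<bar>det (transpose A)\<bar> *\<^sub>R (\<integral>\<eta>. indicator W (transpose A *v \<eta>) *
          character (1 *\<^sub>R (matrix_inv A *v x - l)) (transpose A *v \<eta>) \<partial>lborel)"
    unfolding fourier_def by (rule lborel_integral_linear[OF inv]) measurable
  also have "(\<lambda>\<eta>. indicator W (transpose A *v \<eta>) *
          character (1 *\<^sub>R (matrix_inv A *v x - l)) (transpose A *v \<eta>))
      = (\<lambda>\<eta>. indicator (tile A) \<eta> * character (- l) (transpose A *v \<eta>) * character (1 *\<^sub>R x) \<eta>)"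
  proof
    fix \<eta>
    have "character (matrix_inv A *v x + - l) (transpose A *v \<eta>) = character x \<eta> * character (- l) (transpose A *v \<eta>)"
      unfolding character_simps(1) char ..
    then show "indicator W (transpose A *v \<eta>) * character (1 *\<^sub>R (matrix_inv A *v x - l)) (transpose A *v \<eta>)
       = indicator (tile A) \<eta> * character (- l) (transpose A *v \<eta>) * character (1 *\<^sub>R x) \<eta>"
      unfolding indicator_tile by (simp add: mult_ac)
  qed
  finally have F: "fourier 1 (indicator W) (matrix_inv A *v x - l)
      = of_real \<bar>det A\<bar> * (\<integral>\<eta>. indicator (tile A) \<eta> * character (- l) (transpose A *v \<eta>) * character (1 *\<^sub>R x) \<eta> \<partial>lborel)"
    by (simp add: det_transpose scaleR_conv_of_real)
  have d: "\<bar>det A\<bar> powr (- 1 / 2) * \<bar>det A\<bar> = \<bar>det A\<bar> powr (1 / 2)"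
    using powr_add[of "\<bar>det A\<bar>" "- 1 / 2" 1] invA by (simp add: invertible_det_nz)
  have "dilation A (translation l (fourier 1 (indicator W))) x
      = of_real (\<bar>det A\<bar> powr (- 1 / 2) * \<bar>det A\<bar>) *
        (\<integral>\<eta>. indicator (tile A) \<eta> * character (- l) (transpose A *v \<eta>) * character (1 *\<^sub>R x) \<eta> \<partial>lborel)"
    unfolding dilation_def translation_def F by (simp add: mult.assoc)
  also have "\<dots> = scale A * (\<integral>\<eta>. indicator (tile A) \<eta> * character (- l) (transpose A *v \<eta>) * character (1 *\<^sub>R x) \<eta> \<partial>lborel)"
    unfolding d scale_def ..
  also have "\<dots> = fourier 1 (atom (A, l)) x"
    unfolding fourier_def atom_def integral_mult_right_zero[symmetric] by (simp add: mult_ac)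
  finally show "dilation A (translation l (fourier 1 (indicator W))) x = fourier 1 (atom (A, l)) x" .
qed

lemma sum_wavelets_eq:
  assumes F: "F \<subseteq> D \<times> \<Lambda>"
  shows "(\<Sum>p\<in>F. c p * (case p of (A, l) \<Rightarrow> dilation A (translation l (fourier 1 (indicator W)))) x)
    = fourier 1 (atoms F c) x"
proof -
  have "(case p of (A, l) \<Rightarrow> dilation A (translation l (fourier 1 (indicator W)))) = fourier 1 (atom p)"
    if "p \<in> F" for p
    using F that dilation_translation_eq by (cases p) auto
  moreover have "integrable lborel (\<lambda>\<eta>. c p * atom p \<eta>)" if "p \<in> F" for p
    using F that L2_bounded_support_integrable[OF atom_L2 atom_bounded_support, of p]
    by (intro integrable_mult_right) auto
  ultimately show ?thesis
    by (subst fourier_sum) (auto simp: fourier_cmult intro!: sum.cong)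
qed

lemma sq_norm_sum_atom:
  assumes F: "finite F" "F \<subseteq> D \<times> \<Lambda>"
  shows "sq_norm (atoms F c)
    = (\<Sum>A\<in>fst ` F. sq_norm (\<lambda>\<zeta>. indicator W \<zeta> * (\<Sum>l\<in>{l. (A, - l) \<in> F}. c (A, - l) * character l \<zeta>)))"
proof -
  have "atoms F c \<eta> = (\<Sum>A\<in>fst ` F. scale A * (indicator (tile A) \<eta> *
      (\<Sum>l\<in>{l. (A, - l) \<in> F}. c (A, - l) * character l (transpose A *v \<eta>))))" for \<eta>
    unfolding sum_group_uminus[OF F(1)] sum_distrib_left by (simp add: atom_def mult_ac)
  then show ?thesis
    using F by (simp only:) (intro sq_norm_orthogonal, auto)
qed

text \<open>Finitely many tiles carry most of \<open>h\<close>, by countability of \<open>D\<close>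
  and dominated convergence. Each such piece is pulled back to \<open>W\<close>, approximated there
  by exponentials, and pushed forward; by orthogonality the squared errors add up.\<close>

lemma atoms_dense:
  assumes \<Lambda>: "exponentials_dense \<Lambda> W" and h: "h \<in> L2" and e: "e > 0"
  obtains F c where "finite F" "F \<subseteq> D \<times> uminus ` \<Lambda>" "sq_norm (\<lambda>\<eta>. h \<eta> - atoms F c \<eta>) < ennreal e"
proof -
  have [measurable]: "h \<in> borel_measurable borel" using h by (rule L2_measurable)
  \<comment> \<open>\<open>range_from_nat_into\<close> enumerates nonempty sets; without dilations
    no point would lie in a tile.\<close>
  have "D \<noteq> {}"
  proof
    assume "D = {}"
    have "AE \<eta> :: real ^ 'n in lborel. False"
      using unique
    proof eventually_elim
      case (elim \<eta>)
      then obtain A where "A \<in> D" by blast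
      then show False using \<open>D = {}\<close> by simp
    qed
    then have "emeasure lborel (UNIV :: (real ^ 'n) set) = 0"
      by (subst (asm) AE_iff_measurable[of UNIV]) auto
    then show False by simp
  qed
  then have rng: "range (from_nat_into D) = D" using countable_D by (rule range_from_nat_into)
  define En where "En n = from_nat_into D ` {..<n}" for n
  have En: "finite (En n)" "En n \<subseteq> D" for n using rng by (auto simp: En_def)
  define u where "u n \<eta> = (\<Sum>A\<in>En n. indicator (tile A) \<eta> * h \<eta>)" for n \<eta>
  have [measurable]: "u n \<in> borel_measurable borel" for n
    unfolding u_def by measurable
  \<comment> \<open>The single tile through \<open>\<eta>\<close> decides: \<open>u n \<eta>\<close>
    is 0 until that tile has been enumerated and \<open>h \<eta>\<close> from then on.\<close>
  have u_cases: "AE \<eta> in lborel. \<exists>A0\<in>D. \<forall>n. u n \<eta> = (if A0 \<in> En n then h \<eta> else 0)"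
    using unique
  proof eventually_elim
    case (elim \<eta>)
    define A0 where "A0 = (THE A. A \<in> D \<and> transpose A *v \<eta> \<in> W)"
    have A0: "A0 \<in> D" "transpose A0 *v \<eta> \<in> W"
      using theI'[OF elim] unfolding A0_def by simp_all
    have A0_unique: "A = A0" if "A \<in> D" "transpose A *v \<eta> \<in> W" for A
      using the1_equality[OF elim, of A] that unfolding A0_def by simp
    have "u n \<eta> = (if A0 \<in> En n then h \<eta> else 0)" for n
    proof -
      have "u n \<eta> = (\<Sum>A\<in>En n. if A = A0 then h \<eta> else 0)"
        unfolding u_def
      proof (rule sum.cong[OF refl])
        fix A assume "A \<in> En n"
        then have "A \<in> D" using En(2) by blast
        then have "\<eta> \<in> tile A \<longleftrightarrow> A = A0" using A0(2) A0_unique[of A] by auto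
        then show "indicator (tile A) \<eta> * h \<eta> = (if A = A0 then h \<eta> else 0)"
          by (simp add: indicator_def)
      qed
      then show ?thesis using En(1) by (simp add: sum.delta')
    qed
    then show ?case using A0(1) by (intro bexI[of _ A0]) simp_all
  qed
  have "(\<lambda>n. sq_norm (\<lambda>x. u n x - h x)) \<longlonglongrightarrow> 0"
  proof (rule sq_norm_dominated[where w = "\<lambda>x. ennreal ((cmod (h x))\<^sup>2)"])
    show "AE x in lborel. ennreal ((cmod (u n x - h x))\<^sup>2) \<le> ennreal ((cmod (h x))\<^sup>2)" for n
      using u_cases by eventually_elim auto
    show "AE x in lborel. (\<lambda>n. u n x) \<longlonglongrightarrow> h x"
      using u_cases
    proof eventually_elim
      case (elim x)
      then obtain A0 where A0: "A0 \<in> D" "\<And>n. u n x = (if A0 \<in> En n then h x else 0)" by blast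
      obtain n0 where "from_nat_into D n0 = A0" using A0(1) rng by (metis imageE)
      then have "A0 \<in> En n" if "n \<ge> Suc n0" for n
        using that unfolding En_def by (intro image_eqI[of _ _ n0]) auto
      then have "\<forall>\<^sub>F n in sequentially. u n x = h x"
        unfolding eventually_sequentially using A0(2) by (intro exI[of _ "Suc n0"]) simp
      then show ?case by (rule tendsto_eventually)
    qed
  qed (use h in \<open>simp_all add: L2_iff sq_norm_def\<close>)
  then have "\<forall>\<^sub>F n in sequentially. sq_norm (\<lambda>x. u n x - h x) < ennreal (e / 4)"
    using e by (intro order_tendstoD) auto
  then obtain n where "sq_norm (\<lambda>x. u n x - h x) < ennreal (e / 4)"
    using eventually_happens'[OF sequentially_bot] by blast
  then have n: "sq_norm (\<lambda>x. h x - u n x) < ennreal (e / 4)"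
    using sq_norm_diff_commute[of h "u n"] by simp
  \<comment> \<open>The sum of the errors stays below \<open>e / 8\<close>; the added 1 allows for
    an empty \<open>En n\<close>.\<close>
  define \<delta> where "\<delta> = e / (8 * (1 + real (card (En n))))"
  have \<delta>: "\<delta> > 0" "real (card (En n)) * \<delta> < e / 4"
    using e by (auto simp: \<delta>_def field_simps add_pos_nonneg)
  \<comment> \<open>Chosen so that \<open>scale A * Y A (transpose A *v \<eta>)\<close> is
    \<open>h \<eta>\<close> for \<open>A\<close> in \<open>D\<close>.\<close>
  define Y where "Y A \<zeta> = (1 / scale A) * h (matrix_inv (transpose A) *v \<zeta>)" for A \<zeta>
  have inv: "invertible (transpose A)" if "A \<in> D" for A
    using D_invertible[OF that] by (rule transpose_invertible)
  have Y_L2: "Y A \<in> L2" if "A \<in> D" for A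
  proof -
    have "invertible (matrix_inv (transpose A))"
      using matrix_inv[OF inv[OF that]] unfolding invertible_def by blast
    from L2_linear[OF this h] show ?thesis unfolding Y_def[abs_def] by (rule L2_cmult)
  qed
  let ?Q = "\<lambda>A q. finite (fst q) \<and> fst q \<subseteq> \<Lambda> \<and> (A \<in> D \<longrightarrow>
      sq_norm (\<lambda>x. indicator W x * (Y A x - exp_sum (fst q) (snd q) x)) < ennreal \<delta>)"
  have "\<exists>q. ?Q A q" for A
  proof (cases "A \<in> D")
    case True
    obtain G d where "finite G" "G \<subseteq> \<Lambda>"
      "sq_norm (\<lambda>x. indicator W x * (Y A x - exp_sum G d x)) < ennreal \<delta>"
      by (rule exponentials_denseD[OF \<Lambda> Y_L2[OF True] \<delta>(1)])
    then show ?thesis by (intro exI[of _ "(G, d)"]) simp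
  next
    case False
    then show ?thesis by (intro exI[of _ "({}, \<lambda>_. 0)"]) simp
  qed
  then obtain q where q: "?Q A (q A)" for A
    using choice[of ?Q] by blast
  define G where "G A = fst (q A)" for A
  define d where "d A = snd (q A)" for A
  have G: "finite (G A)" "G A \<subseteq> \<Lambda>" for A using q unfolding G_def by blast+
  have Gd: "sq_norm (\<lambda>x. indicator W x * (Y A x - (\<Sum>l\<in>G A. d A l * character l x))) < ennreal \<delta>" if "A \<in> D" for A
    using q that unfolding G_def d_def by blast
  let ?\<phi> = "\<lambda>(A, l). (A, - l)"
  let ?S = "Sigma (En n) G"
  define F where "F = ?\<phi> ` ?S"
  define c where "c p = d (fst p) (- snd p)" for p
  have inj: "inj_on ?\<phi> ?S" by (auto simp: inj_on_def)
  have F: "finite F" "F \<subseteq> D \<times> uminus ` \<Lambda>"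
    using En G unfolding F_def by (auto simp: subset_iff)
  have sum_F: "atoms F c \<eta>
     = (\<Sum>A\<in>En n. scale A * (indicator (tile A) \<eta> * (\<Sum>l\<in>G A. d A l * character l (transpose A *v \<eta>))))" for \<eta>
  proof -
    have "atoms F c \<eta> = (\<Sum>(A, l)\<in>?S. d A l * atom (A, - l) \<eta>)"
      unfolding F_def by (subst sum.reindex[OF inj]) (simp add: c_def case_prod_unfold)
    also have "\<dots> = (\<Sum>A\<in>En n. \<Sum>l\<in>G A. d A l * atom (A, - l) \<eta>)"
      using En(1) G(1) by (intro sum.Sigma[symmetric]) auto
    also have "\<dots> = (\<Sum>A\<in>En n. scale A * (indicator (tile A) \<eta> * (\<Sum>l\<in>G A. d A l * character l (transpose A *v \<eta>))))"
      unfolding sum_distrib_left by (simp add: atom_def mult_ac)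
    finally show ?thesis .
  qed
  let ?E = "\<lambda>A \<zeta>. Y A \<zeta> - (\<Sum>l\<in>G A. d A l * character l \<zeta>)"
  have diff: "u n \<eta> - atoms F c \<eta>
     = (\<Sum>A\<in>En n. scale A * (indicator (tile A) \<eta> * ?E A (transpose A *v \<eta>)))" for \<eta>
    unfolding sum_F u_def sum_subtractf[symmetric]
  proof (rule sum.cong[OF refl])
    fix A assume "A \<in> En n"
    then have A: "A \<in> D" using En by blast
    have "scale A * Y A (transpose A *v \<eta>) = h \<eta>"
      using scale(1)[OF A] invertible_mul_matrix_inv(2)[OF inv[OF A], of \<eta>] by (simp add: Y_def)
    then show "indicator (tile A) \<eta> * h \<eta> - scale A * (indicator (tile A) \<eta> * (\<Sum>l\<in>G A. d A l * character l (transpose A *v \<eta>)))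
      = scale A * (indicator (tile A) \<eta> * ?E A (transpose A *v \<eta>))"
      by (simp add: right_diff_distrib mult.left_commute)
  qed
  have [measurable]: "Y A \<in> borel_measurable borel" for A
    unfolding Y_def by measurable
  have "sq_norm (\<lambda>\<eta>. u n \<eta> - atoms F c \<eta>) = (\<Sum>A\<in>En n. sq_norm (\<lambda>\<zeta>. indicator W \<zeta> * ?E A \<zeta>))"
    unfolding diff by (rule sq_norm_orthogonal[OF En]) measurable
  also have "\<dots> \<le> (\<Sum>A\<in>En n. ennreal \<delta>)"
    using Gd En(2) by (intro sum_mono less_imp_le) auto
  also have "\<dots> = ennreal (real (card (En n)) * \<delta>)"
    using \<delta> by (simp add: ennreal_mult' flip: ennreal_of_nat_eq_real_of_nat)
  also have "\<dots> < ennreal (e / 4)" using \<delta> e by (simp add: ennreal_less_iff)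
  finally have close: "sq_norm (\<lambda>\<eta>. u n \<eta> - atoms F c \<eta>) < ennreal (e / 4)" .
  have "sq_norm (\<lambda>\<eta>. h \<eta> - atoms F c \<eta>) < ennreal (2 * (e / 4) + 2 * (e / 4))"
    using n close L2_measurable[OF sum_atom_L2[OF F(2), of c]]
    by (intro sq_norm_triangle[where g = "u n"]) auto
  then show ?thesis using that[OF F] by simp
qed

text \<open>The frequencies are negated because the atom for \<open>l\<close> carries the character
  of \<open>-l\<close>. Density needs two truncations: \<open>f\<close> is cut off in space so that
  its transform is an integral, and this transform is cut off in frequency so that its inverse
  transform is one.\<close>

theorem wavelet_set:
  assumes \<Lambda>: "exponential_riesz_basis \<Lambda> W"
  shows "riesz_wavelet_set (uminus ` \<Lambda>) D W"
proof -
  let ?\<psi> = "fourier 1 (indicator W)"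
  let ?g = "\<lambda>(A, l). dilation A (translation l ?\<psi>)"
  let ?I = "D \<times> uminus ` \<Lambda>"
  have W_L2: "(indicator W :: real ^ 'n \<Rightarrow> complex) \<in> L2"
    using L2_indicator_bounded[of W "\<lambda>_. 1"] W_bounded by simp
  have W_supp: "bounded_support (indicator W :: real ^ 'n \<Rightarrow> complex)"
    using bounded_support_indicator[OF W_bounded, of "\<lambda>_. 1"] by simp
  have atom_sum: "fourier 1 (atoms F c) \<in> L2"
    "sq_norm (fourier 1 (atoms F c)) = sq_norm (atoms F c)"
    if "finite F" "F \<subseteq> ?I" for F c
    using plancherel[OF sum_atom_L2[OF that(2)] sum_atom_bounded_support[OF that], of 1] by auto
  have sum_g: "(\<lambda>x. \<Sum>p\<in>F. c p * ?g p x) = fourier 1 (atoms F c)" if "F \<subseteq> ?I" for F c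
    using sum_wavelets_eq[OF that] by (intro ext) simp
  have "\<forall>p\<in>?I. ?g p \<in> L2"
  proof
    fix p assume p: "p \<in> ?I"
    have "fourier 1 (atom p) \<in> L2"
      by (rule plancherel(1)[OF atom_L2[OF p] atom_bounded_support[OF p]]) simp
    then show "?g p \<in> L2" using p dilation_translation_eq by (cases p) auto
  qed
  moreover have "\<forall>f\<in>L2. \<forall>\<epsilon>>0. \<exists>F c. finite F \<and> F \<subseteq> ?I \<and> L2_norm (\<lambda>x. f x - (\<Sum>p\<in>F. c p * ?g p x)) < \<epsilon>"
  proof (intro ballI allI impI)
    fix f :: "real ^ 'n \<Rightarrow> complex" and \<epsilon> :: real assume f: "f \<in> L2" and \<epsilon>: "\<epsilon> > 0"
    \<comment> \<open>Squared distances are compared: the allowances \<open>e / 16\<close> and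
      \<open>e / 16\<close> combine to \<open>e / 4\<close>, and this with the spatial truncation
      error \<open>e / 4\<close> to \<open>e\<close>, since each use of
      \<open>sq_norm_triangle\<close> doubles the sum.\<close>
    define e where "e = \<epsilon>\<^sup>2"
    have e: "e > 0" using \<epsilon> by (simp add: e_def)
    obtain m where m: "sq_norm (\<lambda>x. indicator (ball 0 (real m)) x * f x - f x) < ennreal (e / 4)"
      using sq_norm_truncation[OF f, of "e / 4"] e by auto
    define f1 where "f1 x = indicator (ball 0 (real m)) x * f x" for x
    have f1: "f1 \<in> L2" "bounded_support f1"
      unfolding f1_def[abs_def] using f by (auto intro: L2_indicator_mult bounded_support_indicator)
    have Ff1: "fourier (-1) f1 \<in> L2" by (rule plancherel(1)[OF f1]) simp
    obtain n where n: "sq_norm (\<lambda>\<eta>. indicator (ball 0 (real n)) \<eta> * fourier (-1) f1 \<eta> - fourier (-1) f1 \<eta>) < ennreal (e / 16)"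
      using sq_norm_truncation[OF Ff1, of "e / 16"] e by auto
    define H where "H \<eta> = indicator (ball 0 (real n)) \<eta> * fourier (-1) f1 \<eta>" for \<eta>
    have H: "H \<in> L2" "bounded_support H"
      unfolding H_def[abs_def] using Ff1 by (auto intro: L2_indicator_mult bounded_support_indicator)
    have FH: "fourier 1 H \<in> L2" by (rule plancherel(1)[OF H]) simp
    \<comment> \<open>The error made by truncating in frequency reappears with the same size in
      space.\<close>
    have "L2_norm (\<lambda>x. fourier 1 H x - f1 x) = L2_norm (\<lambda>\<eta>. H \<eta> - fourier (-1) f1 \<eta>)"
      using fourier_inverse_distance[OF f1 H, of "-1"] by simp
    then have "sq_norm (\<lambda>x. fourier 1 H x - f1 x) = sq_norm (\<lambda>\<eta>. H \<eta> - fourier (-1) f1 \<eta>)"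
      by (subst (asm) L2_norm_eq_sq_norm) (auto intro: L2_diff FH f1 H Ff1)
    then have fH: "sq_norm (\<lambda>x. f1 x - fourier 1 H x) < ennreal (e / 16)"
      using n sq_norm_diff_commute[of f1 "fourier 1 H"] by (simp add: H_def)
    obtain F c where F: "finite F" "F \<subseteq> ?I"
      and Hc: "sq_norm (\<lambda>\<eta>. H \<eta> - atoms F c \<eta>) < ennreal (e / 16)"
      using atoms_dense[of \<Lambda> H "e / 16"] \<Lambda> H(1) e unfolding exponential_riesz_basis_def by auto
    let ?s = "atoms F c"
    have s: "?s \<in> L2" "bounded_support ?s"
      using sum_atom_L2[OF F(2)] sum_atom_bounded_support[OF F] by blast+
    have "sq_norm (\<lambda>x. fourier 1 H x - fourier 1 ?s x) = sq_norm (fourier 1 (\<lambda>\<eta>. H \<eta> - ?s \<eta>))"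
      unfolding fourier_diff[OF L2_bounded_support_integrable[OF H] L2_bounded_support_integrable[OF s], symmetric] ..
    also have "\<dots> = sq_norm (\<lambda>\<eta>. H \<eta> - ?s \<eta>)"
      by (rule plancherel(2)[OF L2_diff[OF H(1) s(1)] bounded_support_diff[OF H(2) s(2)]]) simp
    finally have Hs: "sq_norm (\<lambda>x. fourier 1 H x - fourier 1 ?s x) < ennreal (e / 16)"
      using Hc by simp
    note meas = L2_measurable[OF f] L2_measurable[OF f1(1)] L2_measurable[OF FH] L2_measurable[OF atom_sum(1)[OF F]]
    have "sq_norm (\<lambda>x. f1 x - fourier 1 ?s x) < ennreal (2 * (e / 16) + 2 * (e / 16))"
      by (rule sq_norm_triangle[OF meas(2,3,4) fH Hs])
    then have 1: "sq_norm (\<lambda>x. f1 x - fourier 1 ?s x) < ennreal (e / 4)" by simp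
    have 2: "sq_norm (\<lambda>x. f x - f1 x) < ennreal (e / 4)"
      using m sq_norm_diff_commute[of f f1] by (simp add: f1_def)
    have "sq_norm (\<lambda>x. f x - fourier 1 ?s x) < ennreal (2 * (e / 4) + 2 * (e / 4))"
      by (rule sq_norm_triangle[OF meas(1,2,4) 2 1])
    then have "sq_norm (\<lambda>x. f x - fourier 1 ?s x) < ennreal (\<epsilon>\<^sup>2)" by (simp add: e_def)
    then have "(L2_norm (\<lambda>x. f x - fourier 1 ?s x))\<^sup>2 < \<epsilon>\<^sup>2"
      unfolding sq_norm_L2[OF L2_diff[OF f atom_sum(1)[OF F]]] by (simp add: ennreal_less_iff)
    then have "L2_norm (\<lambda>x. f x - fourier 1 ?s x) < \<epsilon>"
      using \<epsilon> by (intro power_less_imp_less_base[of _ 2 \<epsilon>]) auto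
    moreover have "(\<Sum>p\<in>F. c p * ?g p x) = fourier 1 ?s x" for x
      using sum_wavelets_eq[OF F(2)] by simp
    ultimately show "\<exists>F c. finite F \<and> F \<subseteq> ?I \<and> L2_norm (\<lambda>x. f x - (\<Sum>p\<in>F. c p * ?g p x)) < \<epsilon>"
      using F by (intro exI[of _ F] exI[of _ c]) simp
  qed
  moreover have "\<exists>C1 C2. 0 < C1 \<and> C1 \<le> C2 \<and> (\<forall>F c. finite F \<and> F \<subseteq> ?I \<longrightarrow>
      C1 * (\<Sum>p\<in>F. (cmod (c p))\<^sup>2) \<le> (L2_norm (\<lambda>x. \<Sum>p\<in>F. c p * ?g p x))\<^sup>2 \<and>
      (L2_norm (\<lambda>x. \<Sum>p\<in>F. c p * ?g p x))\<^sup>2 \<le> C2 * (\<Sum>p\<in>F. (cmod (c p))\<^sup>2))"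
  proof -
    obtain C1 C2 where B: "exponential_riesz_bounds C1 C2 \<Lambda> W"
      using \<Lambda> unfolding exponential_riesz_basis_def by blast
    note C = exponential_riesz_boundsD(1,2)[OF B]
    \<comment> \<open>Each dilation in \<open>F\<close> contributes one exponential sum on
      \<open>W\<close> with frequencies in \<open>\<Lambda>\<close>; the squared norms add, so the
      constants of \<open>W\<close> serve for the whole family.\<close>
    have bounds: "C1 * (\<Sum>p\<in>F. (cmod (c p))\<^sup>2) \<le> (L2_norm (\<lambda>x. \<Sum>p\<in>F. c p * ?g p x))\<^sup>2
      \<and> (L2_norm (\<lambda>x. \<Sum>p\<in>F. c p * ?g p x))\<^sup>2 \<le> C2 * (\<Sum>p\<in>F. (cmod (c p))\<^sup>2)"
      if F: "finite F" "F \<subseteq> ?I" for F c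
    proof -
      let ?L = "\<lambda>A. {l. (A, - l) \<in> F}"
      define s where "s A = (\<Sum>l\<in>?L A. (cmod (c (A, - l)))\<^sup>2)" for A
      have s_nonneg: "s A \<ge> 0" for A unfolding s_def by (intro sum_nonneg) auto
      have L: "finite (?L A)" "?L A \<subseteq> \<Lambda>" for A
      proof -
        have "?L A \<subseteq> (\<lambda>p. - snd p) ` F" by force
        then show "finite (?L A)" using F(1) finite_subset by blast
        show "?L A \<subseteq> \<Lambda>" using F(2) by auto
      qed
      have S: "(\<Sum>p\<in>F. (cmod (c p))\<^sup>2) = (\<Sum>A\<in>fst ` F. s A)"
        unfolding s_def by (rule sum_group_uminus[OF F(1)])
      have N: "ennreal ((L2_norm (\<lambda>x. \<Sum>p\<in>F. c p * ?g p x))\<^sup>2)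
          = (\<Sum>A\<in>fst ` F. sq_norm (\<lambda>\<zeta>. indicator W \<zeta> * (\<Sum>l\<in>?L A. c (A, - l) * character l \<zeta>)))"
        unfolding sum_g[OF F(2)] sq_norm_L2[OF atom_sum(1)[OF F], symmetric] atom_sum(2)[OF F] sq_norm_sum_atom[OF F] ..
      have E: "ennreal (K * (\<Sum>p\<in>F. (cmod (c p))\<^sup>2)) = (\<Sum>A\<in>fst ` F. ennreal (K * s A))" if "K \<ge> 0" for K
        unfolding S sum_distrib_left using s_nonneg that by (subst sum_ennreal) auto
      have "ennreal (C1 * (\<Sum>p\<in>F. (cmod (c p))\<^sup>2)) \<le> ennreal ((L2_norm (\<lambda>x. \<Sum>p\<in>F. c p * ?g p x))\<^sup>2)"
        unfolding N E[OF less_imp_le[OF C(1)]] s_def by (intro sum_mono exponential_riesz_boundsD(3)[OF B] L)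
      moreover have "ennreal ((L2_norm (\<lambda>x. \<Sum>p\<in>F. c p * ?g p x))\<^sup>2) \<le> ennreal (C2 * (\<Sum>p\<in>F. (cmod (c p))\<^sup>2))"
        unfolding N E[OF order_trans[OF less_imp_le[OF C(1)] C(2)]] s_def
        by (intro sum_mono exponential_riesz_boundsD(4)[OF B] L)
      moreover have "0 \<le> C2 * (\<Sum>p\<in>F. (cmod (c p))\<^sup>2)"
        using C by (intro mult_nonneg_nonneg sum_nonneg) auto
      ultimately show ?thesis
        by (simp add: ennreal_le_iff del: ennreal_le_iff2)
    qed
    show ?thesis using C bounds by blast
  qed
  ultimately have "riesz_basis_L2 ?I ?g"
    unfolding riesz_basis_L2_def by blast
  moreover have "?\<psi> \<in> L2" by (rule plancherel(1)[OF W_L2 W_supp]) simp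
  ultimately have "riesz_wavelet (uminus ` \<Lambda>) D ?\<psi>"
    unfolding riesz_wavelet_def by blast
  \<comment> \<open>The normalization constant is 1, since \<open>?\<psi>\<close> is the inverse
    transform of the indicator itself.\<close>
  moreover have "is_fourier_transform ?\<psi> (\<lambda>\<zeta>. 1 * indicator W \<zeta>)"
    using is_fourier_transform_inverse[OF W_L2 W_supp] by simp
  ultimately show ?thesis
    unfolding riesz_wavelet_set_def using W_borel by (intro conjI exI[of _ 1] exI[of _ ?\<psi>]) auto
qed

end

theorem theorem1p2:
  fixes D :: "(real ^ 'n ^ 'n) set"
    and \<Gamma> W :: "(real ^ 'n) set"
    and k :: nat
  assumes "\<And>A. A \<in> D \<Longrightarrow> invertible A"
    and "full_rank_lattice \<Gamma>"
    and "k \<ge> 1"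
    and "W \<in> sets borel" and "bounded W" and "frontier W \<in> null_sets lborel"
    and "translationally_tiling k \<Gamma> W"
    and "multiplicatively_tiling ((\<lambda>A. transpose (matrix_inv A)) ` D) W"
  shows "\<exists>\<Lambda> :: (real ^ 'n) set. riesz_wavelet_set \<Lambda> D W"
proof -
  let ?T = "\<lambda>A :: real ^ 'n ^ 'n. transpose (matrix_inv A)"
  obtain \<Lambda> where \<Lambda>: "exponential_riesz_basis \<Lambda> W"
    using exponential_riesz_basis_lattice_multitile[OF assms(2-5,7)] by blast
  have mem: "\<xi> \<in> (*v) (?T A) ` W \<longleftrightarrow> transpose A *v \<xi> \<in> W" if A: "A \<in> D" for A \<xi>
  proof -
    have "transpose A ** ?T A = mat 1" "?T A ** transpose A = mat 1"
      using matrix_inv[OF assms(1)[OF A]] by (simp_all flip: matrix_transpose_mul)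
    then have "transpose A *v (?T A *v x) = x" "?T A *v (transpose A *v x) = x" for x
      by (simp_all add: matrix_vector_mul_assoc)
    then show ?thesis by (auto simp: image_iff) metis
  qed
  \<comment> \<open>The tiling hypothesis sums over the set of the matrices \<open>?T A\<close>;
    injectivity allows summing over \<open>D\<close> instead.\<close>
  have inj: "inj_on ?T D"
  proof (rule inj_onI)
    fix A B assume AB: "A \<in> D" "B \<in> D" "?T A = ?T B"
    then have eq: "matrix_inv A = matrix_inv B" by (metis transpose_transpose)
    have "A = A ** (matrix_inv B ** B)" using matrix_inv(2)[OF assms(1)[OF AB(2)]] by simp
    also have "\<dots> = B"
      unfolding matrix_mul_assoc eq[symmetric] matrix_inv(1)[OF assms(1)[OF AB(1)]] by simp
    finally show "A = B" .
  qed
  have "AE \<xi> in lborel. \<exists>!A. A \<in> D \<and> transpose A *v \<xi> \<in> W"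
    using assms(8)[unfolded multiplicatively_tiling_def]
  proof eventually_elim
    case (elim \<xi>)
    define f where "f A = (indicator ((*v) (?T A) ` W) \<xi> :: real)" for A
    have f: "(f has_sum 1) D"
      using elim unfolding has_sum_reindex[OF inj] f_def o_def .
    have fv: "f A = of_bool (transpose A *v \<xi> \<in> W)" if "A \<in> D" for A
      using mem[OF that, of \<xi>] by (simp add: f_def indicator_def)
    \<comment> \<open>A sum of zeros and ones with value 1: it would be 0 without a nonzero term and
      at least 2 with two of them.\<close>
    have "\<exists>A\<in>D. transpose A *v \<xi> \<in> W"
    proof (rule ccontr)
      assume "\<not> ?thesis"
      then have "(f has_sum 0) D" using fv by (intro has_sum_0) auto
      then show False using f has_sum_unique by fastforce
    qed
    moreover have "A = B" if "A \<in> D" "B \<in> D" "transpose A *v \<xi> \<in> W" "transpose B *v \<xi> \<in> W" for A B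
    proof (rule ccontr)
      assume "A \<noteq> B"
      then have "sum f {A, B} = 2" using that fv by simp
      moreover have "sum f {A, B} \<le> 1"
        by (rule finite_sum_le_has_sum[OF f]) (use that in \<open>auto simp: f_def\<close>)
      ultimately show False by simp
    qed
    ultimately show ?case by blast
  qed
  then interpret dilation_tiling D W
    using assms(1,4,5) emeasure_lattice_multitile[OF assms(2-5,7)] by unfold_locales
  show ?thesis using wavelet_set[OF \<Lambda>] by blast
qed

end
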